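(* Let $n\ge 2$, let $p$ be a prime, let $\eta>0$, and let $H:\mathcal{S}_\eta^n\to\mathbb{C}$ be a holomorphic function which is symmetric (invariant under all permutations of its $n$ arguments), where $\mathcal{S}_\eta=\{z\in\mathbb{C}: p^{-\eta}<|z|_{\mathbb{C}}<p^{\eta}\}$. Define $H^{\flat}:Z(\mathbb{Q}_p)\backslash T(\mathbb{Q}_p)\to\mathbb{C}$ by $$H^{\flat}(t)=\frac{1}{n!\,(2\pi i)^{n-1}}\int_{\mathbb{T}} H(\beta)\,W_{1/\beta}(t)\prod_{\substack{i,j=1\\ i\neq j}}^n(\beta_i-\beta_j)\,\frac{d\beta_1\cdots d\beta_{n-1}}{\beta_1\cdots\beta_{n-1}},$$ where $\mathbb{T}=\{(\beta_1,\dots,\beta_{n-1})\in\mathbb{C}^{n-1}:|\beta_i|_{\mathbb{C}}=1\}$, $\beta_n=\frac{1}{\beta_1\cdots\beta_{n-1}}$, $\beta=(\beta_1,\dots,\beta_n)$ and $1/\beta=(1/\beta_1,\dots,1/\beta_n)$. Assume that the Whittaker transform $(H^{\flat})^{\sharp}(\alpha)=\int_{T(\mathbb{Z}_p)\backslash T(\mathbb{Q}_p)}H^{\flat}(t)W_\alpha(t)\,d^\times t$ converges absolutely for all $\alpha\in\mathcal{S}_\eta^n$. Then $$(H^{\flat})^{\sharp}(\alpha)=H(\alpha)$$ for every $\alpha=(\alpha_1,\dots,\alpha_n)\in\mathcal{S}_\eta^n$ with $\alpha_1\cdots\alpha_n=1$.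
   Context: $T(\mathbb{Q}_p)$ is the group of invertible diagonal $n\times n$ matrices over $\mathbb{Q}_p$, $Z(\mathbb{Q}_p)$ the scalar matrices, $T(\mathbb{Z}_p)$ the diagonal matrices with entries in $\mathbb{Z}_p^\times$. Every class in $Z(\mathbb{Q}_p)\backslash T(\mathbb{Q}_p)$ has a unique representative $t=\mathrm{diag}(t_1\cdots t_{n-1},\ t_1\cdots t_{n-2},\ \dots,\ t_1,\ 1)$ with $t_1,\dots,t_{n-1}\in\mathbb{Q}_p^\times$, and functions on $Z\backslash T$ are written in these coordinates. Throughout, $\log$ denotes the base-$p$ logarithm, so $-\log|t_k|_p=v_p(t_k)$, and $-\log|t|_p=(-\log|t_1|_p,\dots,-\log|t_{n-1}|_p)$. Set $\delta(t)=\prod_{k=1}^{n-1}|t_k|_p^{k(n-k)}$. Schur polynomial: for $\lambda=(\lambda_1,\dots,\lambda_{n-1})\in\mathbb{Z}^{n-1}$ and $\alpha=(\alpha_1,\dots,\alpha_n)$ with nonzero (distinct, then extended by continuity) entries, $s_\lambda(\alpha)=\det(A)/\det(V)$, where $A$ is the $n\times n$ matrix whose row $r$ ($r=1,\dots,n$) has entries $\alpha_j^{\,n-r+\lambda_1+\cdots+\lambda_{n-r}}$, $j=1,\dots,n$ (the row $r=n$ being all $1$'s), and $V$ is the Vandermonde matrix with row $r$ equal to $(\alpha_j^{\,n-r})_j$. For $\alpha\in(\mathbb{C}\setminus\{0\})^n$, $W_\alpha(t)=\delta^{1/2}(t)\,s_{-\log|t|_p}(\alpha)$ if $t_i\in\mathbb{Z}_p$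 for all $i=1,\dots,n-1$, and $W_\alpha(t)=0$ otherwise. Whittaker transform: for $h:Z(\mathbb{Q}_p)\backslash T(\mathbb{Q}_p)\to\mathbb{C}$, $h^\sharp(\alpha)=\int_{T(\mathbb{Z}_p)\backslash T(\mathbb{Q}_p)}h(t)W_\alpha(t)\,d^\times t$ with $d^\times t=\prod_{k=1}^{n-1}|t_k|_p^{-k(n-k)}\frac{dt_k}{|t_k|_p}$, where $dt_k/|t_k|_p$ is the Haar measure on $\mathbb{Q}_p^\times$ giving $\mathbb{Z}_p^\times$ volume $1$; concretely, for $h$ invariant under $(\mathbb{Z}_p^\times)^{n-1}$ in the coordinates $t_k$, this integral equals $\sum_{m\in\mathbb{Z}^{n-1}}h(p^m)W_\alpha(p^m)\prod_{k=1}^{n-1}p^{k(n-k)m_k}$, where $p^m$ denotes the point with $t_k=p^{m_k}$. *)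

theory Defs
  imports "HOL-Analysis.Analysis" "HOL-Combinatorics.Permutations" "Jordan_Normal_Form.Determinant"
begin

(* Conventions: tuples alpha = (alpha_1,...,alpha_n) are functions nat => complex, indexed by
   {1..n} (extensional: value undefined outside).  Points p^m of Z\T, m in Z^(n-1), are
   functions nat => int indexed by {1..n-1}, i.e. elements of {1..<n} ->E UNIV. *)

definition annulus :: "nat \<Rightarrow> real \<Rightarrow> complex set" where
  "annulus p \<eta> = {z. real p powr (- \<eta>) < cmod z \<and> cmod z < real p powr \<eta>}"

text \<open>The matrix A of the definition of the Schur polynomial (rows/columns 0-based here:
  JNF row i corresponds to row r = i+1 of the paper, column j to alpha_(j+1)).\<close>
definition schur_num_mat :: "nat \<Rightarrow> (nat \<Rightarrow> int) \<Rightarrow> (nat \<Rightarrow> complex) \<Rightarrow> complex Matrix.mat" where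
  "schur_num_mat n lam \<alpha> = Matrix.mat n n (\<lambda>(i, j).
      \<alpha> (j + 1) powi (int (n - (i + 1)) + (\<Sum>k\<in>{1..n - (i + 1)}. lam k)))"

definition vandermonde_mat :: "nat \<Rightarrow> (nat \<Rightarrow> complex) \<Rightarrow> complex Matrix.mat" where
  "vandermonde_mat n \<alpha> = Matrix.mat n n (\<lambda>(i, j). \<alpha> (j + 1) ^ (n - (i + 1)))"

definition schur_ratio :: "nat \<Rightarrow> (nat \<Rightarrow> int) \<Rightarrow> (nat \<Rightarrow> complex) \<Rightarrow> complex" where
  "schur_ratio n lam \<alpha> = Determinant.det (schur_num_mat n lam \<alpha>) / Determinant.det (vandermonde_mat n \<alpha>)"

definition distinct_nonzero :: "nat \<Rightarrow> (nat \<Rightarrow> complex) set" where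
  "distinct_nonzero n = {\<beta> \<in> {1..n} \<rightarrow>\<^sub>E (- {0}). inj_on \<beta> {1..n}}"

definition schur :: "nat \<Rightarrow> (nat \<Rightarrow> int) \<Rightarrow> (nat \<Rightarrow> complex) \<Rightarrow> complex" where
  "schur n lam \<alpha> = (if inj_on \<alpha> {1..n} then schur_ratio n lam \<alpha>
                    else Lim (at \<alpha> within distinct_nonzero n) (schur_ratio n lam))"

text \<open>delta^(1/2)(p^m) = prod_k |p^(m_k)|_p^(k(n-k)/2).\<close>
definition delta_half :: "nat \<Rightarrow> nat \<Rightarrow> (nat \<Rightarrow> int) \<Rightarrow> real" where
  "delta_half n p m = real p powr (- (\<Sum>k\<in>{1..<n}. real (k * (n - k)) * real_of_int (m k)) / 2)"

text \<open>W_alpha(p^m); note -log|t_k|_p = v_p(t_k) = m_k, and t_k in Z_p iff m_k >= 0.\<close>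
definition whittaker :: "nat \<Rightarrow> nat \<Rightarrow> (nat \<Rightarrow> complex) \<Rightarrow> (nat \<Rightarrow> int) \<Rightarrow> complex" where
  "whittaker n p \<alpha> m = (if \<forall>k\<in>{1..<n}. 0 \<le> m k
       then complex_of_real (delta_half n p m) * schur n m \<alpha> else 0)"

text \<open>Density factor prod_k p^(k(n-k) m_k) of d^x t at p^m.\<close>
definition measure_factor :: "nat \<Rightarrow> nat \<Rightarrow> (nat \<Rightarrow> int) \<Rightarrow> complex" where
  "measure_factor n p m = complex_of_real (\<Prod>k\<in>{1..<n}. real p powi (int (k * (n - k)) * m k))"

definition whittaker_summand ::
  "nat \<Rightarrow> nat \<Rightarrow> ((nat \<Rightarrow> int) \<Rightarrow> complex) \<Rightarrow> (nat \<Rightarrow> complex) \<Rightarrow> (nat \<Rightarrow> int) \<Rightarrow> complex" where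
  "whittaker_summand n p h \<alpha> m = h m * whittaker n p \<alpha> m * measure_factor n p m"

definition lattice_pts :: "nat \<Rightarrow> (nat \<Rightarrow> int) set" where
  "lattice_pts n = {1..<n} \<rightarrow>\<^sub>E (UNIV :: int set)"

definition whittaker_transform ::
  "nat \<Rightarrow> nat \<Rightarrow> ((nat \<Rightarrow> int) \<Rightarrow> complex) \<Rightarrow> (nat \<Rightarrow> complex) \<Rightarrow> complex" where
  "whittaker_transform n p h \<alpha> = (\<Sum>\<^sub>\<infinity>m\<in>lattice_pts n. whittaker_summand n p h \<alpha> m)"

text \<open>Holomorphic in n variables on the polydomain U^n: continuous and holomorphic in each
  variable separately (equivalent to joint holomorphy by Osgood's lemma).\<close>
definition holomorphic_n :: "nat \<Rightarrow> complex set \<Rightarrow> ((nat \<Rightarrow> complex) \<Rightarrow> complex) \<Rightarrow> bool" where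
  "holomorphic_n n U H \<longleftrightarrow>
     continuous_on ({1..n} \<rightarrow>\<^sub>E U) H \<and>
     (\<forall>\<alpha>\<in>{1..n} \<rightarrow>\<^sub>E U. \<forall>k\<in>{1..n}. (\<lambda>z. H (\<alpha>(k := z))) holomorphic_on U)"

definition symmetric_n :: "nat \<Rightarrow> complex set \<Rightarrow> ((nat \<Rightarrow> complex) \<Rightarrow> complex) \<Rightarrow> bool" where
  "symmetric_n n U H \<longleftrightarrow>
     (\<forall>\<sigma>. \<sigma> permutes {1..n} \<longrightarrow> (\<forall>\<alpha>\<in>{1..n} \<rightarrow>\<^sub>E U. H (\<alpha> \<circ> \<sigma>) = H \<alpha>))"

definition torus_pt :: "nat \<Rightarrow> (nat \<Rightarrow> real) \<Rightarrow> nat \<Rightarrow> complex" where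
  "torus_pt n \<theta> = (\<lambda>k. if k \<in> {1..<n} then cis (\<theta> k)
                       else if k = n then 1 / (\<Prod>l\<in>{1..<n}. cis (\<theta> l)) else undefined)"

definition inv_tuple :: "nat \<Rightarrow> (nat \<Rightarrow> complex) \<Rightarrow> nat \<Rightarrow> complex" where
  "inv_tuple n \<beta> = (\<lambda>k. if k \<in> {1..n} then 1 / \<beta> k else undefined)"

text \<open>H^flat(p^m): the torus integral, parametrised by beta_k = exp(i theta_k), theta_k in [0,2pi],
  so that d beta_k/beta_k = i d theta_k and the factor (2 pi i)^(n-1) becomes (2 pi)^(n-1).\<close>
definition H_flat :: "nat \<Rightarrow> nat \<Rightarrow> ((nat \<Rightarrow> complex) \<Rightarrow> complex) \<Rightarrow> (nat \<Rightarrow> int) \<Rightarrow> complex" where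
  "H_flat n p H m = complex_of_real (1 / (fact n * (2 * pi) ^ (n - 1))) *
     (LINT \<theta> | (\<Pi>\<^sub>M k\<in>{1..<n}. lebesgue_on {0..2 * pi}).
        H (torus_pt n \<theta>) * whittaker n p (inv_tuple n (torus_pt n \<theta>)) m *
        (\<Prod>i\<in>{1..n}. \<Prod>j\<in>{1..n} - {i}. torus_pt n \<theta> i - torus_pt n \<theta> j))"

end

theory Submission
  imports Defs "HOL-Complex_Analysis.Complex_Analysis"
begin

text \<open>Let \<open>V\<close> be the Vandermonde determinant. The function \<open>H V\<close> is antisymmetric and holomorphic on a product of
  annuli, hence has an absolutely convergent Laurent expansion with antisymmetric coefficients \<open>a\<^sub>e\<close>,
  \<open>e \<in> \<int>\<^sup>n\<close>. On the torus \<open>\<beta>\<^sub>1 \<cdots> \<beta>\<^sub>n = 1\<close> the product of all differences \<open>\<beta>\<^sub>i - \<beta>\<^sub>j\<close> is \<open>V(\<beta>) V(1/\<beta>)\<close>, so the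
  integral defining the flat function of \<open>H\<close> at \<open>p\<^sup>m\<close> is, up to the modulus factor, the Fourier coefficient of \<open>H V\<close> at the
  exponents of the alternant numerator of \<open>s\<^sub>m\<close>, that is, the sum of \<open>a\<^sub>e\<close> over a coset of \<open>\<int> (1, \<dots>, 1)\<close>.
  Grouping the Laurent series at a point with \<open>\<alpha>\<^sub>1 \<cdots> \<alpha>\<^sub>n = 1\<close> by the orbits of the symmetric group and these cosets
  turns it into the series of the Whittaker transform multiplied by \<open>V(\<alpha>)\<close>. Dividing by \<open>V\<close> is harmless where the \<open>\<alpha>\<^sub>i\<close>
  are distinct; other points are reached along a holomorphic curve of points with distinct coordinates,
  the maximum principle making the convergence uniform up to the limit point.\<close>

section \<open>Laurent series on an annulus\<close>

text \<open>Multiplying by \<open>V\<close> adapts the expansion to Schur functions: s_m V is a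
  signed sum of monomials, so orthogonality of Schur functions on the torus becomes orthogonality of
  characters, and antisymmetry leaves one free coefficient for each orbit of exponents with distinct
  entries. The expansion uses all n variables, although only points with product 1 matter, because
  there the symmetric group simply permutes exponents; the price is the sum over shifts by (1, ...,
  1), which such points cannot distinguish. The prime enters only through the radius p^\<eta> and
  the modulus factors: \<delta>^(1/2) occurs once in \<open>H_flat\<close> and once in the Whittaker
  function, and together they cancel the density \<delta>^(-1) of the measure. The obstacle is at
  points with coincident coordinates. There the regrouped identity reads 0 = 0, and the regrouping
  supplies a summable majorant for c_m s_m V but not for c_m s_m, so a limit cannot simply be taken
  term by term.\<close>

definition open_ring :: "real \<Rightarrow> complex set" where
  "open_ring R = {z. 1 / R < cmod z \<and> cmod z < R}"

definition closed_ring :: "real \<Rightarrow> complex set" where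
  "closed_ring \<rho> = {z. 1 / \<rho> \<le> cmod z \<and> cmod z \<le> \<rho>}"

lemma open_open_ring: "open (open_ring R)"
proof -
  have "open_ring R = {z. 1 / R < cmod z} \<inter> {z. cmod z < R}" by (auto simp: open_ring_def)
  thus ?thesis by (auto intro!: open_Collect_less continuous_intros open_Int)
qed

lemma compact_closed_ring: "compact (closed_ring \<rho>)"
proof -
  have "closed_ring \<rho> = {z. 1 / \<rho> \<le> cmod z} \<inter> cball 0 \<rho>" by (auto simp: closed_ring_def)
  thus ?thesis by (auto intro!: closed_Collect_le continuous_intros closed_Int_compact)
qed

lemma closed_ring_subset_open_ring: "0 < \<rho> \<Longrightarrow> \<rho> < R \<Longrightarrow> closed_ring \<rho> \<subseteq> open_ring R"
  by (auto simp: closed_ring_def open_ring_def intro: less_le_trans[OF divide_strict_left_mono])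

lemma closed_ring_mono: "0 < \<rho> \<Longrightarrow> \<rho> \<le> \<sigma> \<Longrightarrow> closed_ring \<rho> \<subseteq> closed_ring \<sigma>"
  by (auto simp: closed_ring_def intro: order_trans[OF divide_left_mono])

lemma zero_notin_open_ring: "0 < R \<Longrightarrow> 0 \<notin> open_ring R"
  by (auto simp: open_ring_def)

lemma mem_open_ring_imp_closed_ring:
  assumes "z \<in> open_ring R" "1 < R"
  obtains \<rho> where "1 < \<rho>" "\<rho> < R" "z \<in> closed_ring \<rho>"
proof -
  have z: "1 / R < cmod z" "cmod z < R" using assms by (auto simp: open_ring_def)
  have "0 < 1 / R" using assms by simp
  hence "0 < cmod z" using z by linarith
  have "1 / cmod z < R" using z \<open>0 < cmod z\<close> assms by (simp add: field_simps)
  then obtain \<rho> where \<rho>: "max 1 (max (cmod z) (1 / cmod z)) < \<rho>" "\<rho> < R"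
    using dense[of "max 1 (max (cmod z) (1 / cmod z))" R] z assms by auto
  have "1 / \<rho> \<le> cmod z" using \<rho> \<open>0 < cmod z\<close> by (simp add: field_simps)
  thus ?thesis using that[of \<rho>] \<rho> by (auto simp: closed_ring_def)
qed

text \<open>The ring is stable under inversion, so a single weight \<rho>^|k| serves positive and
  negative powers.\<close>

lemma norm_powi_closed_ring_le:
  assumes "z \<in> closed_ring \<rho>" "0 < \<rho>"
  shows "norm (z powi k) \<le> \<rho> ^ nat \<bar>k\<bar>"
proof (cases "k \<ge> 0")
  case True
  thus ?thesis using assms by (auto simp: power_int_def norm_power closed_ring_def intro!: power_mono)
next
  case False
  have z: "1 / \<rho> \<le> cmod z" using assms by (auto simp: closed_ring_def)
  have "0 < 1 / \<rho>" using assms by simp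
  hence "0 < cmod z" using z by linarith
  hence "inverse (cmod z) \<le> \<rho>" using z assms by (simp add: field_simps)
  thus ?thesis using False by (auto simp: power_int_def norm_power norm_inverse power_inverse[symmetric] intro!: power_mono)
qed

lemma summable_on_geometric_int:
  fixes q :: real
  assumes "0 \<le> q" "q < 1"
  shows "(\<lambda>k::int. q ^ nat \<bar>k\<bar>) summable_on UNIV"
proof -
  have nat: "(\<lambda>n::nat. q ^ n) summable_on UNIV"
    using assms by (auto intro!: summable_nonneg_imp_summable_on summable_geometric)
  have "(\<lambda>k::int. q ^ nat \<bar>k\<bar>) summable_on range int"
    by (subst summable_on_reindex) (use nat in \<open>auto simp: o_def\<close>)
  moreover have "(\<lambda>k::int. q ^ nat \<bar>k\<bar>) summable_on range (\<lambda>n. - int n)"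
    by (subst summable_on_reindex) (use nat in \<open>auto simp: o_def inj_on_def\<close>)
  ultimately have "(\<lambda>k::int. q ^ nat \<bar>k\<bar>) summable_on (range int \<union> range (\<lambda>n. - int n))"
    by (rule summable_on_union)
  also have "range int \<union> range (\<lambda>n. - int n) = UNIV"
  proof -
    have "k \<in> range int \<union> range (\<lambda>n. - int n)" for k :: int
      by (cases k rule: int_cases2) auto
    thus ?thesis by blast
  qed
  finally show ?thesis .
qed

text \<open>The straight-line homotopy between two concentric circles moves every point along its
  own ray, so the modulus is a convex combination of the radii and stays inside the ring.\<close>

lemma contour_integral_circlepath_open_ring_eq:
  assumes f: "f holomorphic_on open_ring R"
    and r: "1 / R < r" "r < R" and s: "1 / R < s" "s < R" and "0 < R"
  shows "contour_integral (circlepath 0 r) f = contour_integral (circlepath 0 s) f"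
proof (rule Cauchy_theorem_homotopic_loops[OF _ open_open_ring f])
  have "0 < 1 / R" using \<open>0 < R\<close> by simp
  hence pos: "0 < r" "0 < s" using r s by linarith+
  show "homotopic_loops (open_ring R) (circlepath 0 r) (circlepath 0 s)"
  proof (rule homotopic_loops_linear)
    fix t :: real assume "t \<in> {0..1}"
    show "closed_segment (circlepath 0 r t) (circlepath 0 s t) \<subseteq> open_ring R"
    proof
      fix w assume "w \<in> closed_segment (circlepath 0 r t) (circlepath 0 s t)"
      then obtain u where u: "0 \<le> u" "u \<le> 1"
        and w: "w = (1 - u) *\<^sub>R circlepath 0 r t + u *\<^sub>R circlepath 0 s t"
        by (auto simp: in_segment)
      have "w = of_real ((1 - u) * r + u * s) * exp (2 * of_real pi * \<i> * of_real t)"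
        by (simp add: w circlepath scaleR_conv_of_real algebra_simps)
      moreover have "norm (exp (2 * of_real pi * \<i> * of_real t)) = 1"
        by (metis (no_types, opaque_lifting) mult.assoc mult.commute norm_exp_i_times of_real_mult of_real_numeral)
      moreover have "0 \<le> (1 - u) * r + u * s" using u pos by simp
      ultimately have n: "norm w = (1 - u) * r + u * s" by (simp only: norm_mult norm_of_real) simp
      have "(1 - u) * r + u * s < R"
        using convex_bound_lt[of r R s "1 - u" u] r s u by simp
      \<comment> \<open>The lower bound on the modulus is an upper bound for the negated
        radii.\<close>
      moreover have "(1 - u) * (- r) + u * (- s) < - (1 / R)"
        using convex_bound_lt[of "- r" "- (1 / R)" "- s" "1 - u" u] r s u by simp
      ultimately show "w \<in> open_ring R" using n by (simp add: open_ring_def)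
    qed
  qed auto
qed auto

definition laurent_coeff :: "(complex \<Rightarrow> complex) \<Rightarrow> int \<Rightarrow> complex" where
  "laurent_coeff f k = contour_integral (circlepath 0 1) (\<lambda>w. f w * w powi (- k - 1)) / (2 * pi * \<i>)"

lemma holomorphic_on_laurent_integrand:
  assumes "f holomorphic_on open_ring R" "0 < R"
  shows "(\<lambda>w. f w * w powi k) holomorphic_on open_ring R"
  using assms zero_notin_open_ring[of R] by (intro holomorphic_intros) auto

text \<open>The Cauchy estimate on the outer circle for k \<ge> 0 and on the inner circle for k < 0
  gives decay \<rho>^(-|k|) in both directions.\<close>

lemma norm_laurent_coeff_le:
  assumes f: "f holomorphic_on open_ring R" and \<rho>: "1 \<le> \<rho>" "\<rho> < R"
    and M: "\<And>z. z \<in> closed_ring \<rho> \<Longrightarrow> norm (f z) \<le> M"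
  shows "norm (laurent_coeff f k) * \<rho> ^ nat \<bar>k\<bar> \<le> M"
proof -
  have "0 < R" using \<rho> by simp
  define r where "r = (if k \<ge> 0 then \<rho> else 1 / \<rho>)"
  have r: "0 < r" "1 / \<rho> \<le> r" "r \<le> \<rho>" using \<rho>
    by (auto simp: r_def field_simps) (smt (verit, best) mult_le_cancel_right1)+
  have "1 / R < 1 / \<rho>" using \<rho> by (intro divide_strict_left_mono) auto
  hence rR: "1 / R < r" "r < R" using r \<rho> by linarith+
  have hol: "(\<lambda>w. f w * w powi (- k - 1)) holomorphic_on open_ring R"
    using f \<open>0 < R\<close> by (rule holomorphic_on_laurent_integrand)
  have "1 / R < 1" using \<rho> by simp
  hence eq: "contour_integral (circlepath 0 1) (\<lambda>w. f w * w powi (- k - 1)) =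
         contour_integral (circlepath 0 r) (\<lambda>w. f w * w powi (- k - 1))" (is "_ = ?I")
    by (intro contour_integral_circlepath_open_ring_eq[OF hol]) (use rR \<rho> in auto)
  have sub: "sphere 0 r \<subseteq> open_ring R" using rR by (auto simp: open_ring_def)
  have "((\<lambda>w. f w * w powi (- k - 1)) has_contour_integral ?I) (circlepath 0 r)"
    using r sub
    by (intro has_contour_integral_integral contour_integrable_continuous_circlepath
        holomorphic_on_imp_continuous_on holomorphic_on_subset[OF hol]) auto
  moreover have M0: "0 \<le> M" using order_trans[OF norm_ge_zero[of "f 1"] M[of 1]] \<rho> by (simp add: closed_ring_def)
  moreover have "norm (f w * w powi (- k - 1)) \<le> M * r powi (- k - 1)" if "norm (w - 0) = r" for w
    using that M[of w] r by (auto simp: norm_mult norm_power_int closed_ring_def intro!: mult_right_mono)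
  ultimately have "norm ?I \<le> M * r powi (- k - 1) * (2 * pi * r)"
    using r by (intro has_contour_integral_bound_circlepath) auto
  also have "\<dots> = M * r powi (- k) * (2 * pi)"
    using r by (simp add: power_int_diff)
  finally have "norm (laurent_coeff f k) \<le> M * r powi (- k)"
    by (simp add: laurent_coeff_def eq norm_divide norm_mult field_simps)
  hence "norm (laurent_coeff f k) * \<rho> ^ nat \<bar>k\<bar> \<le> (M * r powi (- k)) * \<rho> ^ nat \<bar>k\<bar>"
    using \<rho> by (intro mult_right_mono) auto
  also have "\<dots> = M * (r powi (- k) * \<rho> ^ nat \<bar>k\<bar>)" by simp
  also have "r powi (- k) * \<rho> ^ nat \<bar>k\<bar> = 1"
    using \<rho> by (auto simp: r_def power_int_def power_inverse power_divide)
  finally show ?thesis by simp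
qed

text \<open>The point lies in a ring of radius \<sigma>, and the Cauchy bound is taken on a larger
  ring of radius \<rho>; the terms are then dominated by a two-sided geometric series of ratio
  \<sigma>/\<rho>.\<close>

lemma laurent_terms_summable:
  assumes f: "f holomorphic_on open_ring R" and R: "1 < R" and z: "z \<in> open_ring R"
  shows "(\<lambda>k. laurent_coeff f k * z powi k) summable_on UNIV"
proof -
  obtain \<sigma> where \<sigma>: "1 < \<sigma>" "\<sigma> < R" "z \<in> closed_ring \<sigma>"
    using mem_open_ring_imp_closed_ring[OF z R] .
  obtain \<rho> where \<rho>: "\<sigma> < \<rho>" "\<rho> < R" using dense \<sigma> by blast
  have "continuous_on (closed_ring \<rho>) f"
    using closed_ring_subset_open_ring[of \<rho> R] \<rho> \<sigma> f
    by (intro holomorphic_on_imp_continuous_on holomorphic_on_subset[OF f]) auto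
  hence "bounded (f ` closed_ring \<rho>)"
    by (intro compact_imp_bounded compact_continuous_image compact_closed_ring)
  then obtain M where M: "\<And>w. w \<in> closed_ring \<rho> \<Longrightarrow> norm (f w) \<le> M"
    by (auto simp: bounded_iff)
  have "(\<lambda>k. norm (laurent_coeff f k * z powi k)) summable_on UNIV"
  proof (rule Infinite_Sum.abs_summable_on_comparison_test')
    show "(\<lambda>k::int. M * (\<sigma> / \<rho>) ^ nat \<bar>k\<bar>) summable_on UNIV"
      by (intro summable_on_cmult_right summable_on_geometric_int) (use \<sigma> \<rho> in auto)
    fix k :: int
    have "norm (laurent_coeff f k) \<le> M / \<rho> ^ nat \<bar>k\<bar>"
      using norm_laurent_coeff_le[OF f _ \<rho>(2) M, of k] \<sigma> \<rho> by (simp add: field_simps)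
    hence "norm (laurent_coeff f k) * norm (z powi k) \<le> M / \<rho> ^ nat \<bar>k\<bar> * \<sigma> ^ nat \<bar>k\<bar>"
      using norm_powi_closed_ring_le[OF \<sigma>(3), of k] \<sigma> by (intro mult_mono) (auto intro: order_trans[OF norm_ge_zero])
    thus "norm (laurent_coeff f k * z powi k) \<le> M * (\<sigma> / \<rho>) ^ nat \<bar>k\<bar>"
      by (simp add: norm_mult power_divide)
  qed
  thus ?thesis by (rule abs_summable_summable)
qed

lemma contour_integral_unit_circle_powi:
  "contour_integral (circlepath 0 1) (\<lambda>w. w powi (- k - 1)) = (if k = 0 then 2 * pi * \<i> else 0)"
proof (cases "k = 0")
  case True
  have "((\<lambda>w. 1 / (w - 0)) has_contour_integral 2 * of_real pi * \<i> * 1) (circlepath 0 1)"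
    using Cauchy_integral_circlepath_simple[of "\<lambda>_. 1" 0 1 0] by simp
  thus ?thesis using True by (auto intro!: contour_integral_unique simp: power_int_minus field_simps)
next
  case False
  have "((\<lambda>w. w powi (- k - 1)) has_contour_integral
      (pathfinish (circlepath 0 1) powi (- k) / of_int (- k) - pathstart (circlepath 0 1) powi (- k) / of_int (- k)))
      (circlepath 0 1)"
  proof (rule contour_integral_primitive[where S = "- {0}"])
    fix x :: complex assume "x \<in> - {0}"
    thus "((\<lambda>w. w powi (- k) / of_int (- k)) has_field_derivative x powi (- k - 1)) (at x within - {0})"
      using False by (auto intro!: derivative_eq_intros)
  qed auto
  thus ?thesis using False by (auto intro!: contour_integral_unique)
qed

text \<open>The divided difference \<open>g w = (f w - f z) / (w - z)\<close> is holomorphic on the annulus, and the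
  Laurent coefficients of \<open>f w - f z = (w - z) * g w\<close> make the series at \<open>z\<close> telescope.\<close>
lemma laurent_series:
  assumes f: "f holomorphic_on open_ring R" and R: "1 < R" and z: "z \<in> open_ring R"
  shows "((\<lambda>k. laurent_coeff f k * z powi k) has_sum f z) UNIV"
proof -
  define g where "g w = (if w = z then deriv f z else (f w - f z) / (w - z))" for w
  have g: "g holomorphic_on open_ring R"
    unfolding g_def by (rule pole_lemma_open[OF f open_open_ring])
  have fg: "f w = f z + (w - z) * g w" for w by (simp add: g_def)
  have "z \<noteq> 0" using z R zero_notin_open_ring[of R] by auto
  have sub: "sphere 0 1 \<subseteq> open_ring R" using R by (auto simp: open_ring_def)
  have int: "(\<lambda>w. h w * w powi k) contour_integrable_on circlepath 0 1"
    if "h holomorphic_on open_ring R" for h k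
    using R sub
    by (intro contour_integrable_continuous_circlepath holomorphic_on_imp_continuous_on
        holomorphic_on_subset[OF holomorphic_on_laurent_integrand[OF that]]) auto
  \<comment> \<open>Multiplying by w lowers the coefficient index by one, so (w - z) * g w
    contributes a difference of neighbouring coefficients of g.\<close>
  have rel: "laurent_coeff f k = (if k = 0 then f z else 0) + laurent_coeff g (k - 1) - z * laurent_coeff g k" for k
  proof -
    have "contour_integral (circlepath 0 1) (\<lambda>w. f w * w powi (- k - 1)) =
      contour_integral (circlepath 0 1) (\<lambda>w. f z * w powi (- k - 1) + g w * w powi (- (k - 1) - 1) - z * (g w * w powi (- k - 1)))"
    proof (rule contour_integral_eq)
      fix w :: complex assume "w \<in> path_image (circlepath 0 1)"
      hence "w \<noteq> 0" by auto
      hence "w * w powi (- k - 1) = w powi (- (k - 1) - 1)"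
        by (subst power_int_add_1'[symmetric]) (auto simp: algebra_simps)
      thus "f w * w powi (- k - 1) = f z * w powi (- k - 1) + g w * w powi (- (k - 1) - 1) - z * (g w * w powi (- k - 1))"
        by (subst fg) (simp add: algebra_simps flip: mult.assoc)
    qed
    also have "\<dots> = f z * contour_integral (circlepath 0 1) (\<lambda>w. w powi (- k - 1)) +
        contour_integral (circlepath 0 1) (\<lambda>w. g w * w powi (- (k - 1) - 1))
        - z * contour_integral (circlepath 0 1) (\<lambda>w. g w * w powi (- k - 1))"
      using int[of "\<lambda>_. 1" "- k - 1"] int[OF g]
      by (simp add: contour_integral_diff contour_integral_add contour_integral_lmul
          contour_integrable_add contour_integrable_lmul)
    finally show ?thesis
      by (simp add: laurent_coeff_def contour_integral_unit_circle_powi diff_divide_distrib add_divide_distrib)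
  qed
  \<comment> \<open>Only the convergence of the series of g enters, which the Cauchy bounds already
    give; its value s cancels at the end.\<close>
  obtain s where s: "((\<lambda>k. laurent_coeff g k * z powi k) has_sum s) UNIV"
    using laurent_terms_summable[OF g R z] by (auto simp: summable_on_def)
  have s1: "((\<lambda>k. z * laurent_coeff g k * z powi k) has_sum z * s) UNIV"
    using has_sum_cmult_right[OF s, of z] by (simp add: mult.assoc)
  have "((\<lambda>k. laurent_coeff g (k - 1) * z powi k) has_sum z * s) UNIV \<longleftrightarrow>
        ((\<lambda>k. z * laurent_coeff g k * z powi k) has_sum z * s) UNIV"
    using \<open>z \<noteq> 0\<close> by (intro has_sum_reindex_bij_witness[of _ "\<lambda>k. k + 1" "\<lambda>k. k - 1"]) (auto simp: power_int_diff)
  with s1 have s2: "((\<lambda>k. laurent_coeff g (k - 1) * z powi k) has_sum z * s) UNIV" by simp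
  have s0: "((\<lambda>k::int. (if k = 0 then f z else 0) * z powi k) has_sum f z) UNIV"
    by (rule has_sum_finite_neutralI[of "{0}"]) auto
  have "((\<lambda>k. (if k = 0 then f z else 0) * z powi k + laurent_coeff g (k - 1) * z powi k
          + - (z * laurent_coeff g k * z powi k)) has_sum f z + z * s + - (z * s)) UNIV"
    by (intro has_sum_add s0 s2 has_sum_uminusI s1)
  thus ?thesis by (simp add: rel algebra_simps)
qed

section \<open>Laurent series in several variables\<close>

lemma continuous_on_circle_integral_param:
  fixes \<phi> :: "'a::topological_space \<Rightarrow> complex \<Rightarrow> complex"
  assumes "continuous_on (S \<times> sphere 0 1) (\<lambda>(x, w). \<phi> x w)"
  shows "continuous_on S (\<lambda>x. contour_integral (circlepath 0 1) (\<phi> x))"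
proof -
  have "continuous_on (S \<times> cbox 0 1) (\<lambda>y. (case (fst y, circlepath 0 1 (snd y)) of (x, w) \<Rightarrow> \<phi> x w)
      * vector_derivative (circlepath 0 1) (at (snd y)))"
    unfolding vector_derivative_circlepath
  proof (intro continuous_on_mult continuous_on_compose2[OF assms] continuous_intros)
    have "continuous_on (S \<times> cbox 0 1) (\<lambda>y. exp (2 * of_real pi * \<i> * of_real (snd y)) :: complex)"
      by (intro continuous_intros)
    thus "continuous_on (S \<times> cbox 0 1) (\<lambda>y. circlepath 0 1 (snd y) :: complex)"
      by (simp add: circlepath)
    have "circlepath 0 1 t \<in> sphere 0 1" if "t \<in> {0..1}" for t
      using that path_image_circlepath_nonneg[of 1 0] by (auto simp: path_image_def)
    thus "(\<lambda>y. (fst y, circlepath 0 1 (snd y))) ` (S \<times> cbox 0 1) \<subseteq> S \<times> sphere 0 1"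
      by (auto simp: cbox_interval)
  qed
  hence "continuous_on (S \<times> cbox 0 1) (\<lambda>(x, t). \<phi> x (circlepath 0 1 t) * vector_derivative (circlepath 0 1) (at t))"
    by (simp add: case_prod_unfold)
  hence "continuous_on S (\<lambda>x. integral (cbox 0 1) (\<lambda>t. \<phi> x (circlepath 0 1 t) * vector_derivative (circlepath 0 1) (at t)))"
    by (rule integral_continuous_on_param)
  thus ?thesis by (simp add: contour_integral_integral cbox_interval)
qed

text \<open>Interchanging the two contour integrals transfers Cauchy's integral formula from each
  \<phi>(., w) to the integral F; a continuous function satisfying that formula on small circles is
  differentiable.\<close>

lemma holomorphic_on_circle_integral_param:
  assumes "open U" and cont: "continuous_on (U \<times> sphere 0 1) (\<lambda>(z, w). \<phi> z w)"
    and hol: "\<And>w. w \<in> sphere 0 1 \<Longrightarrow> (\<lambda>z. \<phi> z w) holomorphic_on U"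
  shows "(\<lambda>z. contour_integral (circlepath 0 1) (\<phi> z)) holomorphic_on U"
proof -
  define F where "F z = contour_integral (circlepath 0 1) (\<phi> z)" for z
  have Fcont: "continuous_on U F"
    unfolding F_def by (rule continuous_on_circle_integral_param[OF cont])
  have \<phi>_cont: "continuous_on (sphere 0 1) (\<phi> u)" if "u \<in> U" for u
  proof -
    have "continuous_on (sphere 0 1) (\<lambda>w. (\<lambda>(z, w). \<phi> z w) (u, w))"
      by (rule continuous_on_compose2[OF cont continuous_on_Pair[OF continuous_on_const continuous_on_id]]) (use that in auto)
    thus ?thesis by simp
  qed
  have "\<exists>F'. (F has_field_derivative F') (at z)" if zU: "z \<in> U" for z
  proof -
    obtain r where r: "0 < r" "cball z r \<subseteq> U" using \<open>open U\<close> zU by (meson open_contains_cball)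
    have sph: "sphere z r \<subseteq> U" using r by auto
    \<comment> \<open>The exponent 1 puts the formula into the shape from which
      \<open>Cauchy_next_derivative_circlepath\<close> yields a derivative.\<close>
    have int: "((\<lambda>u. F u / (u - y) ^ 1) has_contour_integral 2 * of_real pi * \<i> * F y) (circlepath z r)"
      if y: "y \<in> ball z r" for y
    proof -
      have ne: "u - y \<noteq> 0" if "u \<in> sphere z r" for u using y that by auto
      have "(\<lambda>u. F u / (u - y)) contour_integrable_on circlepath z r"
        using r ne sph
        by (intro contour_integrable_continuous_circlepath continuous_intros continuous_on_subset[OF Fcont]) auto
      moreover have "contour_integral (circlepath z r) (\<lambda>u. F u / (u - y)) = 2 * of_real pi * \<i> * F y"
      proof -
        have "contour_integral (circlepath z r) (\<lambda>u. F u / (u - y)) =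
              contour_integral (circlepath z r) (\<lambda>u. contour_integral (circlepath 0 1) (\<lambda>w. \<phi> u w / (u - y)))"
        proof (rule contour_integral_eq)
          fix u assume "u \<in> path_image (circlepath z r)"
          hence u: "u \<in> sphere z r" using r by auto
          have "continuous_on (sphere 0 1) (\<phi> u)" using u sph by (intro \<phi>_cont) auto
          hence "\<phi> u contour_integrable_on circlepath 0 1"
            by (intro contour_integrable_continuous_circlepath) auto
          thus "F u / (u - y) = contour_integral (circlepath 0 1) (\<lambda>w. \<phi> u w / (u - y))"
            by (simp add: F_def contour_integral_div)
        qed
        also have "\<dots> = contour_integral (circlepath 0 1) (\<lambda>w. contour_integral (circlepath z r) (\<lambda>u. \<phi> u w / (u - y)))"
        proof (rule contour_integral_swap)
          have "continuous_on (sphere z r \<times> sphere 0 1) (\<lambda>p. (case p of (u, w) \<Rightarrow> \<phi> u w) / (fst p - y))"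
            using ne sph by (intro continuous_intros continuous_on_subset[OF cont]) auto
          thus "continuous_on (path_image (circlepath z r) \<times> path_image (circlepath 0 1)) (\<lambda>(u, w). \<phi> u w / (u - y))"
            using r by (simp add: case_prod_unfold)
        qed (auto simp: vector_derivative_circlepath intro!: continuous_intros)
        also have "\<dots> = contour_integral (circlepath 0 1) (\<lambda>w. 2 * of_real pi * \<i> * \<phi> y w)"
        proof (rule contour_integral_eq)
          fix w :: complex assume "w \<in> path_image (circlepath 0 1)"
          hence "(\<lambda>u. \<phi> u w) holomorphic_on U" by (intro hol) auto
          hence "((\<lambda>u. \<phi> u w / (u - y)) has_contour_integral 2 * of_real pi * \<i> * \<phi> y w) (circlepath z r)"
            using r y by (intro Cauchy_integral_circlepath_simple) (auto intro: holomorphic_on_subset simp: dist_norm norm_minus_commute)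
          thus "contour_integral (circlepath z r) (\<lambda>u. \<phi> u w / (u - y)) = 2 * of_real pi * \<i> * \<phi> y w"
            by (rule contour_integral_unique)
        qed
        also have "\<dots> = 2 * of_real pi * \<i> * F y"
        proof -
          have "y \<in> U" using y r by auto
          hence "continuous_on (sphere 0 1) (\<phi> y)" by (rule \<phi>_cont)
          hence "\<phi> y contour_integrable_on circlepath 0 1"
            by (intro contour_integrable_continuous_circlepath) auto
          thus ?thesis unfolding F_def by (rule contour_integral_lmul)
        qed
        finally show ?thesis .
      qed
      ultimately show ?thesis using has_contour_integral_integral by fastforce
    qed
    have "((\<lambda>y. 2 * of_real pi * \<i> * F y) has_field_derivative
        (of_nat 1 * contour_integral (circlepath z r) (\<lambda>u. F u / (u - z) ^ Suc 1))) (at z)"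
      using r sph by (intro Cauchy_next_derivative_circlepath(2)[OF _ int] continuous_on_subset[OF Fcont]) auto
    from DERIV_cdivide[OF this, of "2 * of_real pi * \<i>"] show ?thesis by auto
  qed
  hence "F holomorphic_on U" using \<open>open U\<close> by (auto simp: holomorphic_on_open)
  thus ?thesis by (simp add: F_def[abs_def])
qed

section \<open>Exponent tuples, Laurent monomials and their weights\<close>

definition int_tuples :: "nat \<Rightarrow> (nat \<Rightarrow> int) set" where
  "int_tuples n = {1..n} \<rightarrow>\<^sub>E UNIV"

definition laurent_monom :: "nat \<Rightarrow> (nat \<Rightarrow> int) \<Rightarrow> (nat \<Rightarrow> complex) \<Rightarrow> complex" where
  "laurent_monom n e x = (\<Prod>i\<in>{1..n}. x i powi e i)"

definition ring_weight :: "nat \<Rightarrow> real \<Rightarrow> (nat \<Rightarrow> int) \<Rightarrow> real" where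
  "ring_weight n \<rho> e = (\<Prod>i\<in>{1..n}. \<rho> ^ nat \<bar>e i\<bar>)"

lemma norm_laurent_monom_le:
  assumes "x \<in> {1..n} \<rightarrow>\<^sub>E closed_ring \<rho>" "0 < \<rho>"
  shows "norm (laurent_monom n e x) \<le> ring_weight n \<rho> e"
  unfolding laurent_monom_def ring_weight_def prod_norm[symmetric]
  using assms by (intro prod_mono conjI norm_powi_closed_ring_le) auto

lemma ring_weight_pos: "0 < \<rho> \<Longrightarrow> 0 < ring_weight n \<rho> e"
  by (auto simp: ring_weight_def intro!: prod_pos)

lemma bij_betw_int_tuples_Suc:
  "bij_betw (\<lambda>(k, e). e(Suc n := k)) (UNIV \<times> int_tuples n) (int_tuples (Suc n))"
proof -
  have "{1..Suc n} = insert (Suc n) {1..n}" by auto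
  thus ?thesis
    unfolding bij_betw_def int_tuples_def
    using inj_combinator[of "Suc n" "{1..n}" "\<lambda>_. UNIV :: int set"]
    by (simp add: PiE_insert_eq)
qed

lemma laurent_monom_Suc_upd:
  "laurent_monom (Suc n) (e(Suc n := k)) x = laurent_monom n e x * x (Suc n) powi k"
  unfolding laurent_monom_def by simp

lemma ring_weight_Suc_upd:
  "ring_weight (Suc n) \<rho> (e(Suc n := k)) = ring_weight n \<rho> e * \<rho> ^ nat \<bar>k\<bar>"
  unfolding ring_weight_def by simp

lemma ring_weight_summable:
  assumes "0 \<le> q" "q < 1"
  shows "ring_weight n q summable_on int_tuples n"
proof (induction n)
  case 0
  show ?case by (auto simp: int_tuples_def)
next
  case (Suc n)
  have "(\<lambda>(k, e). q ^ nat \<bar>k\<bar> * ring_weight n q e) summable_on UNIV \<times> int_tuples n"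
  proof (rule summable_on_SigmaI)
    show "((\<lambda>e. case (k, e) of (k, e) \<Rightarrow> q ^ nat \<bar>k\<bar> * ring_weight n q e) has_sum
        q ^ nat \<bar>k\<bar> * infsum (ring_weight n q) (int_tuples n)) (int_tuples n)" for k :: int
      using Suc.IH by (auto intro: has_sum_cmult_right)
    show "(\<lambda>k::int. q ^ nat \<bar>k\<bar> * infsum (ring_weight n q) (int_tuples n)) summable_on UNIV"
      by (intro summable_on_cmult_left summable_on_geometric_int assms)
  qed (use assms in \<open>auto simp: ring_weight_def intro!: prod_nonneg mult_nonneg_nonneg\<close>)
  also have "(\<lambda>(k, e). q ^ nat \<bar>k\<bar> * ring_weight n q e) =
             (\<lambda>y. ring_weight (Suc n) q (case y of (k, e) \<Rightarrow> e(Suc n := k)))"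
    by (auto simp: ring_weight_Suc_upd)
  finally show ?case
    by (subst (asm) summable_on_reindex_bij_betw[OF bij_betw_int_tuples_Suc])
qed

lemma ring_weight_div: "ring_weight n \<sigma> e / ring_weight n \<rho> e = ring_weight n (\<sigma> / \<rho>) e"
  by (simp add: ring_weight_def prod_dividef power_divide)

lemma tuple_in_closed_ring:
  fixes n :: nat
  assumes "x \<in> {1..n} \<rightarrow>\<^sub>E open_ring R" "1 < R"
  obtains \<rho> where "1 < \<rho>" "\<rho> < R" "x \<in> {1..n} \<rightarrow>\<^sub>E closed_ring \<rho>"
proof -
  have "\<exists>\<rho>. 1 < \<rho> \<and> \<rho> < R \<and> x i \<in> closed_ring \<rho>" if "i \<in> {1..n}" for i
    using mem_open_ring_imp_closed_ring[OF PiE_mem[OF assms(1) that] assms(2)] by blast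
  then obtain r where r: "\<And>i. i \<in> {1..n} \<Longrightarrow> 1 < r i \<and> r i < R \<and> x i \<in> closed_ring (r i)"
    by metis
  \<comment> \<open>Including s keeps the maximum below nonempty when n = 0 and forces it above
    1.\<close>
  obtain s where s: "1 < s" "s < R" using dense assms by blast
  define \<rho> where "\<rho> = Max (insert s (r ` {1..n}))"
  have "s \<le> \<rho>" "\<And>i. i \<in> {1..n} \<Longrightarrow> r i \<le> \<rho>" unfolding \<rho>_def by (auto intro!: Max_ge simp del: Max_insert)
  moreover have "\<rho> < R" unfolding \<rho>_def using r s by (subst Max_less_iff) auto
  ultimately show ?thesis
    using that[of \<rho>] r s assms(1) closed_ring_mono[of "r _" \<rho>]
    by (force simp: PiE_iff)
qed

text \<open>Tychonoff's theorem, after viewing extensional tuples as a product over all indices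
  whose factors outside {1..n} are the singleton of \<open>undefined\<close>.\<close>

lemma compact_PiE_tuples:
  fixes K :: "complex set"
  assumes "compact K"
  shows "compact ({1..n::nat} \<rightarrow>\<^sub>E K)"
proof -
  have "compact (\<Pi>\<^sub>E i\<in>UNIV. if i \<in> {1..n} then K else {undefined})"
    using assms compactin_PiE[of "\<lambda>_. euclidean :: complex topology" UNIV "\<lambda>i. if i \<in> {1..n} then K else {undefined}"]
    by (simp add: euclidean_product_topology flip: compactin_euclidean_iff)
  also have "(\<Pi>\<^sub>E i\<in>UNIV. if i \<in> {1..n} then K else {undefined}) = {1..n} \<rightarrow>\<^sub>E K"
    by (auto simp: PiE_def Pi_def extensional_def split: if_splits)
  finally show ?thesis .
qed

definition laurent_coeff_last :: "nat \<Rightarrow> ((nat \<Rightarrow> complex) \<Rightarrow> complex) \<Rightarrow> int \<Rightarrow> (nat \<Rightarrow> complex) \<Rightarrow> complex" where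
  "laurent_coeff_last n G k x = laurent_coeff (\<lambda>w. G (x(Suc n := w))) k"

text \<open>This is what allows induction on the number of variables: the last variable is
  integrated over the unit circle, while the others enter the integral as parameters, jointly
  continuously and holomorphically one at a time.\<close>

lemma holomorphic_n_laurent_coeff_last:
  assumes R: "1 < R" and G: "holomorphic_n (Suc n) (open_ring R) G"
  shows "holomorphic_n n (open_ring R) (laurent_coeff_last n G k)"
proof -
  let ?U = "open_ring R"
  have Gc: "continuous_on ({1..Suc n} \<rightarrow>\<^sub>E ?U) G" using G by (simp add: holomorphic_n_def)
  have Gh: "(\<lambda>z. G (x(i := z))) holomorphic_on ?U" if "x \<in> {1..Suc n} \<rightarrow>\<^sub>E ?U" "i \<in> {1..Suc n}" for x i
    using G that by (simp add: holomorphic_n_def)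
  have sub: "sphere 0 1 \<subseteq> ?U" using R by (auto simp: open_ring_def)
  have ext: "x(Suc n := w) \<in> {1..Suc n} \<rightarrow>\<^sub>E ?U" if "x \<in> {1..n} \<rightarrow>\<^sub>E ?U" "w \<in> sphere 0 1" for x w
    using that sub by (auto simp: PiE_iff extensional_def)
  define \<phi> where "\<phi> x w = G (x(Suc n := w)) * w powi (- k - 1)" for x w
  have \<phi>c: "continuous_on (({1..n} \<rightarrow>\<^sub>E ?U) \<times> sphere 0 1) (\<lambda>(x, w). \<phi> x w)"
    unfolding \<phi>_def case_prod_unfold
  proof (rule continuous_on_mult, rule continuous_on_compose2[OF Gc])
    show "continuous_on (({1..n} \<rightarrow>\<^sub>E ?U) \<times> sphere 0 1) (\<lambda>p. (fst p)(Suc n := snd p))"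
    proof (rule continuous_on_coordinatewise_then_product)
      fix i
      show "continuous_on (({1..n} \<rightarrow>\<^sub>E ?U) \<times> sphere 0 1) (\<lambda>p. ((fst p)(Suc n := snd p)) i)"
      proof (cases "i = Suc n")
        case True
        thus ?thesis by (simp add: continuous_on_snd[OF continuous_on_id])
      next
        case False
        have "continuous_on (({1..n} \<rightarrow>\<^sub>E ?U) \<times> sphere 0 1) (\<lambda>p. fst p i)"
          by (rule continuous_on_product_then_coordinatewise[OF continuous_on_fst[OF continuous_on_id]])
        thus ?thesis using False by simp
      qed
    qed
    show "continuous_on (({1..n} \<rightarrow>\<^sub>E ?U) \<times> (sphere 0 1 :: complex set)) (\<lambda>p. snd p powi (- k - 1))"
    proof -
      have "(\<lambda>w::complex. w powi (- k - 1)) holomorphic_on sphere 0 1"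
        by (intro holomorphic_intros) auto
      show ?thesis
        by (rule continuous_on_compose2[OF holomorphic_on_imp_continuous_on[OF \<open>(\<lambda>w::complex. w powi (- k - 1)) holomorphic_on sphere 0 1\<close>]
              continuous_on_snd[OF continuous_on_id]]) auto
    qed
  qed (rule image_subsetI, rule ext, auto simp: mem_Times_iff)
  have eq: "laurent_coeff_last n G k = (\<lambda>x. contour_integral (circlepath 0 1) (\<phi> x) / (2 * pi * \<i>))"
    by (simp add: laurent_coeff_last_def laurent_coeff_def \<phi>_def[abs_def] fun_eq_iff)
  show ?thesis
    unfolding holomorphic_n_def eq
  proof (intro conjI ballI)
    show "continuous_on ({1..n} \<rightarrow>\<^sub>E ?U) (\<lambda>x. contour_integral (circlepath 0 1) (\<phi> x) / (2 * pi * \<i>))"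
      by (intro continuous_intros continuous_on_circle_integral_param \<phi>c) auto
    fix x i assume x: "x \<in> {1..n} \<rightarrow>\<^sub>E ?U" and i: "i \<in> {1..n}"
    have upd: "x(i := z) \<in> {1..n} \<rightarrow>\<^sub>E ?U" if "z \<in> ?U" for z
      using x i that by (auto simp: PiE_iff extensional_def)
    have "(\<lambda>z. contour_integral (circlepath 0 1) (\<phi> (x(i := z)))) holomorphic_on ?U"
    proof (rule holomorphic_on_circle_integral_param[OF open_open_ring])
      have "continuous_on (?U \<times> sphere 0 1) (\<lambda>p. (\<lambda>(x, w). \<phi> x w) (x(i := fst p), snd p))"
      proof (rule continuous_on_compose2[OF \<phi>c])
        show "continuous_on (?U \<times> sphere 0 1) (\<lambda>p. (x(i := fst p), snd p))"
        proof (intro continuous_on_Pair continuous_on_coordinatewise_then_product)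
          show "continuous_on (?U \<times> sphere 0 1) (\<lambda>p. (x(i := fst p)) j)" for j
            by (cases "j = i") (auto intro!: continuous_intros)
        qed (intro continuous_intros)
      qed (rule image_subsetI, rule SigmaI, rule upd, auto)
      thus "continuous_on (?U \<times> sphere 0 1) (\<lambda>(z, w). \<phi> (x(i := z)) w)"
        by (simp add: case_prod_unfold)
      fix w :: complex assume w: "w \<in> sphere 0 1"
      have "(\<lambda>z. G ((x(Suc n := w))(i := z)) * w powi (- k - 1)) holomorphic_on ?U"
        using ext[OF x w] i w by (intro holomorphic_intros Gh) auto
      thus "(\<lambda>z. \<phi> (x(i := z)) w) holomorphic_on ?U"
        using i by (simp add: \<phi>_def fun_upd_twist)
    qed
    thus "(\<lambda>z. contour_integral (circlepath 0 1) (\<phi> (x(i := z))) / (2 * pi * \<i>)) holomorphic_on ?U"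
      by (intro holomorphic_intros) auto
  qed
qed

lemma holomorphic_n_bounded_closed_ring:
  assumes "holomorphic_n n (open_ring R) G" "0 < \<rho>" "\<rho> < R"
  obtains M where "\<And>x. x \<in> {1..n} \<rightarrow>\<^sub>E closed_ring \<rho> \<Longrightarrow> norm (G x) \<le> M"
proof -
  have "({1..n} \<rightarrow>\<^sub>E closed_ring \<rho>) \<subseteq> ({1..n} \<rightarrow>\<^sub>E open_ring R)"
    using closed_ring_subset_open_ring[OF assms(2,3)] by (rule PiE_mono)
  hence "continuous_on ({1..n} \<rightarrow>\<^sub>E closed_ring \<rho>) G"
    using assms(1) by (auto simp: holomorphic_n_def intro: continuous_on_subset)
  hence "bounded (G ` ({1..n} \<rightarrow>\<^sub>E closed_ring \<rho>))"
    by (intro compact_imp_bounded compact_continuous_image compact_PiE_tuples compact_closed_ring)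
  thus ?thesis using that by (auto simp: bounded_iff)
qed

text \<open>A Cauchy bound at the larger radius \<rho> dominates the terms at radius \<sigma> by a
  product of geometric series of ratio \<sigma>/\<rho>, one for each coordinate.\<close>

lemma laurent_coeff_bound_imp_summable:
  assumes a: "\<And>e. e \<in> int_tuples n \<Longrightarrow> norm (a e) * ring_weight n \<rho> e \<le> M"
    and "0 < \<sigma>" "\<sigma> < \<rho>"
  shows "(\<lambda>e. norm (a e) * ring_weight n \<sigma> e) summable_on int_tuples n"
proof -
  have "(\<lambda>e. norm (norm (a e) * ring_weight n \<sigma> e)) summable_on int_tuples n"
  proof (rule Infinite_Sum.abs_summable_on_comparison_test')
    show "(\<lambda>e. M * ring_weight n (\<sigma> / \<rho>) e) summable_on int_tuples n"
      using assms by (intro summable_on_cmult_right ring_weight_summable) auto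
    fix e assume "e \<in> int_tuples n"
    hence "norm (a e) \<le> M / ring_weight n \<rho> e"
      using a[of e] ring_weight_pos[of \<rho> n e] assms by (simp add: field_simps)
    hence "norm (a e) * ring_weight n \<sigma> e \<le> M / ring_weight n \<rho> e * ring_weight n \<sigma> e"
      using ring_weight_pos[of \<sigma> n e] assms by (intro mult_right_mono) auto
    also have "\<dots> = M * ring_weight n (\<sigma> / \<rho>) e" by (simp flip: ring_weight_div)
    finally show "norm (norm (a e) * ring_weight n \<sigma> e) \<le> M * ring_weight n (\<sigma> / \<rho>) e"
      using ring_weight_pos[of \<sigma> n e] assms by simp
  qed
  thus ?thesis using summable_on_iff_abs_summable_on_real by blast
qed

text \<open>Induction expands in the last variable and then expands each coefficient in the
  remaining ones. The Cauchy bounds are part of the induction because they give the joint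
  summability that turns iterated sums into one unordered sum; \<rho> and M are quantified after the
  coefficients, so that one family serves all radii.\<close>

theorem laurent_series_n:
  assumes R: "1 < R" and "holomorphic_n n (open_ring R) G"
  obtains a where
    "\<And>\<rho> M e. 1 \<le> \<rho> \<Longrightarrow> \<rho> < R \<Longrightarrow> (\<And>x. x \<in> {1..n} \<rightarrow>\<^sub>E closed_ring \<rho> \<Longrightarrow> norm (G x) \<le> M) \<Longrightarrow>
       e \<in> int_tuples n \<Longrightarrow> norm (a e) * ring_weight n \<rho> e \<le> M"
    "\<And>x. x \<in> {1..n} \<rightarrow>\<^sub>E open_ring R \<Longrightarrow> ((\<lambda>e. a e * laurent_monom n e x) has_sum G x) (int_tuples n)"
proof -
  define P where "P n G a \<longleftrightarrow> (\<forall>\<rho> M e. 1 \<le> \<rho> \<longrightarrow> \<rho> < R \<longrightarrow> (\<forall>x \<in> {1..n} \<rightarrow>\<^sub>E closed_ring \<rho>. norm (G x) \<le> M) \<longrightarrow>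
       e \<in> int_tuples n \<longrightarrow> norm (a e) * ring_weight n \<rho> e \<le> M)
     \<and> (\<forall>x \<in> {1..n} \<rightarrow>\<^sub>E open_ring R. ((\<lambda>e. a e * laurent_monom n e x) has_sum G x) (int_tuples n))"
    for n and G :: "(nat \<Rightarrow> complex) \<Rightarrow> complex" and a
  have "\<exists>a. P n G a" using assms(2)
  proof (induction n arbitrary: G)
    case 0
    have "P 0 G (\<lambda>_. G (\<lambda>_. undefined))"
      by (auto simp: P_def ring_weight_def laurent_monom_def int_tuples_def intro!: has_sum_finiteI)
    thus ?case by blast
  next
    case (Suc n)
    let ?b = "laurent_coeff_last n G"
    have "\<exists>a. P n (?b k) a" for k
      by (intro Suc.IH holomorphic_n_laurent_coeff_last R Suc.prems)
    then obtain a' where a': "\<And>k. P n (?b k) (a' k)" by metis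
    define a where "a e = a' (e (Suc n)) (restrict e {1..n})" for e
    have a_upd: "a (e(Suc n := k)) = a' k e" if "e \<in> int_tuples n" for e k
    proof -
      have "restrict (e(Suc n := k)) {1..n} = e"
        using that by (auto simp: int_tuples_def PiE_iff extensional_def restrict_def fun_eq_iff)
      thus ?thesis by (simp add: a_def)
    qed
    have slice: "(\<lambda>w. G (x(Suc n := w))) holomorphic_on open_ring R" if "x \<in> {1..n} \<rightarrow>\<^sub>E open_ring R" for x
    proof -
      have "x(Suc n := 1) \<in> {1..Suc n} \<rightarrow>\<^sub>E open_ring R"
        using that R by (auto simp: PiE_iff extensional_def open_ring_def)
      hence "(\<lambda>w. G ((x(Suc n := 1))(Suc n := w))) holomorphic_on open_ring R"
        using Suc.prems unfolding holomorphic_n_def by (metis atLeastAtMost_iff le_add1 order_refl plus_1_eq_Suc)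
      thus ?thesis by simp
    qed
    have bound: "norm (a e) * ring_weight (Suc n) \<rho> e \<le> M"
      if \<rho>: "1 \<le> \<rho>" "\<rho> < R" and M: "\<forall>x \<in> {1..Suc n} \<rightarrow>\<^sub>E closed_ring \<rho>. norm (G x) \<le> M"
        and e: "e \<in> int_tuples (Suc n)" for \<rho> M e
    proof -
      obtain k e' where ke: "e = e'(Suc n := k)" and e': "e' \<in> int_tuples n"
        using e bij_betw_imp_surj_on[OF bij_betw_int_tuples_Suc[of n]] by (auto elim!: equalityE)
      \<comment> \<open>The one-variable estimate holds at every point of the closed product ring,
        so M / \<rho>^|k| is an admissible bound for the induction hypothesis applied to the k-th
        coefficient.\<close>
      have "norm (?b k x) \<le> M / \<rho> ^ nat \<bar>k\<bar>" if x: "x \<in> {1..n} \<rightarrow>\<^sub>E closed_ring \<rho>" for x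
      proof -
        have xo: "x \<in> {1..n} \<rightarrow>\<^sub>E open_ring R"
          using x closed_ring_subset_open_ring[of \<rho> R] \<rho> by (auto simp: PiE_iff)
        have "x(Suc n := z) \<in> {1..Suc n} \<rightarrow>\<^sub>E closed_ring \<rho>" if "z \<in> closed_ring \<rho>" for z
          using x that by (auto simp: PiE_iff extensional_def)
        hence "norm (?b k x) * \<rho> ^ nat \<bar>k\<bar> \<le> M"
          unfolding laurent_coeff_last_def using M
          by (intro norm_laurent_coeff_le[OF slice[OF xo] \<rho>]) auto
        thus ?thesis using \<rho> by (simp add: field_simps)
      qed
      hence "norm (a' k e') * ring_weight n \<rho> e' \<le> M / \<rho> ^ nat \<bar>k\<bar>"
        using a'[of k] \<rho> e' by (auto simp: P_def)
      thus ?thesis using \<rho> e' by (simp add: ke a_upd ring_weight_Suc_upd field_simps)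
    qed
    have sum: "((\<lambda>e. a e * laurent_monom (Suc n) e x) has_sum G x) (int_tuples (Suc n))"
      if x: "x \<in> {1..Suc n} \<rightarrow>\<^sub>E open_ring R" for x
    proof -
      obtain \<sigma> where \<sigma>: "1 < \<sigma>" "\<sigma> < R" "x \<in> {1..Suc n} \<rightarrow>\<^sub>E closed_ring \<sigma>"
        using tuple_in_closed_ring[OF x R] by blast
      obtain \<rho> where \<rho>: "\<sigma> < \<rho>" "\<rho> < R" using dense \<sigma> by blast
      obtain M where M: "\<And>x. x \<in> {1..Suc n} \<rightarrow>\<^sub>E closed_ring \<rho> \<Longrightarrow> norm (G x) \<le> M"
        using holomorphic_n_bounded_closed_ring[OF Suc.prems, of \<rho>] \<rho> \<sigma> by auto
      have "(\<lambda>e. norm (a e) * ring_weight (Suc n) \<sigma> e) summable_on int_tuples (Suc n)"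
        by (rule laurent_coeff_bound_imp_summable[of _ _ \<rho> M]) (use bound[of \<rho> M] M \<sigma> \<rho> in auto)
      hence "(\<lambda>e. norm (a e * laurent_monom (Suc n) e x)) summable_on int_tuples (Suc n)"
        by (rule Infinite_Sum.abs_summable_on_comparison_test')
           (use norm_laurent_monom_le[OF \<sigma>(3)] \<sigma> in \<open>auto simp: norm_mult intro!: mult_left_mono\<close>)
      hence summ: "(\<lambda>e. a e * laurent_monom (Suc n) e x) summable_on int_tuples (Suc n)"
        by (rule abs_summable_summable)
      define x' where "x' = restrict x {1..n}"
      have x': "x' \<in> {1..n} \<rightarrow>\<^sub>E open_ring R" using x by (auto simp: x'_def)
      have mon: "laurent_monom n e x = laurent_monom n e x'" for e
        by (auto simp: laurent_monom_def x'_def)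
      have xu: "x'(Suc n := x (Suc n)) = x"
        using x by (force simp: x'_def fun_eq_iff PiE_iff extensional_def)
      have eq: "(\<lambda>y. (\<lambda>e. a e * laurent_monom (Suc n) e x) (case y of (k, e) \<Rightarrow> e(Suc n := k))) y =
          (\<lambda>(k, e). a' k e * laurent_monom n e x' * x (Suc n) powi k) y" if "y \<in> UNIV \<times> int_tuples n" for y
        using that by (auto simp: laurent_monom_Suc_upd a_upd mon)
      have "((\<lambda>(k, e). a' k e * laurent_monom n e x' * x (Suc n) powi k) has_sum G x) (UNIV \<times> int_tuples n)"
      proof (rule has_sum_SigmaI)
        show "((\<lambda>e. case (k, e) of (k, e) \<Rightarrow> a' k e * laurent_monom n e x' * x (Suc n) powi k) has_sum
             ?b k x' * x (Suc n) powi k) (int_tuples n)" for k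
          using a'[of k] x' by (auto simp: P_def intro: has_sum_cmult_left)
        have "x (Suc n) \<in> open_ring R" using x by auto
        from laurent_series[OF slice[OF x'] R this]
        show "((\<lambda>k. ?b k x' * x (Suc n) powi k) has_sum G x) UNIV"
          by (simp add: laurent_coeff_last_def xu)
        show "(\<lambda>(k, e). a' k e * laurent_monom n e x' * x (Suc n) powi k) summable_on UNIV \<times> int_tuples n"
          using summ unfolding summable_on_reindex_bij_betw[OF bij_betw_int_tuples_Suc, symmetric]
          using eq by (simp cong: summable_on_cong)
      qed
      thus ?thesis
        unfolding has_sum_reindex_bij_betw[OF bij_betw_int_tuples_Suc, symmetric]
        using eq by (simp cong: has_sum_cong)
    qed
    show ?case using bound sum by (intro exI[of _ a]) (auto simp: P_def)
  qed
  then obtain a where "P n G a" by blast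
  thus ?thesis using that[of a] unfolding P_def by blast
qed

section \<open>Alternants and Schur polynomials\<close>

definition geo_fps :: "complex \<Rightarrow> complex fps" where
  "geo_fps c = Abs_fps (\<lambda>n. c ^ n)"

lemma geo_fps_nth [simp]: "fps_nth (geo_fps c) n = c ^ n"
  by (simp add: geo_fps_def)

text \<open>With \<open>geo_fps c\<close> = 1/(1 - cX), this is the resolvent identity 1/(1 - xX) -
  1/(1 - yX) = (x - y)X / ((1 - xX)(1 - yX)).\<close>

lemma geo_fps_diff: "geo_fps x = geo_fps y + fps_const (x - y) * fps_X * geo_fps x * geo_fps y"
proof -
  have inv: "(1 - fps_const c * fps_X) * geo_fps c = 1" for c
  proof (rule fps_ext)
    fix n show "fps_nth ((1 - fps_const c * fps_X) * geo_fps c) n = fps_nth 1 n"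
      by (cases n) (auto simp: algebra_simps)
  qed
  have "geo_fps x - geo_fps y = geo_fps x * ((1 - fps_const y * fps_X) * geo_fps y)
      - ((1 - fps_const x * fps_X) * geo_fps x) * geo_fps y"
    by (simp add: inv)
  also have "\<dots> = (fps_const x - fps_const y) * fps_X * geo_fps x * geo_fps y" by (simp add: algebra_simps del: fps_const_sub)
  finally show ?thesis by (simp add: fps_const_sub algebra_simps)
qed

text \<open>\<open>newton_coeff y k e\<close> is the divided difference of \<open>t\<^sup>e\<close> at the nodes \<open>y 0, \<dots>, y k\<close>, i.e. the complete
  homogeneous symmetric polynomial of degree \<open>e - k\<close> in these nodes.\<close>
definition newton_coeff :: "(nat \<Rightarrow> complex) \<Rightarrow> nat \<Rightarrow> nat \<Rightarrow> complex" where
  "newton_coeff y k e = fps_nth (fps_X ^ k * (\<Prod>l\<le>k. geo_fps (y l))) e"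

text \<open>Newton's interpolation formula with remainder for all powers x^e at once: each induction
  step applies the resolvent identity to the remainder at the next node.\<close>

lemma geo_fps_newton:
  "geo_fps x = (\<Sum>k<N. fps_const (\<Prod>l<k. x - y l) * (fps_X ^ k * (\<Prod>l\<le>k. geo_fps (y l))))
     + fps_const (\<Prod>l<N. x - y l) * fps_X ^ N * (\<Prod>l<N. geo_fps (y l)) * geo_fps x"
proof (induction N)
  case (Suc N)
  let ?Q = "fps_const (\<Prod>l<N. x - y l) * fps_X ^ N * (\<Prod>l<N. geo_fps (y l))"
  have "?Q * geo_fps x = ?Q * (geo_fps (y N) + fps_const (x - y N) * fps_X * geo_fps x * geo_fps (y N))"
    using geo_fps_diff[of x "y N"] by simp
  also have "\<dots> = fps_const (\<Prod>l<N. x - y l) * (fps_X ^ N * (\<Prod>l\<le>N. geo_fps (y l)))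
     + fps_const (\<Prod>l<Suc N. x - y l) * fps_X ^ Suc N * (\<Prod>l<Suc N. geo_fps (y l)) * geo_fps x"
    by (simp add: lessThan_Suc_atMost[symmetric] algebra_simps flip: fps_const_mult)
  finally show ?case using Suc.IH by (simp add: algebra_simps)
qed simp

text \<open>At a node the remainder contains the factor y j - y j. Nothing is divided, so the nodes
  may coincide; this is why the quotient of alternants extends to coincident variables as a
  polynomial.\<close>

lemma power_newton:
  assumes "j < n"
  shows "y j ^ e = (\<Sum>k<n. newton_coeff y k e * (\<Prod>l<k. y j - y l))"
proof -
  have "(\<Prod>l<n. y j - y l) = 0" using assms by (intro prod_zero) auto
  hence "geo_fps (y j) = (\<Sum>k<n. fps_const (\<Prod>l<k. y j - y l) * (fps_X ^ k * (\<Prod>l\<le>k. geo_fps (y l))))"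
    using geo_fps_newton[of "y j" y n] by (simp only: fps_const_0_eq_0 mult_zero_left add_0_right)
  from arg_cong[OF this, of "\<lambda>F. fps_nth F e"] show ?thesis
    unfolding newton_coeff_def by (simp add: fps_sum_nth mult.commute)
qed

lemma newton_coeff_eq_0: "e < k \<Longrightarrow> newton_coeff y k e = 0"
  by (simp add: newton_coeff_def fps_X_power_mult_nth)

lemma newton_coeff_self: "newton_coeff y k k = 1"
  by (simp add: newton_coeff_def fps_X_power_mult_nth fps_prod_nth')

text \<open>A flagged Jacobi-Trudi determinant: the entry in row i and column k is the complete
  homogeneous polynomial of degree f i - k in the first k + 1 nodes.\<close>

definition newton_det :: "nat \<Rightarrow> (nat \<Rightarrow> nat) \<Rightarrow> (nat \<Rightarrow> complex) \<Rightarrow> complex" where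
  "newton_det n f y = Determinant.det (Matrix.mat n n (\<lambda>(i, k). newton_coeff y k (f i)))"

text \<open>The alternant matrix factors into the matrix of Newton coefficients and the matrix of
  Newton basis polynomials evaluated at the nodes. The latter is upper triangular, since the k-th
  basis polynomial vanishes at the nodes before the k-th.\<close>

lemma det_alternant:
  "Determinant.det (Matrix.mat n n (\<lambda>(i, j). y j ^ f i)) = newton_det n f y * (\<Prod>j<n. \<Prod>l<j. y j - y l)"
proof -
  let ?N = "Matrix.mat n n (\<lambda>(i, k). newton_coeff y k (f i))"
  let ?U = "Matrix.mat n n (\<lambda>(k, j). \<Prod>l<k. y j - y l)"
  have "Matrix.mat n n (\<lambda>(i, j). y j ^ f i) = ?N * ?U"
  proof (rule eq_matI)
    fix i j assume "i < dim_row (?N * ?U)" "j < dim_col (?N * ?U)"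
    thus "Matrix.mat n n (\<lambda>(i, j). y j ^ f i) $$ (i, j) = (?N * ?U) $$ (i, j)"
      using power_newton[of j n y "f i"] by (simp add: scalar_prod_def atLeast0LessThan)
  qed auto
  hence "Determinant.det (Matrix.mat n n (\<lambda>(i, j). y j ^ f i)) = Determinant.det ?N * Determinant.det ?U"
    by (simp add: Determinant.det_mult[where n = n])
  also have "Determinant.det ?U = prod_list (diag_mat ?U)"
    by (rule det_upper_triangular[where n = n]) (auto simp: upper_triangular_def intro!: prod_zero)
  also have "\<dots> = (\<Prod>j<n. \<Prod>l<j. y j - y l)"
    by (simp add: diag_mat_def prod.list_conv_set_nth atLeast0LessThan)
  finally show ?thesis by (simp add: newton_det_def)
qed

definition antidiag_mat :: "nat \<Rightarrow> complex Matrix.mat" where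
  "antidiag_mat n = Matrix.mat n n (\<lambda>(i, j). if j = n - 1 - i then 1 else 0)"

text \<open>The sign (-1)^(n(n-1)/2) of reversing n rows. It is left unevaluated; that its square is
  1 suffices.\<close>

definition antidiag_sign :: "nat \<Rightarrow> complex" where
  "antidiag_sign n = Determinant.det (antidiag_mat n)"

lemma antidiag_mat_mult:
  assumes "A \<in> carrier_mat n n"
  shows "antidiag_mat n * A = Matrix.mat n n (\<lambda>(i, j). A $$ (n - 1 - i, j))"
proof (rule eq_matI)
  fix i j assume "i < dim_row (Matrix.mat n n (\<lambda>(i, j). A $$ (n - 1 - i, j)))"
    "j < dim_col (Matrix.mat n n (\<lambda>(i, j). A $$ (n - 1 - i, j)))"
  hence ij: "i < n" "j < n" by auto
  have "(antidiag_mat n * A) $$ (i, j) = (\<Sum>k\<in>{0..<n}. (if k = n - 1 - i then 1 else 0) * A $$ (k, j))"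
    using ij assms by (auto simp: antidiag_mat_def scalar_prod_def)
  also have "\<dots> = (\<Sum>k\<in>{0..<n}. if k = n - 1 - i then A $$ (k, j) else 0)"
    by (intro sum.cong) auto
  also have "\<dots> = A $$ (n - 1 - i, j)" using ij by (subst sum.delta) auto
  finally show "(antidiag_mat n * A) $$ (i, j) = Matrix.mat n n (\<lambda>(i, j). A $$ (n - 1 - i, j)) $$ (i, j)"
    using ij by simp
qed (use assms in \<open>auto simp: antidiag_mat_def\<close>)

lemma antidiag_sign_square: "antidiag_sign n * antidiag_sign n = 1"
proof -
  have c: "antidiag_mat n \<in> carrier_mat n n" by (simp add: antidiag_mat_def)
  have "antidiag_mat n * antidiag_mat n = 1\<^sub>m n"
    unfolding antidiag_mat_mult[OF c] by (rule eq_matI) (auto simp: antidiag_mat_def)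
  thus ?thesis unfolding antidiag_sign_def using Determinant.det_mult[OF c c] by simp
qed

lemma antidiag_sign_cancel: "antidiag_sign n * x * (antidiag_sign n * y) = x * y"
proof -
  have "antidiag_sign n * x * (antidiag_sign n * y) = (antidiag_sign n * antidiag_sign n) * (x * y)"
    by (simp only: mult_ac)
  thus ?thesis by (simp add: antidiag_sign_square)
qed

text \<open>Reversing the rows makes the exponents increase, and then the matrix of Newton
  coefficients is lower triangular with ones on the diagonal.\<close>

lemma newton_det_vandermonde: "newton_det n (\<lambda>i. n - Suc i) y = antidiag_sign n"
proof -
  let ?N = "Matrix.mat n n (\<lambda>(i, k). newton_coeff y k (n - Suc i))"
  have c: "antidiag_mat n \<in> carrier_mat n n" "?N \<in> carrier_mat n n" by (auto simp: antidiag_mat_def)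
  have e: "antidiag_mat n * ?N = Matrix.mat n n (\<lambda>(i, k). newton_coeff y k i)"
    unfolding antidiag_mat_mult[OF c(2)] by (rule eq_matI) auto
  have "antidiag_sign n * newton_det n (\<lambda>i. n - Suc i) y = Determinant.det (antidiag_mat n * ?N)"
    using Determinant.det_mult[OF c] by (simp add: antidiag_sign_def newton_det_def)
  also have "\<dots> = prod_list (diag_mat (antidiag_mat n * ?N))"
    unfolding e by (rule det_lower_triangular[where n = n]) (auto simp: newton_coeff_eq_0)
  also have "\<dots> = 1"
    unfolding e by (simp add: diag_mat_def newton_coeff_self prod.list_conv_set_nth)
  finally have "antidiag_sign n * (antidiag_sign n * newton_det n (\<lambda>i. n - Suc i) y) = antidiag_sign n" by simp
  thus ?thesis using antidiag_sign_square[of n] by (simp flip: mult.assoc)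
qed

definition vdet :: "nat \<Rightarrow> (nat \<Rightarrow> complex) \<Rightarrow> complex" where
  "vdet n \<alpha> = Determinant.det (vandermonde_mat n \<alpha>)"

definition node_prod :: "nat \<Rightarrow> (nat \<Rightarrow> complex) \<Rightarrow> complex" where
  "node_prod n \<alpha> = (\<Prod>j\<in>{1..n}. \<Prod>l\<in>{1..<j}. \<alpha> j - \<alpha> l)"

lemma node_prod_shift: "(\<Prod>j<n. \<Prod>l<j. \<alpha> (Suc j) - \<alpha> (Suc l)) = node_prod n \<alpha>"
proof -
  have e: "(\<Prod>l<j. \<alpha> (Suc j) - \<alpha> (Suc l)) = (\<Prod>l\<in>{1..<Suc j}. \<alpha> (Suc j) - \<alpha> l)" for j
    by (rule prod.reindex_bij_witness[of _ "\<lambda>l. l - 1" Suc]) auto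
  have "(\<Prod>j<n. \<Prod>l<j. \<alpha> (Suc j) - \<alpha> (Suc l)) = (\<Prod>j<n. \<Prod>l\<in>{1..<Suc j}. \<alpha> (Suc j) - \<alpha> l)"
    by (simp only: e)
  also have "\<dots> = node_prod n \<alpha>"
    unfolding node_prod_def by (rule prod.reindex_bij_witness[of _ "\<lambda>l. l - 1" Suc]) auto
  finally show ?thesis .
qed

lemma vdet_eq: "vdet n \<alpha> = antidiag_sign n * node_prod n \<alpha>"
  using det_alternant[of n "\<lambda>j. \<alpha> (Suc j)" "\<lambda>i. n - Suc i"]
  by (simp add: vdet_def vandermonde_mat_def newton_det_vandermonde node_prod_shift)

lemma antidiag_sign_nonzero: "antidiag_sign n \<noteq> 0"
  using antidiag_sign_square[of n] by auto

lemma vdet_eq_0_iff: "vdet n \<alpha> = 0 \<longleftrightarrow> \<not> inj_on \<alpha> {1..n}"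
proof
  assume "vdet n \<alpha> = 0"
  then obtain j l where "j \<in> {1..n}" "l \<in> {1..<j}" "\<alpha> j = \<alpha> l"
    using antidiag_sign_nonzero[of n] by (auto simp: vdet_eq node_prod_def)
  thus "\<not> inj_on \<alpha> {1..n}" by (auto dest!: inj_onD)
next
  assume "\<not> inj_on \<alpha> {1..n}"
  then obtain j l where "j \<in> {1..n}" "l \<in> {1..n}" "\<alpha> j = \<alpha> l" "l < j"
    unfolding inj_on_def by (metis linorder_neqE_nat)
  hence "(\<Prod>l\<in>{1..<j}. \<alpha> j - \<alpha> l) = 0" by (intro prod_zero) auto
  hence "node_prod n \<alpha> = 0" unfolding node_prod_def using \<open>j \<in> {1..n}\<close> by (intro prod_zero) blast+
  thus "vdet n \<alpha> = 0" by (simp add: vdet_eq)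
qed

text \<open>The exponent in row j of the Schur numerator: a partition with gaps m_k plus the
  staircase n - j. Consecutive exponents differ by 1 + m_(n-j) and the last is 0, so m_k \<ge> 0 for
  all k means strict decrease.\<close>

definition schur_exp :: "nat \<Rightarrow> (nat \<Rightarrow> int) \<Rightarrow> nat \<Rightarrow> int" where
  "schur_exp n m j = int (n - j) + (\<Sum>k\<in>{1..n - j}. m k)"

lemma schur_num_mat_eq: "schur_num_mat n m \<alpha> = Matrix.mat n n (\<lambda>(i, j). \<alpha> (Suc j) powi schur_exp n m (Suc i))"
  unfolding schur_num_mat_def schur_exp_def by simp

text \<open>The Schur function as an honest polynomial, defined also at coincident variables. The
  sign undoes the one produced by the decreasing order of exponents in the Vandermonde denominator;
  \<open>nat\<close> loses nothing when m is dominant.\<close>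

definition schur_poly :: "nat \<Rightarrow> (nat \<Rightarrow> int) \<Rightarrow> (nat \<Rightarrow> complex) \<Rightarrow> complex" where
  "schur_poly n m \<alpha> = antidiag_sign n * newton_det n (\<lambda>i. nat (schur_exp n m (Suc i))) (\<lambda>j. \<alpha> (Suc j))"

definition dominant :: "nat \<Rightarrow> (nat \<Rightarrow> int) \<Rightarrow> bool" where
  "dominant n m \<longleftrightarrow> (\<forall>k\<in>{1..<n}. 0 \<le> m k)"

lemma schur_exp_nonneg:
  assumes "dominant n m" "1 \<le> j" "j \<le> n"
  shows "0 \<le> schur_exp n m j"
proof -
  have "0 \<le> (\<Sum>k\<in>{1..n - j}. m k)"
    using assms by (intro sum_nonneg) (auto simp: dominant_def)
  thus ?thesis by (simp add: schur_exp_def)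
qed

lemma det_schur_num_mat:
  assumes "dominant n m"
  shows "Determinant.det (schur_num_mat n m \<alpha>) = schur_poly n m \<alpha> * vdet n \<alpha>"
proof -
  have "schur_num_mat n m \<alpha> = Matrix.mat n n (\<lambda>(i, j). \<alpha> (Suc j) ^ nat (schur_exp n m (Suc i)))"
    unfolding schur_num_mat_eq using schur_exp_nonneg[OF assms]
    by (intro eq_matI) (auto simp: power_int_def)
  hence "Determinant.det (schur_num_mat n m \<alpha>) = newton_det n (\<lambda>i. nat (schur_exp n m (Suc i))) (\<lambda>j. \<alpha> (Suc j)) * node_prod n \<alpha>"
    using det_alternant[of n "\<lambda>j. \<alpha> (Suc j)" "\<lambda>i. nat (schur_exp n m (Suc i))"]
    by (simp add: node_prod_shift)
  thus ?thesis by (simp add: schur_poly_def vdet_eq antidiag_sign_cancel)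
qed

lemma schur_ratio_eq:
  assumes "dominant n m" "inj_on \<alpha> {1..n}"
  shows "schur_ratio n m \<alpha> = schur_poly n m \<alpha>"
  using assms vdet_eq_0_iff[of n \<alpha>] by (simp add: schur_ratio_def det_schur_num_mat vdet_def)

text \<open>Polynomiality in the nodes, phrased as an induction principle over closure under sums
  and products. One argument then serves both continuity in the tuple and holomorphy along a
  curve.\<close>

lemma newton_coeff_induct:
  assumes add: "\<And>f g. P f \<Longrightarrow> P g \<Longrightarrow> P (\<lambda>y. f y + g y :: complex)"
    and mult: "\<And>f g. P f \<Longrightarrow> P g \<Longrightarrow> P (\<lambda>y. f y * g y)"
    and const: "\<And>c. P (\<lambda>y. c)" and nodes: "\<And>l. P (\<lambda>y. u y l)"
  shows "P (\<lambda>y. newton_coeff (u y) k e)"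
proof -
  have sum: "P (\<lambda>y. \<Sum>i\<in>A. f i y)" if "\<And>i. P (f i)" for A :: "nat set" and f
    by (induction A rule: infinite_finite_induct) (auto intro: const add that)
  have pow: "P (\<lambda>y. u y l ^ i)" for l i
    by (induction i) (auto intro: const mult nodes)
  have "P (\<lambda>y. fps_nth (\<Prod>l<N. geo_fps (u y l)) e)" for N e
  proof (induction N arbitrary: e)
    case 0
    show ?case by (auto intro: const)
  next
    case (Suc N)
    show ?case by (simp add: fps_mult_nth) (intro sum mult pow Suc.IH)
  qed
  thus ?thesis
    by (cases "e < k") (auto simp: newton_coeff_def fps_X_power_mult_nth lessThan_Suc_atMost[symmetric] intro: const simp del: prod.lessThan_Suc)
qed

lemma schur_poly_induct:
  assumes add: "\<And>f g. P f \<Longrightarrow> P g \<Longrightarrow> P (\<lambda>y. f y + g y :: complex)"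
    and mult: "\<And>f g. P f \<Longrightarrow> P g \<Longrightarrow> P (\<lambda>y. f y * g y)"
    and const: "\<And>c. P (\<lambda>y. c)" and nodes: "\<And>l. P (\<lambda>y. u y l)"
  shows "P (\<lambda>y. schur_poly n m (u y))"
proof -
  have sum: "P (\<lambda>y. \<Sum>i\<in>A. f i y)" if "\<And>i. P (f i)" for A :: "(nat \<Rightarrow> nat) set" and f
    by (induction A rule: infinite_finite_induct) (auto intro: const add that)
  have prod: "P (\<lambda>y. \<Prod>i\<in>A. f i y)" if "\<And>i. i \<in> A \<Longrightarrow> P (f i)" for A :: "nat set" and f
    using that by (induction A rule: infinite_finite_induct) (auto intro: const mult)
  have nc: "P (\<lambda>y. newton_coeff (\<lambda>j. u y (Suc j)) k e)" for k e
    by (rule newton_coeff_induct[where u = "\<lambda>y j. u y (Suc j)"]) (auto intro: assms)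
  have "P (\<lambda>y. \<Prod>i = 0..<n. Matrix.mat n n (\<lambda>(i, k). newton_coeff (\<lambda>j. u y (Suc j)) k (f i)) $$ (i, p i))"
    if "p permutes {0..<n}" for p f
  proof -
    have "P (\<lambda>y. \<Prod>i = 0..<n. newton_coeff (\<lambda>j. u y (Suc j)) (p i) (f i))"
      by (intro prod nc)
    also have "(\<lambda>y. \<Prod>i = 0..<n. newton_coeff (\<lambda>j. u y (Suc j)) (p i) (f i)) =
      (\<lambda>y. \<Prod>i = 0..<n. Matrix.mat n n (\<lambda>(i, k). newton_coeff (\<lambda>j. u y (Suc j)) k (f i)) $$ (i, p i))"
      using permutes_in_image[OF that] by (intro ext prod.cong) auto
    finally show ?thesis .
  qed
  \<comment> \<open>The conditional makes the summand satisfy P for every function p, as the closure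
    rule for sums asks, and not only for permutations.\<close>
  hence "P (\<lambda>y. if p permutes {0..<n} then
     signof p * (\<Prod>i = 0..<n. Matrix.mat n n (\<lambda>(i, k). newton_coeff (\<lambda>j. u y (Suc j)) k (f i)) $$ (i, p i)) else 0)" for f p
    by (cases "p permutes {0..<n}") (simp_all only: if_True if_False mult const)
  hence "P (\<lambda>y. \<Sum>p\<in>{p. p permutes {0..<n}}. if p permutes {0..<n} then
     signof p * (\<Prod>i = 0..<n. Matrix.mat n n (\<lambda>(i, k). newton_coeff (\<lambda>j. u y (Suc j)) k (f i)) $$ (i, p i)) else 0)" for f
    by (intro sum)
  thus ?thesis
    unfolding schur_poly_def newton_det_def by (subst det_def'[where n = n]) (auto intro!: mult const)
qed

lemma continuous_on_schur_poly: "continuous_on S (schur_poly n m)"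
  by (rule schur_poly_induct[where u = "\<lambda>y. y" and P = "continuous_on S"])
     (auto intro: continuous_intros continuous_on_product_then_coordinatewise)

lemma holomorphic_on_schur_poly:
  assumes "\<And>l. (\<lambda>z. u z l) holomorphic_on S"
  shows "(\<lambda>z. schur_poly n m (u z)) holomorphic_on S"
  by (rule schur_poly_induct[where P = "\<lambda>f. f holomorphic_on S"]) (auto intro: holomorphic_intros assms)

text \<open>Conjugating by the successor map carries permutations of {0..<n} to permutations of
  {1..n} and preserves their signs, reconciling matrix indices with the indices of tuples.\<close>

lemma det_mat_permutes:
  "Determinant.det (Matrix.mat n n (\<lambda>(i, j). f (Suc i) (Suc j) :: complex)) =
   (\<Sum>\<sigma> | \<sigma> permutes {1..n}. of_int (sign \<sigma>) * (\<Prod>i\<in>{1..n}. f i (\<sigma> i)))"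
proof -
  let ?s = "map_permutation {0..<n} Suc" and ?t = "map_permutation {1..n} (\<lambda>i. i - 1)"
  have bs: "bij_betw Suc {0..<n} {1..n}" by (rule bij_betwI[of _ _ _ "\<lambda>i. i - 1"]) auto
  have bt: "bij_betw (\<lambda>i. i - 1) {1..n} {0..<n}" by (rule bij_betwI[of _ _ _ Suc]) auto
  have "Determinant.det (Matrix.mat n n (\<lambda>(i, j). f (Suc i) (Suc j))) =
    (\<Sum>p | p permutes {0..<n}. signof p * (\<Prod>i = 0..<n. f (Suc i) (Suc (p i))))"
    by (subst det_def'[where n = n])
       (auto intro!: sum.cong prod.cong dest: permutes_in_image)
  also have "\<dots> = (\<Sum>\<sigma> | \<sigma> permutes {1..n}. of_int (sign \<sigma>) * (\<Prod>i\<in>{1..n}. f i (\<sigma> i)))"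
  proof (rule sum.reindex_bij_witness[of _ ?t ?s])
    fix p assume "p \<in> {p. p permutes {0..<n}}"
    hence p: "p permutes {0..<n}" by simp
    show "?t (?s p) = p" using p by (intro map_permutation_compose_inv[OF bs]) auto
    show "?s p \<in> {\<sigma>. \<sigma> permutes {1..n}}" using map_permutation_permutes[OF bs p] by simp
    have "(\<Prod>i\<in>{1..n}. f i (?s p i)) = (\<Prod>i = 0..<n. f (Suc i) (?s p (Suc i)))"
      by (rule prod.reindex_bij_witness[of _ Suc "\<lambda>i. i - 1"]) auto
    also have "\<dots> = (\<Prod>i = 0..<n. f (Suc i) (Suc (p i)))"
      by (intro prod.cong) (auto simp: map_permutation_apply)
    finally show "of_int (sign (?s p)) * (\<Prod>i\<in>{1..n}. f i (?s p i)) = signof p * (\<Prod>i = 0..<n. f (Suc i) (Suc (p i)))"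
      using sign_map_permutation[of Suc "{0..<n}" p] p by (simp add: sign_def)
  next
    fix q assume "q \<in> {q. q permutes {1..n}}"
    hence q: "q permutes {1..n}" by simp
    show "?s (?t q) = q" using q by (intro map_permutation_compose_inv[OF bt]) auto
    show "?t q \<in> {\<sigma>. \<sigma> permutes {0..<n}}" using map_permutation_permutes[OF bt q] by simp
  qed
  finally show ?thesis .
qed

lemma det_schur_num_mat_sum:
  "Determinant.det (schur_num_mat n m \<alpha>) =
   (\<Sum>\<sigma> | \<sigma> permutes {1..n}. of_int (sign \<sigma>) * (\<Prod>i\<in>{1..n}. \<alpha> (\<sigma> i) powi schur_exp n m i))"
  using det_mat_permutes[of n "\<lambda>i j. \<alpha> j powi schur_exp n m i"] by (simp add: schur_num_mat_eq)

lemma vdet_sum: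
  "vdet n \<alpha> = (\<Sum>\<sigma> | \<sigma> permutes {1..n}. of_int (sign \<sigma>) * (\<Prod>i\<in>{1..n}. \<alpha> (\<sigma> i) ^ (n - i)))"
  using det_mat_permutes[of n "\<lambda>i j. \<alpha> j ^ (n - i)"] by (simp add: vdet_def vandermonde_mat_def)

lemma vdet_permute:
  assumes "\<tau> permutes {1..n}"
  shows "vdet n (\<alpha> \<circ> \<tau>) = of_int (sign \<tau>) * vdet n \<alpha>"
proof -
  have "vdet n (\<alpha> \<circ> \<tau>) = (\<Sum>\<sigma> | \<sigma> permutes {1..n}. of_int (sign \<tau>) * (of_int (sign (\<tau> \<circ> \<sigma>)) * (\<Prod>i\<in>{1..n}. \<alpha> ((\<tau> \<circ> \<sigma>) i) ^ (n - i))))"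
    unfolding vdet_sum using assms
    by (intro sum.cong) (auto simp: sign_compose permutes_imp_permutation[of "{1..n}"] simp flip: mult.assoc of_int_mult)
  also have "\<dots> = of_int (sign \<tau>) * vdet n \<alpha>"
    unfolding vdet_sum sum_distrib_left
    by (rule setum_permutations_compose_left[OF assms, symmetric])
  finally show ?thesis .
qed

section \<open>The discriminant as a product of two Vandermonde determinants\<close>

lemma prod_off_diagonal:
  fixes f :: "nat \<Rightarrow> nat \<Rightarrow> complex"
  shows "(\<Prod>i\<in>{1..n}. \<Prod>j\<in>{1..n} - {i}. f i j) = (\<Prod>j\<in>{1..n}. \<Prod>l\<in>{1..<j}. f j l * f l j)"
proof (induction n)
  case (Suc n)
  have "(\<Prod>i\<in>{1..Suc n}. \<Prod>j\<in>{1..Suc n} - {i}. f i j) =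
     (\<Prod>i\<in>{1..n}. \<Prod>j\<in>{1..Suc n} - {i}. f i j) * (\<Prod>j\<in>{1..Suc n} - {Suc n}. f (Suc n) j)" by simp
  also have "(\<Prod>i\<in>{1..n}. \<Prod>j\<in>{1..Suc n} - {i}. f i j) = (\<Prod>i\<in>{1..n}. f i (Suc n) * (\<Prod>j\<in>{1..n} - {i}. f i j))"
  proof (rule prod.cong)
    fix i assume "i \<in> {1..n}"
    hence "{1..Suc n} - {i} = insert (Suc n) ({1..n} - {i})" by auto
    thus "(\<Prod>j\<in>{1..Suc n} - {i}. f i j) = f i (Suc n) * (\<Prod>j\<in>{1..n} - {i}. f i j)" by simp
  qed simp
  also have "{1..Suc n} - {Suc n} = {1..n}" by auto
  finally show ?case
    using Suc.IH by (simp add: prod.distrib atLeastLessThanSuc_atLeastAtMost mult_ac)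
qed simp

lemma prod_pairs_mult:
  fixes \<beta> :: "nat \<Rightarrow> complex"
  shows "(\<Prod>j\<in>{1..n}. \<Prod>l\<in>{1..<j}. \<beta> j * \<beta> l) = (\<Prod>j\<in>{1..n}. \<beta> j) ^ (n - 1)"
proof (induction n)
  case (Suc n)
  have "(\<Prod>j\<in>{1..Suc n}. \<Prod>l\<in>{1..<j}. \<beta> j * \<beta> l) = (\<Prod>j\<in>{1..n}. \<beta> j) ^ (n - 1) * (\<beta> (Suc n) ^ n * (\<Prod>l\<in>{1..n}. \<beta> l))"
    using Suc.IH by (simp add: prod.distrib atLeastLessThanSuc_atLeastAtMost)
  thus ?case by (cases n) (auto simp: power_mult_distrib mult_ac)
qed simp

text \<open>Each difference 1/\<beta>_j - 1/\<beta>_l equals (\<beta>_l - \<beta>_j)/(\<beta>_j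
  \<beta>_l). Every variable lies in n - 1 pairs, so the denominators multiply to the (n-1)-st power
  of the product of all \<beta>_j, which is 1.\<close>

lemma vdet_mult_vdet_inv:
  assumes "\<And>j. j \<in> {1..n} \<Longrightarrow> \<beta> j \<noteq> 0" "(\<Prod>j\<in>{1..n}. \<beta> j) = 1"
  shows "vdet n (inv_tuple n \<beta>) * vdet n \<beta> = (\<Prod>i\<in>{1..n}. \<Prod>j\<in>{1..n} - {i}. \<beta> i - \<beta> j)"
proof -
  have "node_prod n (inv_tuple n \<beta>) = (\<Prod>j\<in>{1..n}. \<Prod>l\<in>{1..<j}. (\<beta> l - \<beta> j) / (\<beta> j * \<beta> l))"
    unfolding node_prod_def by (intro prod.cong) (use assms in \<open>auto simp: inv_tuple_def field_simps\<close>)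
  also have "\<dots> = (\<Prod>j\<in>{1..n}. \<Prod>l\<in>{1..<j}. \<beta> l - \<beta> j) / (\<Prod>j\<in>{1..n}. \<Prod>l\<in>{1..<j}. \<beta> j * \<beta> l)"
    by (simp add: prod_dividef)
  also have "\<dots> = (\<Prod>j\<in>{1..n}. \<Prod>l\<in>{1..<j}. \<beta> l - \<beta> j)"
    by (simp only: prod_pairs_mult assms(2)) simp
  finally have "node_prod n (inv_tuple n \<beta>) * node_prod n \<beta> = (\<Prod>j\<in>{1..n}. \<Prod>l\<in>{1..<j}. (\<beta> j - \<beta> l) * (\<beta> l - \<beta> j))"
    by (simp add: node_prod_def prod.distrib mult.commute)
  thus ?thesis by (simp only: vdet_eq prod_off_diagonal antidiag_sign_cancel)
qed

section \<open>Antisymmetric Laurent series and torus integrals\<close>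

lemma comp_permutes_int_tuples:
  assumes "e \<in> int_tuples n" "\<tau> permutes {1..n}"
  shows "e \<circ> \<tau> \<in> int_tuples n"
  using assms by (auto simp: int_tuples_def PiE_iff extensional_def permutes_not_in)

lemma comp_permutes_PiE:
  assumes "x \<in> {1..n} \<rightarrow>\<^sub>E U" "\<tau> permutes {1..n}"
  shows "x \<circ> \<tau> \<in> {1..n} \<rightarrow>\<^sub>E U"
  using assms permutes_in_image[OF assms(2)] by (auto simp: PiE_iff extensional_def permutes_not_in)

lemma bij_betw_comp_permutes_int_tuples:
  assumes "\<tau> permutes {1..n}"
  shows "bij_betw (\<lambda>e. e \<circ> \<tau>) (int_tuples n) (int_tuples n)"
  by (rule bij_betwI[of _ _ _ "\<lambda>e. e \<circ> inv_into UNIV \<tau>"])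
     (use assms in \<open>auto simp: comp_permutes_int_tuples permutes_inv comp_assoc permutes_inv_o\<close>)

lemma laurent_monom_permute:
  assumes "\<tau> permutes {1..n}"
  shows "laurent_monom n (e \<circ> \<tau>) (x \<circ> \<tau>) = laurent_monom n e x"
  unfolding laurent_monom_def using prod.permute[OF assms, of "\<lambda>i. x i powi e i"] by (simp add: o_def)

lemma ring_weight_permute:
  assumes "\<tau> permutes {1..n}"
  shows "ring_weight n \<rho> (e \<circ> \<tau>) = ring_weight n \<rho> e"
  unfolding ring_weight_def using prod.permute[OF assms, of "\<lambda>i. \<rho> ^ nat \<bar>e i\<bar>"] by (simp add: o_def)

lemma holomorphic_n_mult_vdet:
  assumes "holomorphic_n n U H"
  shows "holomorphic_n n U (\<lambda>x. H x * vdet n x)"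
  unfolding holomorphic_n_def
proof (intro conjI ballI)
  have coord: "continuous_on ({1..n} \<rightarrow>\<^sub>E U) (\<lambda>x. x i :: complex)" for i
    by (rule continuous_on_product_then_coordinatewise[OF continuous_on_id])
  show "continuous_on ({1..n} \<rightarrow>\<^sub>E U) (\<lambda>x. H x * vdet n x)"
    unfolding vdet_eq node_prod_def using assms
    by (intro continuous_on_mult continuous_on_prod continuous_on_diff continuous_on_const coord)
       (simp add: holomorphic_n_def)
  fix x i assume "x \<in> {1..n} \<rightarrow>\<^sub>E U" "i \<in> {1..n}"
  hence "(\<lambda>z. H (x(i := z))) holomorphic_on U" using assms by (simp add: holomorphic_n_def)
  moreover have "(\<lambda>z. (x(i := z)) j) holomorphic_on U" for j
    by (cases "j = i") (auto intro: holomorphic_intros)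
  ultimately show "(\<lambda>z. H (x(i := z)) * vdet n (x(i := z))) holomorphic_on U"
    unfolding vdet_eq node_prod_def
    by (intro holomorphic_on_mult holomorphic_on_prod holomorphic_on_diff holomorphic_on_const)
qed

lemma sign_square_complex: "complex_of_int (sign \<sigma>) * complex_of_int (sign \<sigma>) = 1"
  by (simp flip: of_int_mult)

lemma has_sum_finite_sum:
  fixes f :: "'i \<Rightarrow> 'a \<Rightarrow> complex"
  assumes "finite A" "\<And>i. i \<in> A \<Longrightarrow> (f i has_sum s i) B"
  shows "((\<lambda>x. \<Sum>i\<in>A. f i x) has_sum (\<Sum>i\<in>A. s i)) B"
  using assms by (induction A rule: finite_induct) (auto intro: has_sum_add)

text \<open>Averaging a Laurent expansion of \<open>H V\<close> over all permutations with signs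
  preserves its sum, because \<open>H V\<close> is antisymmetric, and its Cauchy bounds, because the
  weight is invariant. Antisymmetry of the coefficients then holds by construction, without appeal
  to uniqueness of Laurent coefficients.\<close>

lemma antisymmetric_laurent_series:
  assumes R: "1 < R" and H: "holomorphic_n n (open_ring R) H" and sym: "symmetric_n n (open_ring R) H"
  obtains a where
    "\<And>\<rho>. 1 \<le> \<rho> \<Longrightarrow> \<rho> < R \<Longrightarrow> (\<lambda>e. norm (a e) * ring_weight n \<rho> e) summable_on int_tuples n"
    "\<And>x. x \<in> {1..n} \<rightarrow>\<^sub>E open_ring R \<Longrightarrow> ((\<lambda>e. a e * laurent_monom n e x) has_sum H x * vdet n x) (int_tuples n)"
    "\<And>e \<sigma>. \<sigma> permutes {1..n} \<Longrightarrow> a (e \<circ> \<sigma>) = of_int (sign \<sigma>) * a e"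
proof -
  define G where "G x = H x * vdet n x" for x
  let ?P = "{\<tau>. \<tau> permutes {1..n}}"
  have card: "card ?P = fact n" using card_permutations[of "{1..n}" n] by simp
  have finP: "finite ?P" by (simp add: finite_permutations)
  have Gh: "holomorphic_n n (open_ring R) G" unfolding G_def by (rule holomorphic_n_mult_vdet[OF H])
  obtain b where
    b: "\<And>\<rho> M e. 1 \<le> \<rho> \<Longrightarrow> \<rho> < R \<Longrightarrow> (\<And>x. x \<in> {1..n} \<rightarrow>\<^sub>E closed_ring \<rho> \<Longrightarrow> norm (G x) \<le> M) \<Longrightarrow>
       e \<in> int_tuples n \<Longrightarrow> norm (b e) * ring_weight n \<rho> e \<le> M"
    and sum_b: "\<And>x. x \<in> {1..n} \<rightarrow>\<^sub>E open_ring R \<Longrightarrow> ((\<lambda>e. b e * laurent_monom n e x) has_sum G x) (int_tuples n)"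
    using laurent_series_n[OF R Gh] by blast
  define a where "a e = (\<Sum>\<tau>\<in>?P. of_int (sign \<tau>) * b (e \<circ> \<tau>)) / fact n" for e
  show ?thesis
  proof (rule that)
    fix \<rho> assume \<rho>: "1 \<le> \<rho>" "\<rho> < R"
    obtain \<rho>' where \<rho>': "\<rho> < \<rho>'" "\<rho>' < R" using dense \<rho> by blast
    obtain M where M: "\<And>x. x \<in> {1..n} \<rightarrow>\<^sub>E closed_ring \<rho>' \<Longrightarrow> norm (G x) \<le> M"
      using holomorphic_n_bounded_closed_ring[OF Gh, of \<rho>'] \<rho> \<rho>' by auto
    show "(\<lambda>e. norm (a e) * ring_weight n \<rho> e) summable_on int_tuples n"
    proof (rule laurent_coeff_bound_imp_summable[of _ _ \<rho>' M])
      fix e assume e: "e \<in> int_tuples n"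
      let ?w = "ring_weight n \<rho>' e"
      have w: "0 < ?w" using ring_weight_pos[of \<rho>'] \<rho> \<rho>' by auto
      have "norm (a e) \<le> (\<Sum>\<tau>\<in>?P. norm (of_int (sign \<tau>) * b (e \<circ> \<tau>))) / fact n"
        unfolding a_def norm_divide by (intro divide_mono norm_sum) auto
      also have "\<dots> \<le> (\<Sum>\<tau>\<in>?P. M / ?w) / fact n"
      proof (intro divide_right_mono sum_mono)
        fix \<tau> assume "\<tau> \<in> ?P"
        hence \<tau>: "\<tau> permutes {1..n}" by simp
        have "norm (b (e \<circ> \<tau>)) * ring_weight n \<rho>' (e \<circ> \<tau>) \<le> M"
          by (rule b[OF _ \<rho>'(2) M comp_permutes_int_tuples[OF e \<tau>]]) (use \<rho> \<rho>' in auto)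
        hence "norm (b (e \<circ> \<tau>)) * ?w \<le> M" by (simp only: ring_weight_permute[OF \<tau>])
        thus "norm (of_int (sign \<tau>) * b (e \<circ> \<tau>)) \<le> M / ?w"
          using w by (auto simp: norm_mult field_simps sign_def)
      qed auto
      also have "\<dots> = M / ?w" by (simp only: sum_constant card) simp
      finally show "norm (a e) * ?w \<le> M" using w by (simp add: field_simps)
    qed (use \<rho> \<rho>' in auto)
  next
    fix x assume x: "x \<in> {1..n} \<rightarrow>\<^sub>E open_ring R"
    have "((\<lambda>e. of_int (sign \<tau>) * (b (e \<circ> \<tau>) * laurent_monom n e x)) has_sum G x) (int_tuples n)"
      if "\<tau> \<in> ?P" for \<tau>
    proof -
      have \<tau>: "\<tau> permutes {1..n}" using that by simp
      have "((\<lambda>e. b e * laurent_monom n e (x \<circ> \<tau>)) has_sum G (x \<circ> \<tau>)) (int_tuples n)"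
        by (intro sum_b comp_permutes_PiE x \<tau>)
      hence "((\<lambda>e. b (e \<circ> \<tau>) * laurent_monom n (e \<circ> \<tau>) (x \<circ> \<tau>)) has_sum G (x \<circ> \<tau>)) (int_tuples n)"
        by (subst has_sum_reindex_bij_betw[OF bij_betw_comp_permutes_int_tuples[OF \<tau>], where f = "\<lambda>e. b e * laurent_monom n e (x \<circ> \<tau>)"])
      hence "((\<lambda>e. b (e \<circ> \<tau>) * laurent_monom n e x) has_sum G (x \<circ> \<tau>)) (int_tuples n)"
        by (simp add: laurent_monom_permute[OF \<tau>])
      hence "((\<lambda>e. of_int (sign \<tau>) * (b (e \<circ> \<tau>) * laurent_monom n e x)) has_sum of_int (sign \<tau>) * G (x \<circ> \<tau>)) (int_tuples n)"
        by (rule has_sum_cmult_right)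
      also have "of_int (sign \<tau>) * G (x \<circ> \<tau>) = (of_int (sign \<tau>) * of_int (sign \<tau>)) * G x"
        using sym x \<tau> by (simp add: G_def vdet_permute[OF \<tau>] symmetric_n_def mult_ac)
      finally show ?thesis by (simp only: sign_square_complex mult_1)
    qed
    hence "((\<lambda>e. \<Sum>\<tau>\<in>?P. of_int (sign \<tau>) * (b (e \<circ> \<tau>) * laurent_monom n e x)) has_sum (\<Sum>\<tau>\<in>?P. G x)) (int_tuples n)"
      by (intro has_sum_finite_sum finP)
    hence "((\<lambda>e. 1 / fact n * (\<Sum>\<tau>\<in>?P. of_int (sign \<tau>) * (b (e \<circ> \<tau>) * laurent_monom n e x))) has_sum 1 / fact n * (\<Sum>\<tau>\<in>?P. G x)) (int_tuples n)"
      by (rule has_sum_cmult_right)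
    thus "((\<lambda>e. a e * laurent_monom n e x) has_sum H x * vdet n x) (int_tuples n)"
      by (simp add: a_def card[unfolded One_nat_def] G_def sum_distrib_right mult.assoc)
  next
    fix e :: "nat \<Rightarrow> int" and \<sigma> assume \<sigma>: "\<sigma> permutes {1..n}"
    have "(\<Sum>\<tau>\<in>?P. of_int (sign \<tau>) * b (e \<circ> \<sigma> \<circ> \<tau>)) = (\<Sum>\<tau>\<in>?P. of_int (sign \<sigma>) * (of_int (sign (\<sigma> \<circ> \<tau>)) * b (e \<circ> (\<sigma> \<circ> \<tau>))))"
    proof (rule sum.cong)
      fix \<tau> assume "\<tau> \<in> ?P"
      hence "of_int (sign (\<sigma> \<circ> \<tau>)) = complex_of_int (sign \<sigma>) * complex_of_int (sign \<tau>)"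
        using \<sigma> permutes_imp_permutation[of "{1..n}"] by (simp add: sign_compose)
      thus "of_int (sign \<tau>) * b (e \<circ> \<sigma> \<circ> \<tau>) = of_int (sign \<sigma>) * (of_int (sign (\<sigma> \<circ> \<tau>)) * b (e \<circ> (\<sigma> \<circ> \<tau>)))"
        using sign_square_complex[of \<sigma>] by (simp add: comp_assoc flip: mult.assoc)
    qed simp
    also have "\<dots> = of_int (sign \<sigma>) * (\<Sum>\<tau>\<in>?P. of_int (sign \<tau>) * b (e \<circ> \<tau>))"
      unfolding sum_distrib_left by (rule setum_permutations_compose_left[OF \<sigma>, symmetric])
    finally show "a (e \<circ> \<sigma>) = of_int (sign \<sigma>) * a e" by (simp add: a_def)
  qed
qed

section \<open>Fourier analysis on the torus of product one\<close>

abbreviation angle_measure :: "nat \<Rightarrow> (nat \<Rightarrow> real) measure" where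
  "angle_measure n \<equiv> (\<Pi>\<^sub>M k\<in>{1..<n}. lebesgue_on {0..2 * pi})"

lemma finite_measure_circle: "finite_measure (lebesgue_on {0..2 * pi :: real})"
  by (rule finite_measureI) (simp add: emeasure_restrict_space)

lemma product_sigma_finite_circle: "product_sigma_finite (\<lambda>k. lebesgue_on {0..2 * pi :: real})"
  by (simp add: product_sigma_finite_def finite_measure_circle finite_measure.axioms(1))

lemma finite_measure_angle: "finite_measure (angle_measure n)"
proof (rule finite_measureI)
  interpret product_sigma_finite "\<lambda>k::nat. lebesgue_on {0..2 * pi :: real}"
    by (rule product_sigma_finite_circle)
  have "emeasure (angle_measure n) (space (angle_measure n)) = (\<Prod>k\<in>{1..<n}. emeasure (lebesgue_on {0..2 * pi}) {0..2 * pi})"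
    unfolding space_PiM by (subst emeasure_PiM) (auto simp: space_restrict_space sets_restrict_space)
  also have "\<dots> < \<infinity>"
    by (simp add: emeasure_restrict_space ennreal_power)
  finally show "emeasure (angle_measure n) (space (angle_measure n)) \<noteq> \<infinity>" by simp
qed

lemma integral_cis_powi:
  "(LINT t|lebesgue_on {0..2 * pi}. cis t powi k) = (if k = 0 then 2 * pi else 0)"
proof -
  have "continuous_on {0..2 * pi} (\<lambda>t. cis (of_int k * t))" by (intro continuous_intros)
  hence "integrable (lebesgue_on {0..2 * pi}) (\<lambda>t. cis (of_int k * t))"
    by (rule continuous_imp_integrable_real)
  hence eq: "(LINT t|lebesgue_on {0..2 * pi}. cis (of_int k * t)) = integral {0..2 * pi} (\<lambda>t. cis (of_int k * t))"
    by (intro lebesgue_integral_eq_integral) auto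
  show ?thesis
  proof (cases "k = 0")
    case True
    thus ?thesis using eq by (simp add: scaleR_conv_of_real)
  next
    case False
    have "((\<lambda>t. cis (of_int k * t)) has_integral
        (cis (of_int k * (2 * pi)) / (\<i> * of_int k) - cis (of_int k * 0) / (\<i> * of_int k))) {0..2 * pi}"
    proof (rule fundamental_theorem_of_calculus)
      fix t :: real
      show "((\<lambda>t. cis (of_int k * t) / (\<i> * of_int k)) has_vector_derivative cis (of_int k * t)) (at t within {0..2 * pi})"
        unfolding cis_conv_exp of_real_mult of_real_of_int_eq
      proof (rule has_vector_derivative_real_field)
        have "((\<lambda>z. exp (\<i> * (of_int k * z))) has_field_derivative exp (\<i> * (of_int k * of_real t)) * (\<i> * of_int k)) (at (of_real t))"
          by (auto intro!: derivative_eq_intros)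
        from DERIV_cdivide[OF this, of "\<i> * of_int k"] False
        show "((\<lambda>z. exp (\<i> * (of_int k * z)) / (\<i> * of_int k)) has_field_derivative exp (\<i> * (of_int k * of_real t))) (at (of_real t))"
          by simp
      qed
    qed simp
    moreover have "cis (of_int k * (2 * pi)) = 1"
      using cis_multiple_2pi[of "of_int k"] by (simp add: mult.commute mult.left_commute)
    ultimately have "integral {0..2 * pi} (\<lambda>t. cis (of_int k * t)) = 0" by (simp add: integral_unique)
    thus ?thesis using False eq by (simp add: cis_power_int)
  qed
qed

lemma integrable_cis_powi: "integrable (lebesgue_on {0..2 * pi}) (\<lambda>t. cis t powi k)"
  unfolding cis_power_int by (intro continuous_imp_integrable_real continuous_intros)

lemma powi_prod: "(\<Prod>i\<in>A. f i :: complex) powi k = (\<Prod>i\<in>A. f i powi k)"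
  by (induction A rule: infinite_finite_induct) (auto simp: power_int_mult_distrib)

text \<open>Eliminating the last coordinate, the inverse product of the others, leaves a character
  that depends only on the differences d j - d n. Hence exponents differing by a multiple of (1,
  ..., 1) cannot be told apart.\<close>

lemma laurent_monom_torus_pt:
  assumes "1 \<le> n"
  shows "laurent_monom n d (torus_pt n \<theta>) = (\<Prod>j\<in>{1..<n}. cis (\<theta> j) powi (d j - d n))"
proof -
  have "{1..n} = insert n {1..<n}" using assms by auto
  hence "laurent_monom n d (torus_pt n \<theta>) = (1 / (\<Prod>l\<in>{1..<n}. cis (\<theta> l))) powi d n * (\<Prod>j\<in>{1..<n}. cis (\<theta> j) powi d j)"
    unfolding laurent_monom_def torus_pt_def by (auto intro!: prod.cong)
  also have "(1 / (\<Prod>l\<in>{1..<n}. cis (\<theta> l))) powi d n = 1 / (\<Prod>l\<in>{1..<n}. cis (\<theta> l) powi d n)"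
    by (simp add: power_int_divide_distrib powi_prod)
  also have "\<dots> * (\<Prod>j\<in>{1..<n}. cis (\<theta> j) powi d j) = (\<Prod>j\<in>{1..<n}. cis (\<theta> j) powi (d j - d n))"
    by (simp add: power_int_diff prod_dividef)
  finally show ?thesis .
qed

lemma integrable_laurent_monom_torus:
  assumes "1 \<le> n"
  shows "integrable (angle_measure n) (\<lambda>\<theta>. laurent_monom n d (torus_pt n \<theta>))"
proof -
  interpret product_sigma_finite "\<lambda>k::nat. lebesgue_on {0..2 * pi :: real}"
    by (rule product_sigma_finite_circle)
  show ?thesis unfolding laurent_monom_torus_pt[OF assms]
    by (rule product_integrable_prod) (auto intro: integrable_cis_powi)
qed

lemma integral_laurent_monom_torus:
  assumes "1 \<le> n"
  shows "(LINT \<theta>|angle_measure n. laurent_monom n d (torus_pt n \<theta>)) =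
    (if \<forall>j\<in>{1..n}. d j = d n then (2 * pi) ^ (n - 1) else 0)"
proof -
  interpret product_sigma_finite "\<lambda>k::nat. lebesgue_on {0..2 * pi :: real}"
    by (rule product_sigma_finite_circle)
  have "(LINT \<theta>|angle_measure n. laurent_monom n d (torus_pt n \<theta>)) =
    (\<Prod>j\<in>{1..<n}. LINT t|lebesgue_on {0..2 * pi}. cis t powi (d j - d n))"
    unfolding laurent_monom_torus_pt[OF assms]
    by (rule product_integral_prod) (auto intro: integrable_cis_powi)
  also have "\<dots> = (\<Prod>j\<in>{1..<n}. if d j = d n then of_real (2 * pi) else 0)"
    by (intro prod.cong) (auto simp: integral_cis_powi)
  also have "\<dots> = (if \<forall>j\<in>{1..n}. d j = d n then (2 * pi) ^ (n - 1) else 0)"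
  proof (cases "\<forall>j\<in>{1..n}. d j = d n")
    case True
    have "(\<Prod>j\<in>{1..<n}. if d j = d n then complex_of_real (2 * pi) else 0) = (\<Prod>j\<in>{1..<n}. complex_of_real (2 * pi))"
    proof (intro prod.cong refl if_P)
      fix j assume "j \<in> {1..<n}"
      hence "j \<in> {1..n}" by simp
      with True show "d j = d n" by (rule bspec)
    qed
    also have "\<dots> = of_real ((2 * pi) ^ (n - 1))" by simp
    finally show ?thesis unfolding if_P[OF True] .
  next
    case False
    then obtain j where "j \<in> {1..n}" "d j \<noteq> d n" by blast
    hence "j \<in> {1..<n}" "d j \<noteq> d n" by (auto simp: order_le_less)
    hence "(\<Prod>j\<in>{1..<n}. if d j = d n then complex_of_real (2 * pi) else 0) = 0"
      by (intro prod_zero bexI[of _ j]) auto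
    thus ?thesis unfolding if_not_P[OF False] of_real_0 .
  qed
  finally show ?thesis .
qed

lemma norm_has_sum_tail_le:
  fixes f :: "'i \<Rightarrow> complex"
  assumes "(f has_sum s) I" "\<And>i. i \<in> I \<Longrightarrow> norm (f i) \<le> b i" "b summable_on I" "finite F" "F \<subseteq> I"
  shows "norm (s - sum f F) \<le> infsum b I - sum b F"
proof (rule norm_infsum_le)
  show "(f has_sum s - sum f F) (I - F)" "(b has_sum infsum b I - sum b F) (I - F)"
    using assms by (auto intro!: has_sum_Diff)
qed (use assms in auto)

text \<open>Termwise integration of an unordered sum with a constant majorant for each term: the
  tails of b bound the error uniformly on the space, which has finite measure.\<close>

lemma has_sum_integral_dominated:
  fixes f :: "'i \<Rightarrow> 'a \<Rightarrow> complex"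
  assumes "finite_measure M"
    and f: "\<And>i. i \<in> I \<Longrightarrow> integrable M (f i)"
    and b: "\<And>i x. i \<in> I \<Longrightarrow> x \<in> space M \<Longrightarrow> norm (f i x) \<le> b i"
    and bs: "b summable_on I"
    and g: "\<And>x. x \<in> space M \<Longrightarrow> ((\<lambda>i. f i x) has_sum g x) I"
  shows "integrable M g" "((\<lambda>i. integral\<^sup>L M (f i)) has_sum integral\<^sup>L M g) I"
proof -
  interpret finite_measure M by fact
  define B where "B F = infsum b I - sum b F" for F
  have Blim: "(B \<longlongrightarrow> 0) (finite_subsets_at_top I)"
    using tendsto_diff[OF tendsto_const[of "infsum b I"] infsum_tendsto[OF bs]] by (simp add: B_def[abs_def])
  have bound: "norm (g x - (\<Sum>i\<in>F. f i x)) \<le> B F" if F: "finite F" "F \<subseteq> I" and x: "x \<in> space M" for F x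
    unfolding B_def using b[OF _ x] by (intro norm_has_sum_tail_le g x bs F)
  \<comment> \<open>Measurability of g needs a limit along a sequence, so finite sets with tails
    below 1/(k+1) are picked from the net of all finite subsets.\<close>
  have "\<exists>F. finite F \<and> F \<subseteq> I \<and> B F < 1 / real (Suc k)" for k
  proof -
    have "eventually (\<lambda>F. B F < 1 / real (Suc k)) (finite_subsets_at_top I)"
      by (rule order_tendstoD(2)[OF Blim]) simp
    thus ?thesis by (auto simp: eventually_finite_subsets_at_top)
  qed
  then obtain F where F: "\<And>k. finite (F k)" "\<And>k. F k \<subseteq> I" "\<And>k. B (F k) < 1 / real (Suc k)" by metis
  have gm: "g \<in> borel_measurable M"
  proof (rule borel_measurable_LIMSEQ_metric)
    show "(\<lambda>x. \<Sum>i\<in>F k. f i x) \<in> borel_measurable M" for k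
      by (intro borel_measurable_sum borel_measurable_integrable f) (use F(2)[of k] in blast)
    fix x assume x: "x \<in> space M"
    have "(\<lambda>k. (\<Sum>i\<in>F k. f i x) - g x) \<longlonglongrightarrow> 0"
    proof (rule Lim_null_comparison)
      show "\<forall>\<^sub>F k in sequentially. norm ((\<Sum>i\<in>F k. f i x) - g x) \<le> 1 / real (Suc k)"
      proof (intro always_eventually allI)
        fix k
        show "norm ((\<Sum>i\<in>F k. f i x) - g x) \<le> 1 / real (Suc k)"
          using bound[OF F(1) F(2) x, of k] F(3)[of k] by (simp add: norm_minus_commute)
      qed
      show "(\<lambda>k. 1 / real (Suc k)) \<longlonglongrightarrow> 0"
        using LIMSEQ_inverse_real_of_nat by (simp add: inverse_eq_divide)
    qed
    thus "(\<lambda>k. \<Sum>i\<in>F k. f i x) \<longlonglongrightarrow> g x" by (rule LIM_zero_cancel)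
  qed
  show gi: "integrable M g"
    using bound[of "{}"] gm by (intro integrable_const_bound[of _ "B {}"]) auto
  have "norm (integral\<^sup>L M g - (\<Sum>i\<in>F. integral\<^sup>L M (f i))) \<le> B F * measure M (space M)"
    if F: "finite F" "F \<subseteq> I" for F
  proof -
    have int: "integrable M (\<lambda>x. \<Sum>i\<in>F. f i x)" using F f by (intro Bochner_Integration.integrable_sum) auto
    have "integral\<^sup>L M g - (\<Sum>i\<in>F. integral\<^sup>L M (f i)) = (LINT x|M. g x - (\<Sum>i\<in>F. f i x))"
      using F f gi int by (simp add: Bochner_Integration.integral_diff Bochner_Integration.integral_sum subset_iff)
    also have "norm \<dots> \<le> (LINT x|M. norm (g x - (\<Sum>i\<in>F. f i x)))" by (rule integral_norm_bound)
    also have "\<dots> \<le> (LINT x|M. B F)"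
      using bound[OF F] gi int by (intro integral_mono integrable_norm Bochner_Integration.integrable_diff) auto
    also have "\<dots> = B F * measure M (space M)" by simp
    finally show ?thesis .
  qed
  hence "\<forall>\<^sub>F F in finite_subsets_at_top I. norm ((\<Sum>i\<in>F. integral\<^sup>L M (f i)) - integral\<^sup>L M g) \<le> B F * measure M (space M)"
    by (intro eventually_finite_subsets_at_top_weakI) (auto simp: norm_minus_commute)
  hence "((\<lambda>F. (\<Sum>i\<in>F. integral\<^sup>L M (f i)) - integral\<^sup>L M g) \<longlongrightarrow> 0) (finite_subsets_at_top I)"
    by (rule Lim_null_comparison) (use tendsto_mult_right[OF Blim] in auto)
  thus "((\<lambda>i. integral\<^sup>L M (f i)) has_sum integral\<^sup>L M g) I"
    unfolding has_sum_def by (rule LIM_zero_cancel)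
qed

section \<open>Fourier coefficients and regrouping\<close>

definition shift_tuple :: "nat \<Rightarrow> (nat \<Rightarrow> int) \<Rightarrow> int \<Rightarrow> nat \<Rightarrow> int" where
  "shift_tuple n f k = restrict (\<lambda>i. f i + k) {1..n}"

lemma shift_tuple_in: "shift_tuple n f k \<in> int_tuples n"
  by (auto simp: shift_tuple_def int_tuples_def)

lemma shift_tuple_permute:
  assumes "\<sigma> permutes {1..n}"
  shows "shift_tuple n (f \<circ> \<sigma>) k = shift_tuple n f k \<circ> \<sigma>"
  using permutes_in_image[OF assms] permutes_not_in[OF assms] by (auto simp: shift_tuple_def fun_eq_iff)

lemma torus_pt_norm: "1 \<le> n \<Longrightarrow> i \<in> {1..n} \<Longrightarrow> norm (torus_pt n \<theta> i) = 1"
  by (auto simp: torus_pt_def norm_divide simp flip: prod_norm)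

lemma torus_pt_in:
  assumes "1 < R" "1 \<le> n"
  shows "torus_pt n \<theta> \<in> {1..n} \<rightarrow>\<^sub>E open_ring R"
proof (rule PiE_I)
  fix i assume "i \<in> {1..n}"
  thus "torus_pt n \<theta> i \<in> open_ring R"
    using torus_pt_norm[OF assms(2), of i \<theta>] assms by (simp add: open_ring_def)
next
  fix i assume "i \<notin> {1..n}"
  thus "torus_pt n \<theta> i = undefined" using assms by (auto simp: torus_pt_def)
qed

lemma torus_pt_nonzero: "1 \<le> n \<Longrightarrow> i \<in> {1..n} \<Longrightarrow> torus_pt n \<theta> i \<noteq> 0"
  using torus_pt_norm[of n i \<theta>] by auto

lemma torus_pt_prod:
  assumes "1 \<le> n"
  shows "(\<Prod>i\<in>{1..n}. torus_pt n \<theta> i) = 1"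
proof -
  have "{1..n} = insert n {1..<n}" using assms by auto
  hence "(\<Prod>i\<in>{1..n}. torus_pt n \<theta> i) = torus_pt n \<theta> n * (\<Prod>i\<in>{1..<n}. torus_pt n \<theta> i)" by simp
  also have "(\<Prod>i\<in>{1..<n}. torus_pt n \<theta> i) = (\<Prod>i\<in>{1..<n}. cis (\<theta> i))"
    by (intro prod.cong) (auto simp: torus_pt_def)
  finally show ?thesis by (simp add: torus_pt_def)
qed

lemma laurent_monom_mult:
  assumes "\<And>i. i \<in> {1..n} \<Longrightarrow> x i \<noteq> 0"
  shows "laurent_monom n e x * laurent_monom n f x = laurent_monom n (\<lambda>i. e i + f i) x"
  unfolding laurent_monom_def prod.distrib[symmetric]
  by (intro prod.cong) (use assms in \<open>auto simp: power_int_add\<close>)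

text \<open>Monomials have modulus 1 on the torus, so |a e| is the majorant. Integration against the
  monomial of -f keeps exactly those e for which e - f is constant.\<close>

lemma torus_fourier_coeff:
  fixes f :: "nat \<Rightarrow> int" and G :: "(nat \<Rightarrow> complex) \<Rightarrow> complex"
  assumes n: "1 \<le> n" and a: "(\<lambda>e. norm (a e)) summable_on int_tuples n"
    and G: "\<And>\<theta>. ((\<lambda>e. a e * laurent_monom n e (torus_pt n \<theta>)) has_sum G (torus_pt n \<theta>)) (int_tuples n)"
  defines "F \<equiv> \<lambda>\<theta>. G (torus_pt n \<theta>) * laurent_monom n (\<lambda>i. - f i) (torus_pt n \<theta>)"
  shows "integrable (angle_measure n) F"
    and "((\<lambda>k. of_real ((2 * pi) ^ (n - 1)) * a (shift_tuple n f k)) has_sum integral\<^sup>L (angle_measure n) F) UNIV"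
proof -
  have mult: "laurent_monom n e (torus_pt n \<theta>) * laurent_monom n (\<lambda>i. - f i) (torus_pt n \<theta>)
      = laurent_monom n (\<lambda>i. e i - f i) (torus_pt n \<theta>)" for e \<theta>
    by (subst laurent_monom_mult) (use torus_pt_nonzero[OF n] in auto)
  have norm1: "norm (laurent_monom n d (torus_pt n \<theta>)) = 1" for d \<theta>
    by (simp add: laurent_monom_torus_pt[OF n] norm_power_int flip: prod_norm)
  define g where "g e \<theta> = a e * laurent_monom n (\<lambda>i. e i - f i) (torus_pt n \<theta>)" for e \<theta>
  have gs: "((\<lambda>e. g e \<theta>) has_sum F \<theta>) (int_tuples n)" for \<theta>
    using has_sum_cmult_left[OF G[of \<theta>], where c = "laurent_monom n (\<lambda>i. - f i) (torus_pt n \<theta>)"]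
    by (simp add: g_def F_def mult mult.assoc)
  have gi: "integrable (angle_measure n) (g e)" for e
    unfolding g_def by (intro integrable_mult_right integrable_laurent_monom_torus n)
  have gb: "norm (g e \<theta>) \<le> norm (a e)" for e \<theta> by (simp add: g_def norm_mult norm1)
  show "integrable (angle_measure n) F"
    by (rule has_sum_integral_dominated(1)[OF finite_measure_angle gi gb a gs])
  have "((\<lambda>e. integral\<^sup>L (angle_measure n) (g e)) has_sum integral\<^sup>L (angle_measure n) F) (int_tuples n)"
    by (rule has_sum_integral_dominated(2)[OF finite_measure_angle gi gb a gs])
  moreover have "integral\<^sup>L (angle_measure n) (g e) =
      a e * of_real (if \<forall>j\<in>{1..n}. e j - f j = e n - f n then (2 * pi) ^ (n - 1) else 0)" for e
    unfolding g_def by (simp only: integral_mult_right_zero integral_laurent_monom_torus[OF n])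
  ultimately have S: "((\<lambda>e. a e * of_real (if \<forall>j\<in>{1..n}. e j - f j = e n - f n then (2 * pi) ^ (n - 1) else 0))
      has_sum integral\<^sup>L (angle_measure n) F) (int_tuples n)" by (simp only:)
  \<comment> \<open>The coset of f modulo multiples of (1, ..., 1); the last coordinate of e - f
    recovers the shift.\<close>
  define J where "J = {e \<in> int_tuples n. \<forall>j\<in>{1..n}. e j - f j = e n - f n}"
  have "((\<lambda>e. of_real ((2 * pi) ^ (n - 1)) * a e) has_sum integral\<^sup>L (angle_measure n) F) J"
  proof (rule has_sum_cong_neutral[THEN iffD1, OF _ _ _ S])
    show "a e * of_real (if \<forall>j\<in>{1..n}. e j - f j = e n - f n then (2 * pi) ^ (n - 1) else 0) = 0"
      if "e \<in> int_tuples n - J" for e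
    proof -
      have "\<not> (\<forall>j\<in>{1..n}. e j - f j = e n - f n)" using that unfolding J_def by blast
      thus ?thesis by (simp only: if_False of_real_0 mult_zero_right)
    qed
    show "a e * of_real (if \<forall>j\<in>{1..n}. e j - f j = e n - f n then (2 * pi) ^ (n - 1) else 0) =
        of_real ((2 * pi) ^ (n - 1)) * a e" if "e \<in> int_tuples n \<inter> J" for e
    proof -
      have "\<forall>j\<in>{1..n}. e j - f j = e n - f n" using that unfolding J_def by blast
      from if_P[OF this, of "(2 * pi) ^ (n - 1)" 0] show ?thesis by (simp only: mult.commute)
    qed
  qed (unfold J_def, blast)
  moreover have "bij_betw (shift_tuple n f) UNIV J"
  proof (rule bij_betwI[of _ _ _ "\<lambda>e. e n - f n"])
    have "shift_tuple n f k j - f j = shift_tuple n f k n - f n" if "j \<in> {1..n}" for j k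
      using that n by (simp add: shift_tuple_def)
    thus "shift_tuple n f \<in> UNIV \<rightarrow> J" using shift_tuple_in unfolding J_def by blast
    show "shift_tuple n f k n - f n = k" for k
      using n by (simp add: shift_tuple_def)
    fix e assume e: "e \<in> J"
    show "shift_tuple n f (e n - f n) = e"
    proof
      fix i
      show "shift_tuple n f (e n - f n) i = e i"
      proof (cases "i \<in> {1..n}")
        case True
        with e have "e i - f i = e n - f n" unfolding J_def by blast
        thus ?thesis using True by (simp add: shift_tuple_def)
      next
        case False
        have "e \<in> int_tuples n" using e unfolding J_def by blast
        thus ?thesis using False by (auto simp: shift_tuple_def int_tuples_def PiE_iff extensional_def)
      qed
    qed
  qed simp
  ultimately show "((\<lambda>k. of_real ((2 * pi) ^ (n - 1)) * a (shift_tuple n f k)) has_sum integral\<^sup>L (angle_measure n) F) UNIV"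
    using has_sum_reindex_bij_betw[of "shift_tuple n f" UNIV J "\<lambda>e. of_real ((2 * pi) ^ (n - 1)) * a e"] by simp
qed

text \<open>Summing over inverse permutations moves the permutation from the variables to the
  exponents, where the antisymmetry of the Laurent coefficients can act.\<close>

lemma det_schur_num_mat_sum_inv:
  "Determinant.det (schur_num_mat n m x) =
   (\<Sum>\<sigma> | \<sigma> permutes {1..n}. of_int (sign \<sigma>) * laurent_monom n (schur_exp n m \<circ> \<sigma>) x)"
proof -
  have "Determinant.det (schur_num_mat n m x) = (\<Sum>\<sigma> | \<sigma> permutes {1..n}. of_int (sign (inv_into UNIV \<sigma>)) *
      (\<Prod>i\<in>{1..n}. x (inv_into UNIV \<sigma> i) powi schur_exp n m i))"
    unfolding det_schur_num_mat_sum by (rule sum_permutations_inverse)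
  also have "\<dots> = (\<Sum>\<sigma> | \<sigma> permutes {1..n}. of_int (sign \<sigma>) * laurent_monom n (schur_exp n m \<circ> \<sigma>) x)"
  proof (rule sum.cong)
    fix \<sigma> assume "\<sigma> \<in> {\<sigma>. \<sigma> permutes {1..n}}"
    hence \<sigma>: "\<sigma> permutes {1..n}" by simp
    have "(\<Prod>i\<in>{1..n}. x (inv_into UNIV \<sigma> i) powi schur_exp n m i) =
      (\<Prod>i\<in>{1..n}. x (inv_into UNIV \<sigma> (\<sigma> i)) powi schur_exp n m (\<sigma> i))"
      using prod.permute[OF \<sigma>, of "\<lambda>i. x (inv_into UNIV \<sigma> i) powi schur_exp n m i"] by (simp add: o_def)
    thus "of_int (sign (inv_into UNIV \<sigma>)) * (\<Prod>i\<in>{1..n}. x (inv_into UNIV \<sigma> i) powi schur_exp n m i) =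
      of_int (sign \<sigma>) * laurent_monom n (schur_exp n m \<circ> \<sigma>) x"
      using permutes_inverses(2)[OF \<sigma>] sign_inverse[OF permutes_imp_permutation[OF _ \<sigma>]]
      by (simp add: laurent_monom_def)
  qed simp
  finally show ?thesis .
qed

text \<open>\<open>H_flat\<close> at a dominant p^m with the factor \<delta>^(1/2) removed, so that
  p no longer appears.\<close>

definition flat_coeff :: "nat \<Rightarrow> ((nat \<Rightarrow> complex) \<Rightarrow> complex) \<Rightarrow> (nat \<Rightarrow> int) \<Rightarrow> complex" where
  "flat_coeff n H m = complex_of_real (1 / (fact n * (2 * pi) ^ (n - 1))) *
     (LINT \<theta>|angle_measure n. H (torus_pt n \<theta>) * schur n m (inv_tuple n (torus_pt n \<theta>)) *
        (\<Prod>i\<in>{1..n}. \<Prod>j\<in>{1..n} - {i}. torus_pt n \<theta> i - torus_pt n \<theta> j))"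

text \<open>The discriminant V(\<beta>) V(1/\<beta>) cancels the denominator V(1/\<beta>) of the
  Schur quotient. At coincident coordinates both sides vanish, whatever value \<open>schur\<close>
  takes there.\<close>

lemma schur_times_discriminant:
  assumes "\<And>j. j \<in> {1..n} \<Longrightarrow> \<beta> j \<noteq> 0" "(\<Prod>j\<in>{1..n}. \<beta> j) = 1"
  shows "schur n m (inv_tuple n \<beta>) * (\<Prod>i\<in>{1..n}. \<Prod>j\<in>{1..n} - {i}. \<beta> i - \<beta> j) =
    vdet n \<beta> * Determinant.det (schur_num_mat n m (inv_tuple n \<beta>))"
proof -
  have inj: "inj_on (inv_tuple n \<beta>) {1..n} \<longleftrightarrow> inj_on \<beta> {1..n}"
    using assms(1) by (auto simp: inj_on_def inv_tuple_def)
  show ?thesis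
  proof (cases "inj_on \<beta> {1..n}")
    case True
    hence "schur n m (inv_tuple n \<beta>) = Determinant.det (schur_num_mat n m (inv_tuple n \<beta>)) / vdet n (inv_tuple n \<beta>)"
      using inj by (simp add: schur_def schur_ratio_def vdet_def)
    moreover have "vdet n (inv_tuple n \<beta>) \<noteq> 0" using True inj vdet_eq_0_iff by blast
    ultimately have "schur n m (inv_tuple n \<beta>) * (vdet n (inv_tuple n \<beta>) * vdet n \<beta>) =
        vdet n \<beta> * Determinant.det (schur_num_mat n m (inv_tuple n \<beta>))" by simp
    thus ?thesis by (simp only: vdet_mult_vdet_inv[OF assms])
  next
    case False
    hence "vdet n \<beta> = 0" using vdet_eq_0_iff by blast
    hence "schur n m (inv_tuple n \<beta>) * (vdet n (inv_tuple n \<beta>) * vdet n \<beta>) =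
        vdet n \<beta> * Determinant.det (schur_num_mat n m (inv_tuple n \<beta>))" by simp
    thus ?thesis by (simp only: vdet_mult_vdet_inv[OF assms])
  qed
qed

lemma flat_coeff_has_sum:
  assumes n: "1 \<le> n" and a: "(\<lambda>e. norm (a e)) summable_on int_tuples n"
    and G: "\<And>\<theta>. ((\<lambda>e. a e * laurent_monom n e (torus_pt n \<theta>)) has_sum H (torus_pt n \<theta>) * vdet n (torus_pt n \<theta>)) (int_tuples n)"
    and anti: "\<And>e \<sigma>. \<sigma> permutes {1..n} \<Longrightarrow> a (e \<circ> \<sigma>) = of_int (sign \<sigma>) * a e"
  shows "((\<lambda>k. a (shift_tuple n (schur_exp n m) k)) has_sum flat_coeff n H m) UNIV"
proof -
  let ?E = "schur_exp n m" and ?P = "{\<sigma>. \<sigma> permutes {1..n}}" and ?c = "complex_of_real ((2 * pi) ^ (n - 1))"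
  define F where "F f = (\<lambda>\<theta>. (H (torus_pt n \<theta>) * vdet n (torus_pt n \<theta>)) * laurent_monom n (\<lambda>i. - f i) (torus_pt n \<theta>))"
    for f :: "nat \<Rightarrow> int"
  have int: "integrable (angle_measure n) (F f)" for f
    unfolding F_def by (rule torus_fourier_coeff(1)[OF n a G])
  have coeff: "((\<lambda>k. ?c * a (shift_tuple n f k)) has_sum integral\<^sup>L (angle_measure n) (F f)) UNIV" for f
    unfolding F_def by (rule torus_fourier_coeff(2)[OF n a G])
  \<comment> \<open>By uniqueness of sums, antisymmetry passes from the coefficients to the
    integrals. After multiplication by the signs all n! permutations contribute equally, which
    cancels the 1/n! in the definition.\<close>
  have perm: "integral\<^sup>L (angle_measure n) (F (?E \<circ> \<sigma>)) = of_int (sign \<sigma>) * integral\<^sup>L (angle_measure n) (F ?E)"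
    if "\<sigma> \<in> ?P" for \<sigma>
  proof -
    have \<sigma>: "\<sigma> permutes {1..n}" using that by simp
    have "((\<lambda>k. ?c * a (shift_tuple n (?E \<circ> \<sigma>) k)) has_sum of_int (sign \<sigma>) * integral\<^sup>L (angle_measure n) (F ?E)) UNIV"
      using has_sum_cmult_right[OF coeff[of ?E], of "of_int (sign \<sigma>)"]
      by (simp add: shift_tuple_permute[OF \<sigma>] anti[OF \<sigma>] mult_ac)
    thus ?thesis using coeff[of "?E \<circ> \<sigma>"] has_sum_unique by blast
  qed
  have integrand: "H (torus_pt n \<theta>) * schur n m (inv_tuple n (torus_pt n \<theta>)) *
        (\<Prod>i\<in>{1..n}. \<Prod>j\<in>{1..n} - {i}. torus_pt n \<theta> i - torus_pt n \<theta> j) =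
      (\<Sum>\<sigma>\<in>?P. of_int (sign \<sigma>) * F (?E \<circ> \<sigma>) \<theta>)" for \<theta>
  proof -
    let ?\<beta> = "torus_pt n \<theta>"
    have mon: "laurent_monom n f (inv_tuple n ?\<beta>) = laurent_monom n (\<lambda>i. - f i) ?\<beta>" for f
      unfolding laurent_monom_def
      by (intro prod.cong) (auto simp: inv_tuple_def power_int_minus power_int_divide_distrib field_simps)
    have "H ?\<beta> * schur n m (inv_tuple n ?\<beta>) * (\<Prod>i\<in>{1..n}. \<Prod>j\<in>{1..n} - {i}. ?\<beta> i - ?\<beta> j)
      = H ?\<beta> * vdet n ?\<beta> * Determinant.det (schur_num_mat n m (inv_tuple n ?\<beta>))"
      using schur_times_discriminant[of n ?\<beta> m] torus_pt_nonzero[OF n] torus_pt_prod[OF n] by (simp add: mult.assoc)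
    also have "\<dots> = (\<Sum>\<sigma>\<in>?P. of_int (sign \<sigma>) * F (?E \<circ> \<sigma>) \<theta>)"
      unfolding det_schur_num_mat_sum_inv mon F_def sum_distrib_left by (intro sum.cong) (auto simp: mult_ac)
    finally show ?thesis .
  qed
  have "card ?P = fact n" using card_permutations[of "{1..n}" n] by simp
  hence "(\<Sum>\<sigma>\<in>?P. of_int (sign \<sigma>) * (of_int (sign \<sigma>) * integral\<^sup>L (angle_measure n) (F ?E))) = fact n * integral\<^sup>L (angle_measure n) (F ?E)"
    by (simp only: mult.assoc[symmetric] sign_square_complex mult_1 sum_constant of_nat_fact)
  moreover have "(\<Sum>\<sigma>\<in>?P. of_int (sign \<sigma>) * integral\<^sup>L (angle_measure n) (F (?E \<circ> \<sigma>))) =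
      (\<Sum>\<sigma>\<in>?P. of_int (sign \<sigma>) * (of_int (sign \<sigma>) * integral\<^sup>L (angle_measure n) (F ?E)))"
    by (intro sum.cong refl) (simp only: perm)
  ultimately have "(\<Sum>\<sigma>\<in>?P. of_int (sign \<sigma>) * integral\<^sup>L (angle_measure n) (F (?E \<circ> \<sigma>))) = fact n * integral\<^sup>L (angle_measure n) (F ?E)"
    by (simp only:)
  moreover have "(LINT \<theta>|angle_measure n. (\<Sum>\<sigma>\<in>?P. of_int (sign \<sigma>) * F (?E \<circ> \<sigma>) \<theta>)) =
      (\<Sum>\<sigma>\<in>?P. of_int (sign \<sigma>) * integral\<^sup>L (angle_measure n) (F (?E \<circ> \<sigma>)))"
    by (subst Bochner_Integration.integral_sum, intro integrable_mult_right int) simp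
  ultimately have "flat_coeff n H m = complex_of_real (1 / (fact n * (2 * pi) ^ (n - 1))) * (fact n * integral\<^sup>L (angle_measure n) (F ?E))"
    unfolding flat_coeff_def integrand by simp
  also have "\<dots> = integral\<^sup>L (angle_measure n) (F ?E) / ?c" by simp
  finally have fc: "flat_coeff n H m = integral\<^sup>L (angle_measure n) (F ?E) / ?c" .
  show ?thesis
    using has_sum_cmult_right[OF coeff[of ?E], of "1 / ?c"] by (simp add: fc)
qed

section \<open>Exponents with distinct entries and their decreasing rearrangements\<close>

definition decreasing_on_upto :: "nat \<Rightarrow> (nat \<Rightarrow> int) \<Rightarrow> bool" where
  "decreasing_on_upto n s \<longleftrightarrow> (\<forall>i j. 1 \<le> i \<longrightarrow> i < j \<longrightarrow> j \<le> n \<longrightarrow> s j < s i)"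

text \<open>Negation turns the tuple into a strictly increasing list, which is determined by its set
  of entries.\<close>

lemma decreasing_on_upto_unique:
  assumes "decreasing_on_upto n s" "decreasing_on_upto n t" "s ` {1..n} = t ` {1..n}" "i \<in> {1..n}"
  shows "s i = t i"
proof -
  let ?L = "\<lambda>s. map (\<lambda>i. - s i) [1..<Suc n] :: int list"
  have sorted: "sorted_wrt (<) (?L s)" if "decreasing_on_upto n s" for s
    using that by (auto simp: sorted_wrt_iff_nth_less decreasing_on_upto_def simp del: upt_Suc)
  have set: "set (?L s) = uminus ` (s ` {1..n})" for s
    by (auto simp: image_image atLeastLessThanSuc_atLeastAtMost simp del: upt_Suc)
  have "?L s = ?L t" by (rule strict_sorted_equal) (use sorted assms set in auto)
  hence "\<forall>i\<in>set [1..<Suc n]. - s i = - t i" by (simp only: map_eq_conv)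
  thus ?thesis using assms(4) by (simp add: atLeastLessThanSuc_atLeastAtMost del: upt_Suc)
qed

lemma decreasing_imp_inj:
  assumes "decreasing_on_upto n s"
  shows "inj_on s {1..n}"
proof (rule linorder_inj_onI)
  fix i j assume "i < j" "i \<in> {1..n}" "j \<in> {1..n}"
  thus "s i \<noteq> s j" using assms by (force simp: decreasing_on_upto_def)
qed auto

lemma decreasing_rearrangement:
  fixes e :: "nat \<Rightarrow> int"
  assumes "inj_on e {1..n}"
  obtains s \<sigma> where "decreasing_on_upto n s" "\<sigma> permutes {1..n}" "\<And>i. i \<in> {1..n} \<Longrightarrow> e i = s (\<sigma> i)"
proof -
  define A where "A = (\<lambda>i. - e i) ` {1..n}"
  define L where "L = sorted_list_of_set A"
  have "finite A" by (simp add: A_def)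
  have "inj_on (\<lambda>i. - e i) {1..n}" by (rule inj_onI) (use assms in \<open>auto dest: inj_onD\<close>)
  from card_image[OF this] have "card A = n" by (simp add: A_def)
  hence len: "length L = n" by (simp add: L_def)
  have L: "sorted_wrt (<) L" "set L = A" using \<open>finite A\<close> by (simp_all add: L_def strict_sorted_list_of_set)
  define s where "s i = - L ! (i - 1)" for i
  have dec: "decreasing_on_upto n s"
    using L(1) len by (auto simp: decreasing_on_upto_def s_def sorted_wrt_iff_nth_less)
  have im: "s ` {1..n} = e ` {1..n}"
  proof -
    have "s ` {1..n} = uminus ` set L"
    proof
      show "s ` {1..n} \<subseteq> uminus ` set L" using len by (auto simp: s_def)
      show "uminus ` set L \<subseteq> s ` {1..n}"
      proof
        fix y assume "y \<in> uminus ` set L"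
        then obtain j where "j < n" "y = - L ! j" using len by (auto simp: in_set_conv_nth)
        thus "y \<in> s ` {1..n}" by (intro image_eqI[of _ _ "Suc j"]) (auto simp: s_def)
      qed
    qed
    thus ?thesis using L by (simp add: A_def image_image)
  qed
  have "inj_on s {1..n}" by (rule decreasing_imp_inj[OF dec])
  hence bs: "bij_betw s {1..n} (e ` {1..n})" using im by (simp add: bij_betw_def)
  have be: "bij_betw e {1..n} (e ` {1..n})" using assms by (simp add: bij_betw_def)
  define \<sigma> where "\<sigma> i = (if i \<in> {1..n} then inv_into {1..n} s (e i) else i)" for i
  have "bij_betw (inv_into {1..n} s \<circ> e) {1..n} {1..n}"
    by (rule bij_betw_trans[OF be bij_betw_inv_into[OF bs]])
  hence "bij_betw \<sigma> {1..n} {1..n}"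
    by (rule bij_betw_cong[THEN iffD1, rotated]) (simp add: \<sigma>_def)
  hence "\<sigma> permutes {1..n}" by (rule bij_imp_permutes) (auto simp: \<sigma>_def)
  moreover have "e i = s (\<sigma> i)" if "i \<in> {1..n}" for i
    using that bij_betw_inv_into_right[OF bs, of "e i"] by (simp add: \<sigma>_def)
  ultimately show ?thesis using that dec by blast
qed

lemma schur_exp_step: "i < n \<Longrightarrow> schur_exp n m i = schur_exp n m (Suc i) + 1 + m (n - i)"
  by (simp add: schur_exp_def Suc_diff_Suc[symmetric])

lemma schur_exp_last [simp]: "schur_exp n m n = 0"
  by (simp add: schur_exp_def)

lemma schur_exp_decreasing:
  assumes "dominant n m"
  shows "decreasing_on_upto n (schur_exp n m)"
  unfolding decreasing_on_upto_def
proof (intro allI impI)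
  fix i j assume "1 \<le> i" "i < j" "j \<le> n"
  from \<open>i < j\<close> \<open>j \<le> n\<close> show "schur_exp n m j < schur_exp n m i"
  proof (induction j)
    case (Suc j)
    hence "0 \<le> m (n - j)" using assms \<open>1 \<le> i\<close> by (auto simp: dominant_def)
    hence "schur_exp n m (Suc j) < schur_exp n m j" using Suc.prems by (simp add: schur_exp_step)
    thus ?case using Suc by (cases "i = j") auto
  qed simp
qed

definition dominant_pts :: "nat \<Rightarrow> (nat \<Rightarrow> int) set" where
  "dominant_pts n = {m \<in> lattice_pts n. dominant n m}"

definition exp_orbit :: "nat \<Rightarrow> (nat \<Rightarrow> int) \<times> int \<times> (nat \<Rightarrow> nat) \<Rightarrow> nat \<Rightarrow> int" where
  "exp_orbit n = (\<lambda>(m, k, \<sigma>). shift_tuple n (schur_exp n m) k \<circ> \<sigma>)"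


text \<open>Inverts the passage from gaps to exponents. The 1 removed from each gap is the step of
  the staircase, and the index n - k appears because the exponent in row j sums the gaps m_1, ...,
  m_(n-j).\<close>

lemma schur_exp_of_decreasing:
  assumes "1 \<le> n"
  defines "m \<equiv> \<lambda>s. restrict (\<lambda>k. s (n - k) - s (Suc (n - k)) - 1) {1..<n}"
  shows "decreasing_on_upto n s \<Longrightarrow> m s \<in> dominant_pts n"
    and "j \<in> {1..n} \<Longrightarrow> schur_exp n (m s) j = s j - s n"
proof -
  assume "decreasing_on_upto n s"
  thus "m s \<in> dominant_pts n"
    by (auto simp: dominant_pts_def lattice_pts_def dominant_def m_def decreasing_on_upto_def)
next
  assume j: "j \<in> {1..n}"
  hence "j \<le> n" by simp
  thus "schur_exp n (m s) j = s j - s n" using j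
  proof (induction j rule: inc_induct)
    case base
    show ?case by simp
  next
    case (step j)
    have "n - j \<in> {1..<n}" using step by auto
    moreover have "n - (n - j) = j" using step by auto
    ultimately have "m s (n - j) = s j - s (Suc j) - 1" by (simp add: m_def)
    thus ?case using step by (simp add: schur_exp_step)
  qed
qed

lemma schur_exp_inj:
  assumes "m \<in> lattice_pts n" "m' \<in> lattice_pts n" "\<And>j. j \<in> {1..n} \<Longrightarrow> schur_exp n m j = schur_exp n m' j"
  shows "m = m'"
proof
  fix k
  show "m k = m' k"
  proof (cases "k \<in> {1..<n}")
    case True
    hence "n - k < n" "n - (n - k) = k" "n - k \<in> {1..n}" "Suc (n - k) \<in> {1..n}" by auto
    thus ?thesis using schur_exp_step[of "n - k" n m] schur_exp_step[of "n - k" n m'] assms(3)[of "n - k"] assms(3)[of "Suc (n - k)"]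
      by simp
  next
    case False
    thus ?thesis using assms(1,2) by (auto simp: lattice_pts_def PiE_iff extensional_def)
  qed
qed

lemma decreasing_shift_tuple:
  assumes "dominant n m"
  shows "decreasing_on_upto n (shift_tuple n (schur_exp n m) k)"
  using schur_exp_decreasing[OF assms] by (auto simp: decreasing_on_upto_def shift_tuple_def)

text \<open>Every exponent tuple with distinct entries arises exactly once by permuting a strictly decreasing one, and a
  strictly decreasing tuple is determined by its last entry \<open>k\<close> and its gaps, which encode a dominant \<open>m\<close>.\<close>
lemma bij_betw_exp_orbit:
  assumes n: "1 \<le> n"
  shows "bij_betw (exp_orbit n) (dominant_pts n \<times> UNIV \<times> {\<sigma>. \<sigma> permutes {1..n}}) {e \<in> int_tuples n. inj_on e {1..n}}"
proof -
  let ?P = "{\<sigma>. \<sigma> permutes {1..n}}"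
  have inj: "inj_on (exp_orbit n) (dominant_pts n \<times> UNIV \<times> ?P)"
  proof (rule inj_onI)
    fix y y' assume yy: "y \<in> dominant_pts n \<times> UNIV \<times> ?P" "y' \<in> dominant_pts n \<times> UNIV \<times> ?P" "exp_orbit n y = exp_orbit n y'"
    obtain m k \<sigma> m' k' \<sigma>' where y: "y = (m, k, \<sigma>)" "y' = (m', k', \<sigma>')" by (cases y, cases y') blast
    have m: "m \<in> dominant_pts n" and m': "m' \<in> dominant_pts n" and \<sigma>: "\<sigma> permutes {1..n}" and \<sigma>': "\<sigma>' permutes {1..n}"
      and eq: "exp_orbit n (m, k, \<sigma>) = exp_orbit n (m', k', \<sigma>')"
      using yy by (auto simp: y)
    let ?s = "shift_tuple n (schur_exp n m) k" and ?t = "shift_tuple n (schur_exp n m') k'"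
    have eq': "?s (\<sigma> i) = ?t (\<sigma>' i)" for i
      using fun_cong[OF eq, of i] by (simp add: exp_orbit_def)
    have ds: "decreasing_on_upto n ?s" and dt: "decreasing_on_upto n ?t"
      using m m' by (auto simp: dominant_pts_def intro: decreasing_shift_tuple)
    have "?s ` {1..n} = (\<lambda>i. ?s (\<sigma> i)) ` {1..n}" using permutes_image[OF \<sigma>] by (simp flip: image_image)
    also have "\<dots> = ?t ` {1..n}" using permutes_image[OF \<sigma>'] by (simp add: eq' flip: image_image)
    finally have st: "?s i = ?t i" if "i \<in> {1..n}" for i
      using decreasing_on_upto_unique[OF ds dt _ that] by blast
    have "\<sigma> i = \<sigma>' i" for i
    proof (cases "i \<in> {1..n}")
      case True
      hence in1: "\<sigma> i \<in> {1..n}" "\<sigma>' i \<in> {1..n}" using permutes_in_image \<sigma> \<sigma>' by metis+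
      hence "?s (\<sigma> i) = ?s (\<sigma>' i)" using eq'[of i] st by simp
      thus ?thesis using inj_onD[OF decreasing_imp_inj[OF ds]] in1 by blast
    next
      case False
      thus ?thesis using \<sigma> \<sigma>' by (simp add: permutes_not_in)
    qed
    moreover have k: "k = k'" using st[of n] n by (simp add: shift_tuple_def)
    moreover have "m = m'"
    proof (rule schur_exp_inj[of _ n])
      fix j assume "j \<in> {1..n}"
      thus "schur_exp n m j = schur_exp n m' j" using st[of j] k by (simp add: shift_tuple_def)
    qed (use m m' in \<open>auto simp: dominant_pts_def\<close>)
    ultimately show "y = y'" by (auto simp: y)
  qed
  have "exp_orbit n ` (dominant_pts n \<times> UNIV \<times> ?P) = {e \<in> int_tuples n. inj_on e {1..n}}"
  proof (intro equalityI subsetI)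
    fix e assume "e \<in> exp_orbit n ` (dominant_pts n \<times> UNIV \<times> ?P)"
    then obtain m k \<sigma> where m: "m \<in> dominant_pts n" and \<sigma>: "\<sigma> permutes {1..n}"
      and e: "e = shift_tuple n (schur_exp n m) k \<circ> \<sigma>" by (auto simp: exp_orbit_def)
    have "inj_on (shift_tuple n (schur_exp n m) k) (\<sigma> ` {1..n})"
      unfolding permutes_image[OF \<sigma>] using m
      by (intro decreasing_imp_inj decreasing_shift_tuple) (simp add: dominant_pts_def)
    hence "inj_on e {1..n}" unfolding e by (intro comp_inj_on permutes_inj_on[OF \<sigma>])
    thus "e \<in> {e \<in> int_tuples n. inj_on e {1..n}}"
      unfolding e using comp_permutes_int_tuples[OF shift_tuple_in \<sigma>] by simp
  next
    fix e assume "e \<in> {e \<in> int_tuples n. inj_on e {1..n}}"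
    hence e: "e \<in> int_tuples n" "inj_on e {1..n}" by auto
    obtain s \<sigma> where s: "decreasing_on_upto n s" and \<sigma>: "\<sigma> permutes {1..n}" and es: "\<And>i. i \<in> {1..n} \<Longrightarrow> e i = s (\<sigma> i)"
      using decreasing_rearrangement[OF e(2)] by blast
    define m where "m = restrict (\<lambda>k. s (n - k) - s (Suc (n - k)) - 1) {1..<n}"
    have m: "m \<in> dominant_pts n" and ms: "\<And>j. j \<in> {1..n} \<Longrightarrow> schur_exp n m j = s j - s n"
      unfolding m_def using schur_exp_of_decreasing[OF n] s by blast+
    have "exp_orbit n (m, s n, \<sigma>) = e"
    proof
      fix i
      show "exp_orbit n (m, s n, \<sigma>) i = e i"
      proof (cases "i \<in> {1..n}")
        case True
        hence "\<sigma> i \<in> {1..n}" using permutes_in_image[OF \<sigma>] by blast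
        thus ?thesis using ms[of "\<sigma> i"] es[OF True] by (simp add: exp_orbit_def shift_tuple_def)
      next
        case False
        thus ?thesis using e(1) permutes_not_in[OF \<sigma>]
          by (auto simp: exp_orbit_def shift_tuple_def int_tuples_def PiE_iff extensional_def)
      qed
    qed
    thus "e \<in> exp_orbit n ` (dominant_pts n \<times> UNIV \<times> ?P)"
      using m \<sigma> by (intro image_eqI[of _ _ "(m, s n, \<sigma>)"]) auto
  qed
  with inj show ?thesis by (simp add: bij_betw_def)
qed

text \<open>Transposing two equal entries fixes e and changes the sign of its coefficient.\<close>

lemma antisymmetric_eq_0:
  fixes a :: "(nat \<Rightarrow> int) \<Rightarrow> complex"
  assumes "\<And>e \<sigma>. \<sigma> permutes {1..n} \<Longrightarrow> a (e \<circ> \<sigma>) = of_int (sign \<sigma>) * a e" "\<not> inj_on e {1..n}"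
  shows "a e = 0"
proof -
  obtain i j where ij: "i \<in> {1..n}" "j \<in> {1..n}" "i \<noteq> j" "e i = e j"
    using assms(2) by (auto simp: inj_on_def)
  have "e \<circ> Transposition.transpose i j = e" using ij by (auto simp: fun_eq_iff Transposition.transpose_def)
  moreover have "Transposition.transpose i j permutes {1..n}" by (rule permutes_swap_id) (use ij in auto)
  ultimately have "a e = - a e"
    using assms(1)[of "Transposition.transpose i j" e] ij by (simp add: sign_swap_id)
  thus ?thesis by simp
qed

text \<open>For fixed m, the sum over permutations rebuilds the alternant and the sum over shifts
  rebuilds c m. The majorant T m is the weighted absolute sum of all coefficients in the block of m;
  it depends on \<rho> but not on x, as the passage to degenerate points requires.\<close>

lemma alternant_regroup:
  assumes n: "1 \<le> n" and \<rho>: "0 < \<rho>"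
    and a: "(\<lambda>e. norm (a e) * ring_weight n \<rho> e) summable_on int_tuples n"
    and anti: "\<And>e \<sigma>. \<sigma> permutes {1..n} \<Longrightarrow> a (e \<circ> \<sigma>) = of_int (sign \<sigma>) * a e"
    and G: "\<And>x. x \<in> {1..n} \<rightarrow>\<^sub>E closed_ring \<rho> \<Longrightarrow> ((\<lambda>e. a e * laurent_monom n e x) has_sum G x) (int_tuples n)"
    and c: "\<And>m. m \<in> dominant_pts n \<Longrightarrow> ((\<lambda>k. a (shift_tuple n (schur_exp n m) k)) has_sum c m) UNIV"
  obtains T where "T summable_on dominant_pts n"
    "\<And>x m. x \<in> {1..n} \<rightarrow>\<^sub>E closed_ring \<rho> \<Longrightarrow> (\<Prod>i\<in>{1..n}. x i) = 1 \<Longrightarrow> m \<in> dominant_pts n \<Longrightarrow>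
        norm (c m * Determinant.det (schur_num_mat n m x)) \<le> T m"
    "\<And>x. x \<in> {1..n} \<rightarrow>\<^sub>E closed_ring \<rho> \<Longrightarrow> (\<Prod>i\<in>{1..n}. x i) = 1 \<Longrightarrow>
        ((\<lambda>m. c m * Determinant.det (schur_num_mat n m x)) has_sum G x) (dominant_pts n)"
proof -
  let ?D = "dominant_pts n" and ?P = "{\<sigma>. \<sigma> permutes {1..n}}" and ?\<Phi> = "exp_orbit n"
  define w where "w e = norm (a e) * ring_weight n \<rho> e" for e
  have finP: "finite ?P" by (simp add: finite_permutations)
  have "w summable_on {e \<in> int_tuples n. inj_on e {1..n}}"
    unfolding w_def by (rule summable_on_subset_banach[OF a]) auto
  hence w\<Phi>: "(\<lambda>y. w (?\<Phi> y)) summable_on (?D \<times> UNIV \<times> ?P)"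
    by (subst summable_on_reindex_bij_betw[OF bij_betw_exp_orbit[OF n], where f = w])
  hence w\<Phi>': "(\<lambda>(m, y). w (?\<Phi> (m, y))) summable_on (?D \<times> UNIV \<times> ?P)"
    by (simp only: case_prod_unfold prod.collapse)
  define T where "T m = (\<Sum>\<^sub>\<infinity>y\<in>UNIV \<times> ?P. w (?\<Phi> (m, y)))" for m
  have w1: "(\<lambda>y. w (?\<Phi> (m, y))) summable_on UNIV \<times> ?P" if "m \<in> ?D" for m
    by (rule summable_on_SigmaD1[OF w\<Phi>' that])
  have T: "T summable_on ?D"
    unfolding T_def by (rule summable_on_Sigma_banach[OF w\<Phi>'])
  have main: "norm (c m * Determinant.det (schur_num_mat n m x)) \<le> T m"
       "((\<lambda>y. a (?\<Phi> (m, y)) * laurent_monom n (?\<Phi> (m, y)) x) has_sum c m * Determinant.det (schur_num_mat n m x)) (UNIV \<times> ?P)"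
    if x: "x \<in> {1..n} \<rightarrow>\<^sub>E closed_ring \<rho>" and px: "(\<Prod>i\<in>{1..n}. x i) = 1" and m: "m \<in> ?D" for x m
  proof -
    let ?f = "\<lambda>y. a (?\<Phi> (m, y)) * laurent_monom n (?\<Phi> (m, y)) x"
    have bound: "norm (?f y) \<le> w (?\<Phi> (m, y))" for y
      unfolding w_def norm_mult by (intro mult_left_mono norm_laurent_monom_le x \<rho>) auto
    have nz: "x i \<noteq> 0" if "i \<in> {1..n}" for i
      using px that by (metis finite_atLeastAtMost prod_zero zero_neq_one)
    have "(\<lambda>y. norm (?f y)) summable_on UNIV \<times> ?P"
      by (rule Infinite_Sum.abs_summable_on_comparison_test'[OF w1[OF m] bound])
    hence fs: "?f summable_on UNIV \<times> ?P" by (rule abs_summable_summable)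
    \<comment> \<open>The shift contributes the factor (x_1 ... x_n)^k = 1, so k survives only in
      the coefficient and the block splits as a product.\<close>
    have term_eq: "?f (k, \<sigma>) = a (shift_tuple n (schur_exp n m) k) * (of_int (sign \<sigma>) * laurent_monom n (schur_exp n m \<circ> \<sigma>) x)"
      if "\<sigma> \<in> ?P" for k \<sigma>
    proof -
      have \<sigma>: "\<sigma> permutes {1..n}" using that by simp
      have "laurent_monom n (?\<Phi> (m, k, \<sigma>)) x = (\<Prod>i\<in>{1..n}. x i powi schur_exp n m (\<sigma> i) * x i powi k)"
        unfolding laurent_monom_def exp_orbit_def
      proof (rule prod.cong)
        fix i assume i: "i \<in> {1..n}"
        hence "\<sigma> i \<in> {1..n}" using permutes_in_image[OF \<sigma>] by blast
        thus "x i powi (case (m, k, \<sigma>) of (m, k, \<sigma>) \<Rightarrow> shift_tuple n (schur_exp n m) k \<circ> \<sigma>) i =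
            x i powi schur_exp n m (\<sigma> i) * x i powi k"
          using nz[OF i] by (simp add: shift_tuple_def power_int_add)
      qed simp
      also have "\<dots> = laurent_monom n (schur_exp n m \<circ> \<sigma>) x * (\<Prod>i\<in>{1..n}. x i) powi k"
        by (simp add: laurent_monom_def prod.distrib powi_prod)
      finally show ?thesis using px anti[OF \<sigma>] by (simp add: exp_orbit_def mult_ac)
    qed
    have inner: "((\<lambda>\<sigma>. ?f (k, \<sigma>)) has_sum a (shift_tuple n (schur_exp n m) k) * Determinant.det (schur_num_mat n m x)) ?P" for k
      unfolding det_schur_num_mat_sum_inv sum_distrib_left
      by (rule has_sum_finiteI[OF finP]) (intro sum.cong refl term_eq[symmetric])
    have "((\<lambda>k. a (shift_tuple n (schur_exp n m) k) * Determinant.det (schur_num_mat n m x)) has_sum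
        c m * Determinant.det (schur_num_mat n m x)) UNIV"
      by (rule has_sum_cmult_left[OF c[OF m]])
    with inner fs show S: "(?f has_sum c m * Determinant.det (schur_num_mat n m x)) (UNIV \<times> ?P)"
      by (intro has_sum_SigmaI[where g = "\<lambda>k. a (shift_tuple n (schur_exp n m) k) * Determinant.det (schur_num_mat n m x)"]) auto
    show "norm (c m * Determinant.det (schur_num_mat n m x)) \<le> T m"
      unfolding T_def by (rule norm_infsum_le[OF S has_sum_infsum[OF w1[OF m]] bound])
  qed
  show ?thesis
  proof (rule that[OF T main(1)])
    fix x assume x: "x \<in> {1..n} \<rightarrow>\<^sub>E closed_ring \<rho>" and px: "(\<Prod>i\<in>{1..n}. x i) = 1"
    have "((\<lambda>e. a e * laurent_monom n e x) has_sum G x) {e \<in> int_tuples n. inj_on e {1..n}}"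
      by (rule has_sum_cong_neutral[THEN iffD1, OF _ _ _ G[OF x]]) (auto intro: antisymmetric_eq_0[OF anti])
    hence "((\<lambda>y. a (?\<Phi> y) * laurent_monom n (?\<Phi> y) x) has_sum G x) (?D \<times> UNIV \<times> ?P)"
      by (subst has_sum_reindex_bij_betw[OF bij_betw_exp_orbit[OF n], where f = "\<lambda>e. a e * laurent_monom n e x"])
    thus "((\<lambda>m. c m * Determinant.det (schur_num_mat n m x)) has_sum G x) ?D"
      by (rule has_sum_Sigma') (rule main(2)[OF x px])
  qed
qed

section \<open>Degenerate points and the inversion formula\<close>

text \<open>The Weierstrass M-test for unordered sums: the tails of b bound the tails of the series
  uniformly on S.\<close>

lemma continuous_on_infsum_dominated:
  fixes f :: "'i \<Rightarrow> 'a::topological_space \<Rightarrow> complex"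
  assumes cont: "\<And>i. i \<in> I \<Longrightarrow> continuous_on S (f i)"
    and b: "\<And>i x. i \<in> I \<Longrightarrow> x \<in> S \<Longrightarrow> norm (f i x) \<le> b i" and bs: "b summable_on I"
  shows "continuous_on S (\<lambda>x. infsum (\<lambda>i. f i x) I)"
proof (rule uniform_limit_theorem)
  show "\<forall>\<^sub>F F in finite_subsets_at_top I. continuous_on S (\<lambda>x. \<Sum>i\<in>F. f i x)"
    by (rule eventually_finite_subsets_at_top_weakI) (auto intro!: continuous_on_sum cont)
  show "uniform_limit S (\<lambda>F x. \<Sum>i\<in>F. f i x) (\<lambda>x. infsum (\<lambda>i. f i x) I) (finite_subsets_at_top I)"
  proof (rule uniform_limitI)
    fix \<epsilon> :: real assume "\<epsilon> > 0"
    have "((\<lambda>F. infsum b I - sum b F) \<longlongrightarrow> 0) (finite_subsets_at_top I)"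
      using tendsto_diff[OF tendsto_const[of "infsum b I"] infsum_tendsto[OF bs]] by simp
    hence "\<forall>\<^sub>F F in finite_subsets_at_top I. infsum b I - sum b F < \<epsilon>"
      by (rule order_tendstoD(2)) fact
    moreover have "\<forall>\<^sub>F F in finite_subsets_at_top I. finite F \<and> F \<subseteq> I"
      by (rule eventually_finite_subsets_at_top_weakI) auto
    ultimately show "\<forall>\<^sub>F F in finite_subsets_at_top I. \<forall>x\<in>S. dist (\<Sum>i\<in>F. f i x) (infsum (\<lambda>i. f i x) I) < \<epsilon>"
    proof eventually_elim
      case (elim F)
      show ?case
      proof
        fix x assume "x \<in> S"
        have "(\<lambda>i. norm (f i x)) summable_on I"
          by (rule Infinite_Sum.abs_summable_on_comparison_test'[OF bs]) (use b \<open>x \<in> S\<close> in auto)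
        from has_sum_infsum[OF abs_summable_summable[OF this]] have "norm (infsum (\<lambda>i. f i x) I - (\<Sum>i\<in>F. f i x)) \<le> infsum b I - sum b F"
          by (rule norm_has_sum_tail_le) (use b[OF _ \<open>x \<in> S\<close>] bs elim in auto)
        thus "dist (\<Sum>i\<in>F. f i x) (infsum (\<lambda>i. f i x) I) < \<epsilon>"
          using elim by (simp add: dist_norm norm_minus_commute)
      qed
    qed
  qed
qed simp

text \<open>The weights \<open>2 k - (n + 1)\<close> are distinct and sum to zero, so that the curve stays in \<open>\<alpha>\<^sub>1 \<cdots> \<alpha>\<^sub>n = 1\<close> and has
  distinct coordinates for small \<open>z \<noteq> 0\<close>.\<close>
definition spread_curve :: "nat \<Rightarrow> (nat \<Rightarrow> complex) \<Rightarrow> complex \<Rightarrow> nat \<Rightarrow> complex" where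
  "spread_curve n \<alpha> z = (\<lambda>k. if k \<in> {1..n} then \<alpha> k * exp (z * (2 * of_nat k - of_nat (n + 1))) else undefined)"

lemma spread_curve_0:
  assumes "\<alpha> \<in> {1..n} \<rightarrow>\<^sub>E U"
  shows "spread_curve n \<alpha> 0 = \<alpha>"
  using assms by (auto simp: spread_curve_def fun_eq_iff PiE_iff extensional_def)

lemma holomorphic_spread_curve: "(\<lambda>z. spread_curve n \<alpha> z k) holomorphic_on S"
  unfolding spread_curve_def by (cases "k \<in> {1..n}") (auto intro!: holomorphic_intros)

lemma continuous_on_spread_curve: "continuous_on S (spread_curve n \<alpha>)"
  by (rule continuous_on_coordinatewise_then_product)
     (rule holomorphic_on_imp_continuous_on[OF holomorphic_spread_curve])

lemma prod_spread_curve: "(\<Prod>k\<in>{1..n}. spread_curve n \<alpha> z k) = (\<Prod>k\<in>{1..n}. \<alpha> k)"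
proof -
  have "(\<Sum>k\<in>{1..n}. 2 * of_nat k - of_nat (n + 1) :: complex) = 0"
  proof -
    have "(\<Sum>k\<in>{1..n}. of_nat k :: complex) = of_nat n * (of_nat n + 1) / 2"
      by (induction n) (auto simp: field_simps)
    moreover have "(\<Sum>k\<in>{1..n}. 2 * of_nat k - of_nat (n + 1) :: complex) = 2 * (\<Sum>k\<in>{1..n}. of_nat k) - of_nat n * of_nat (n + 1)"
      by (simp add: sum_subtractf sum_distrib_left)
    ultimately show ?thesis by (simp add: field_simps)
  qed
  hence "(\<Sum>k\<in>{1..n}. z * (2 * of_nat k - of_nat (n + 1))) = 0" by (simp only: sum_distrib_left[symmetric]) simp
  hence "(\<Prod>k\<in>{1..n}. exp (z * (2 * of_nat k - of_nat (n + 1)))) = 1" by (simp only: exp_sum[symmetric] finite_atLeastAtMost) simp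
  moreover have "(\<Prod>k\<in>{1..n}. spread_curve n \<alpha> z k) = (\<Prod>k\<in>{1..n}. \<alpha> k) * (\<Prod>k\<in>{1..n}. exp (z * (2 * of_nat k - of_nat (n + 1))))"
    unfolding prod.distrib[symmetric] by (intro prod.cong) (auto simp: spread_curve_def)
  ultimately show ?thesis by simp
qed

text \<open>Coordinates that differ at z = 0 remain different by continuity. Equal ones are
  separated by the exponentials, whose arguments differ by 2z(k - l): nonzero, and for small z too
  short to be a period of exp.\<close>

lemma eventually_inj_spread_curve:
  assumes "\<And>k. k \<in> {1..n} \<Longrightarrow> \<alpha> k \<noteq> 0"
  shows "\<forall>\<^sub>F z in at 0. inj_on (spread_curve n \<alpha> z) {1..n}"
proof -
  have "\<forall>\<^sub>F z in at 0. k \<noteq> l \<longrightarrow> spread_curve n \<alpha> z k \<noteq> spread_curve n \<alpha> z l"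
    if kl: "k \<in> {1..n}" "l \<in> {1..n}" for k l
  proof (cases "\<alpha> k = \<alpha> l")
    case False
    have "((\<lambda>z. spread_curve n \<alpha> z j) \<longlongrightarrow> \<alpha> j) (at 0)" if "j \<in> {1..n}" for j
      using that unfolding spread_curve_def by (auto intro!: tendsto_eq_intros)
    hence "((\<lambda>z. spread_curve n \<alpha> z k - spread_curve n \<alpha> z l) \<longlongrightarrow> \<alpha> k - \<alpha> l) (at 0)"
      using kl by (intro tendsto_diff) auto
    from tendsto_imp_eventually_ne[OF this, of 0] False show ?thesis by (auto elim!: eventually_mono)
  next
    case True
    define c :: complex where "c = 2 * of_nat k - 2 * of_nat l"
    have "((\<lambda>z. z * c) \<longlongrightarrow> 0) (at 0)" by (auto intro!: tendsto_eq_intros)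
    hence "\<forall>\<^sub>F z in at 0. dist (z * c) 0 < 2 * pi" by (rule tendstoD) simp
    moreover have "\<forall>\<^sub>F z::complex in at 0. z \<noteq> 0" by (simp add: eventually_at_filter)
    ultimately show ?thesis
    proof eventually_elim
      case (elim z)
      show ?case
      proof (intro impI notI)
        assume ne: "k \<noteq> l" and eq: "spread_curve n \<alpha> z k = spread_curve n \<alpha> z l"
        let ?e = "\<lambda>j. z * (2 * of_nat j - of_nat (n + 1)) :: complex"
        have "exp (?e k) = exp (?e l)"
          using eq kl True assms[OF kl(1)] by (simp add: spread_curve_def)
        have ec: "?e k - ?e l = z * c" by (simp add: c_def algebra_simps)
        hence "Im (?e k) - Im (?e l) = Im (z * c)" by (simp only: minus_complex.sel(2)[symmetric])
        hence "\<bar>Im (?e k) - Im (?e l)\<bar> < 2 * pi"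
          using abs_Im_le_cmod[of "z * c"] elim(1) by (simp only: dist_norm diff_zero)
        from exp_complex_eqI[OF this \<open>exp (?e k) = exp (?e l)\<close>] have "z * c = 0"
          unfolding ec[symmetric] by (simp only: diff_self)
        thus False using elim(2) ne by (simp add: c_def)
      qed
    qed
  qed
  hence "\<forall>\<^sub>F z in at 0. \<forall>k\<in>{1..n}. \<forall>l\<in>{1..n}. k \<noteq> l \<longrightarrow> spread_curve n \<alpha> z k \<noteq> spread_curve n \<alpha> z l"
    by (intro eventually_ball_finite finite_atLeastAtMost ballI)
  thus ?thesis by eventually_elim (auto simp: inj_on_def)
qed

lemma eventually_spread_curve_in:
  assumes "\<alpha> \<in> {1..n} \<rightarrow>\<^sub>E U" "open U"
  shows "\<forall>\<^sub>F z in at 0. spread_curve n \<alpha> z \<in> {1..n} \<rightarrow>\<^sub>E U"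
proof -
  have "\<forall>\<^sub>F z in at 0. spread_curve n \<alpha> z k \<in> U" if "k \<in> {1..n}" for k
  proof -
    have "((\<lambda>z. spread_curve n \<alpha> z k) \<longlongrightarrow> \<alpha> k) (at 0)"
      using that unfolding spread_curve_def by (auto intro!: tendsto_eq_intros)
    thus ?thesis by (rule topological_tendstoD) (use assms that in auto)
  qed
  hence "\<forall>\<^sub>F z in at 0. \<forall>k\<in>{1..n}. spread_curve n \<alpha> z k \<in> U"
    by (intro eventually_ball_finite) auto
  thus ?thesis by eventually_elim (auto simp: PiE_iff extensional_def spread_curve_def)
qed

text \<open>Off the diagonal the quotient is the polynomial, so the limit defining
  \<open>schur\<close> at a coincident tuple is found by continuity, once that tuple is known to be
  an accumulation point of tuples with distinct entries. The spread curve shows this.\<close>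

lemma schur_eq_schur_poly:
  assumes m: "dominant n m" and \<alpha>: "\<alpha> \<in> {1..n} \<rightarrow>\<^sub>E - {0}"
  shows "schur n m \<alpha> = schur_poly n m \<alpha>"
proof (cases "inj_on \<alpha> {1..n}")
  case True
  thus ?thesis by (simp add: schur_def schur_ratio_eq[OF m])
next
  case False
  let ?F = "at \<alpha> within distinct_nonzero n"
  have "filterlim (spread_curve n \<alpha>) ?F (at 0)"
    unfolding filterlim_at
  proof
    have "\<forall>\<^sub>F z in at 0. spread_curve n \<alpha> z \<in> {1..n} \<rightarrow>\<^sub>E - {0}"
      by (rule eventually_spread_curve_in[OF \<alpha>]) auto
    moreover have "\<forall>\<^sub>F z in at 0. inj_on (spread_curve n \<alpha> z) {1..n}"
      by (rule eventually_inj_spread_curve) (use \<alpha> in auto)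
    ultimately show "\<forall>\<^sub>F z in at 0. spread_curve n \<alpha> z \<in> distinct_nonzero n \<and> spread_curve n \<alpha> z \<noteq> \<alpha>"
      by eventually_elim (use False in \<open>auto simp: distinct_nonzero_def\<close>)
    have "isCont (spread_curve n \<alpha>) 0"
      using continuous_on_spread_curve[of UNIV n \<alpha>] by (simp add: continuous_on_eq_continuous_within)
    thus "(spread_curve n \<alpha> \<longlongrightarrow> \<alpha>) (at 0)" using spread_curve_0[OF \<alpha>] by (simp add: isCont_def)
  qed
  \<comment> \<open>A filter into which a map converges along the nontrivial filter
    \<open>at 0\<close> is itself nontrivial; otherwise \<open>Lim\<close> would not pin down a
    value.\<close>
  hence nontriv: "?F \<noteq> bot"
    unfolding filterlim_def by (metis at_neq_bot bot_unique filtermap_bot_iff)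
  have "(schur_poly n m \<longlongrightarrow> schur_poly n m \<alpha>) ?F"
  proof -
    have "(schur_poly n m \<longlongrightarrow> schur_poly n m \<alpha>) (at \<alpha> within UNIV)"
      using continuous_on_schur_poly[of UNIV n m] by (simp add: continuous_on_def)
    thus ?thesis by (rule tendsto_within_subset) simp
  qed
  moreover have "\<forall>\<^sub>F x in ?F. schur_poly n m x = schur_ratio n m x"
    unfolding eventually_at_filter by (intro always_eventually) (auto simp: distinct_nonzero_def schur_ratio_eq[OF m])
  ultimately have "(schur_ratio n m \<longlongrightarrow> schur_poly n m \<alpha>) ?F"
    by (rule Lim_transform_eventually)
  hence "Lim ?F (schur_ratio n m) = schur_poly n m \<alpha>" by (rule tendsto_Lim[OF nontriv])
  thus ?thesis using False by (simp add: schur_def)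
qed

lemma schur_poly_expansion:
  assumes R: "1 < R" and \<alpha>: "\<alpha> \<in> {1..n} \<rightarrow>\<^sub>E open_ring R" "(\<Prod>k\<in>{1..n}. \<alpha> k) = 1"
    and H: "continuous_on ({1..n} \<rightarrow>\<^sub>E open_ring R) H"
    and exp: "\<And>\<rho>. 1 < \<rho> \<Longrightarrow> \<rho> < R \<Longrightarrow> \<exists>T. T summable_on dominant_pts n \<and>
      (\<forall>x\<in>{1..n} \<rightarrow>\<^sub>E closed_ring \<rho>. (\<Prod>i\<in>{1..n}. x i) = 1 \<longrightarrow>
        (\<forall>m\<in>dominant_pts n. norm (c m * Determinant.det (schur_num_mat n m x)) \<le> T m) \<and>
        ((\<lambda>m. c m * Determinant.det (schur_num_mat n m x)) has_sum H x * vdet n x) (dominant_pts n))"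
  shows "((\<lambda>m. c m * schur_poly n m \<alpha>) has_sum H \<alpha>) (dominant_pts n)"
proof -
  let ?D = "dominant_pts n" and ?\<gamma> = "spread_curve n \<alpha>"
  obtain \<sigma> where \<sigma>: "1 < \<sigma>" "\<sigma> < R" "\<alpha> \<in> {1..n} \<rightarrow>\<^sub>E closed_ring \<sigma>"
    using tuple_in_closed_ring[OF \<alpha>(1) R] .
  obtain \<rho> where \<rho>: "\<sigma> < \<rho>" "\<rho> < R" using dense \<sigma> by blast
  have sub: "open_ring \<rho> \<subseteq> closed_ring \<rho>" "open_ring \<rho> \<subseteq> open_ring R"
  proof -
    show "open_ring \<rho> \<subseteq> closed_ring \<rho>" by (auto simp: open_ring_def closed_ring_def)
    thus "open_ring \<rho> \<subseteq> open_ring R" using closed_ring_subset_open_ring[of \<rho> R] \<rho> \<sigma> by auto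
  qed
  have \<alpha>\<rho>: "\<alpha> \<in> {1..n} \<rightarrow>\<^sub>E open_ring \<rho>"
    using \<sigma>(3) closed_ring_subset_open_ring[of \<sigma> \<rho>] \<sigma> \<rho> by (auto simp: PiE_iff)
  obtain T where T: "T summable_on ?D"
    and bound: "\<And>x m. x \<in> {1..n} \<rightarrow>\<^sub>E closed_ring \<rho> \<Longrightarrow> (\<Prod>i\<in>{1..n}. x i) = 1 \<Longrightarrow> m \<in> ?D \<Longrightarrow>
        norm (c m * Determinant.det (schur_num_mat n m x)) \<le> T m"
    and sum: "\<And>x. x \<in> {1..n} \<rightarrow>\<^sub>E closed_ring \<rho> \<Longrightarrow> (\<Prod>i\<in>{1..n}. x i) = 1 \<Longrightarrow>
        ((\<lambda>m. c m * Determinant.det (schur_num_mat n m x)) has_sum H x * vdet n x) ?D"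
  proof -
    have "1 < \<rho>" using \<rho> \<sigma> by simp
    from exp[OF this \<rho>(2)] show ?thesis using that by blast
  qed
  have nz: "\<alpha> k \<noteq> 0" if "k \<in> {1..n}" for k
    using PiE_mem[OF \<alpha>(1) that] zero_notin_open_ring[of R] R by auto
  have "\<forall>\<^sub>F z in at 0. ?\<gamma> z \<in> {1..n} \<rightarrow>\<^sub>E open_ring \<rho> \<and> inj_on (?\<gamma> z) {1..n}"
    by (intro eventually_conj eventually_spread_curve_in \<alpha>\<rho> open_open_ring eventually_inj_spread_curve nz)
  then obtain d where d: "0 < d" and good: "\<And>z. z \<noteq> 0 \<Longrightarrow> dist z 0 < d \<Longrightarrow> ?\<gamma> z \<in> {1..n} \<rightarrow>\<^sub>E open_ring \<rho> \<and> inj_on (?\<gamma> z) {1..n}"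
    unfolding eventually_at by auto
  \<comment> \<open>Half of d, so that the whole closed disc, boundary circle included, lies in the
    range where the curve is controlled.\<close>
  define r where "r = d / 2"
  have r: "0 < r" using d by (simp add: r_def)
  have in_ring: "?\<gamma> z \<in> {1..n} \<rightarrow>\<^sub>E open_ring \<rho>" if "norm z \<le> r" for z
    using good[of z] that d \<alpha>\<rho> spread_curve_0[OF \<alpha>\<rho>] by (cases "z = 0") (auto simp: r_def)
  have inj: "inj_on (?\<gamma> z) {1..n}" if "norm z \<le> r" "z \<noteq> 0" for z
    using good[of z] that d by (auto simp: r_def)
  have in_closed: "?\<gamma> z \<in> {1..n} \<rightarrow>\<^sub>E closed_ring \<rho>" if "norm z \<le> r" for z
    using in_ring[OF that] sub by (auto simp: PiE_iff)
  have in_R: "?\<gamma> ` cball 0 r \<subseteq> {1..n} \<rightarrow>\<^sub>E open_ring R"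
    using in_ring PiE_mono[of "{1..n}" "\<lambda>_. open_ring \<rho>" "\<lambda>_. open_ring R"] sub(2) by (intro image_subsetI) auto
  have prod1: "(\<Prod>k\<in>{1..n}. ?\<gamma> z k) = 1" for z using prod_spread_curve[of n \<alpha> z] \<alpha>(2) by simp
  have Vc: "continuous_on S (\<lambda>z. vdet n (?\<gamma> z))" for S
    unfolding vdet_eq node_prod_def
    by (intro continuous_on_mult continuous_on_prod continuous_on_diff continuous_on_const
        holomorphic_on_imp_continuous_on[OF holomorphic_spread_curve])
  obtain z0 where z0: "z0 \<in> sphere 0 r" "\<And>z. z \<in> sphere 0 r \<Longrightarrow> norm (vdet n (?\<gamma> z0)) \<le> norm (vdet n (?\<gamma> z))"
    using continuous_attains_inf[OF compact_sphere _ continuous_on_norm[OF Vc], of 0 r] r by auto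
  \<comment> \<open>The minimum of |V| along the curve over the circle |z| = r, positive by
    compactness because coordinates are distinct there.\<close>
  define \<delta> where "\<delta> = norm (vdet n (?\<gamma> z0))"
  have "z0 \<noteq> 0" "norm z0 \<le> r" using z0(1) r by auto
  hence \<delta>: "0 < \<delta>" using inj[of z0] vdet_eq_0_iff[of n "?\<gamma> z0"] by (simp add: \<delta>_def)
  define f where "f m z = c m * schur_poly n m (?\<gamma> z)" for m z
  have hol: "f m holomorphic_on S" for m S
    unfolding f_def by (intro holomorphic_intros holomorphic_on_schur_poly holomorphic_spread_curve)
  have fV: "f m z * vdet n (?\<gamma> z) = c m * Determinant.det (schur_num_mat n m (?\<gamma> z))" if "m \<in> ?D" for m z
    using that by (simp add: f_def det_schur_num_mat dominant_pts_def)
  \<comment> \<open>On the circle, division by \<delta> removes V from the majorant. Each term is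
    holomorphic in z, so the maximum principle carries T m / \<delta> to the centre, where V may
    vanish.\<close>
  have f_le: "norm (f m z) \<le> T m / \<delta>" if m: "m \<in> ?D" and z: "z \<in> cball 0 r" for m z
  proof (rule maximum_modulus_frontier[of "f m" "cball 0 r"])
    fix z :: complex assume "z \<in> frontier (cball 0 r)"
    hence z: "z \<in> sphere 0 r" using r by (simp add: frontier_cball)
    have "norm (f m z) * \<delta> \<le> norm (f m z) * norm (vdet n (?\<gamma> z))"
      unfolding \<delta>_def by (intro mult_left_mono z0(2) z) auto
    also have "\<dots> \<le> T m"
      using bound[OF in_closed[of z] prod1 m] z by (simp add: fV[OF m] flip: norm_mult)
    finally show "norm (f m z) \<le> T m / \<delta>" using \<delta> by (simp add: field_simps)
  qed (use z hol in \<open>auto intro: holomorphic_on_imp_continuous_on\<close>)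
  have bs: "(\<lambda>m. T m / \<delta>) summable_on ?D"
    using summable_on_cmult_right[OF T, of "1 / \<delta>"] by simp
  have summ: "(\<lambda>m. f m z) summable_on ?D" if "z \<in> cball 0 r" for z
    by (rule abs_summable_summable, rule Infinite_Sum.abs_summable_on_comparison_test'[OF bs]) (use f_le that in auto)
  define g where "g z = infsum (\<lambda>m. f m z) ?D" for z
  have "continuous_on (cball 0 r) g"
    unfolding g_def by (rule continuous_on_infsum_dominated[OF _ f_le bs])
      (auto intro: holomorphic_on_imp_continuous_on hol)
  hence "isCont g 0" using r by (simp add: continuous_on_interior interior_cball)
  hence "(g \<longlongrightarrow> g 0) (at 0)" by (simp add: isCont_def)
  moreover have gH: "g z = H (?\<gamma> z)" if z: "norm z \<le> r" "z \<noteq> 0" for z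
  proof -
    have V: "vdet n (?\<gamma> z) \<noteq> 0" using inj[OF z] vdet_eq_0_iff by blast
    have "((\<lambda>m. c m * Determinant.det (schur_num_mat n m (?\<gamma> z)) / vdet n (?\<gamma> z)) has_sum
        H (?\<gamma> z) * vdet n (?\<gamma> z) / vdet n (?\<gamma> z)) ?D"
      by (rule has_sum_divide_const[OF sum[OF in_closed[OF z(1)] prod1]])
    hence S: "((\<lambda>m. c m * Determinant.det (schur_num_mat n m (?\<gamma> z)) / vdet n (?\<gamma> z)) has_sum H (?\<gamma> z)) ?D"
      using V by simp
    have "f m z = c m * Determinant.det (schur_num_mat n m (?\<gamma> z)) / vdet n (?\<gamma> z)" if "m \<in> ?D" for m
      using V by (simp add: fV[OF that, symmetric])
    from has_sum_cong[of ?D "\<lambda>m. f m z", OF this] S have "((\<lambda>m. f m z) has_sum H (?\<gamma> z)) ?D" by simp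
    thus ?thesis unfolding g_def by (rule infsumI)
  qed
  have "(g \<longlongrightarrow> H \<alpha>) (at 0)"
  proof -
    have "continuous_on (cball 0 r) (\<lambda>z. H (?\<gamma> z))"
      by (rule continuous_on_compose2[OF H continuous_on_spread_curve in_R])
    hence "isCont (\<lambda>z. H (?\<gamma> z)) 0" using r by (simp add: continuous_on_interior interior_cball)
    hence lim: "((\<lambda>z. H (?\<gamma> z)) \<longlongrightarrow> H \<alpha>) (at 0)" using spread_curve_0[OF \<alpha>(1)] by (simp add: isCont_def)
    have "\<forall>\<^sub>F z in at 0. H (?\<gamma> z) = g z"
      unfolding eventually_at using r gH by (intro exI[of _ r]) auto
    from Lim_transform_eventually[OF lim this] show ?thesis .
  qed
  ultimately have "g 0 = H \<alpha>" by (rule LIM_unique)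
  hence "((\<lambda>m. f m 0) has_sum H \<alpha>) ?D"
    using has_sum_infsum[OF summ[of 0]] r by (simp add: g_def)
  thus ?thesis by (simp add: f_def spread_curve_0[OF \<alpha>(1)])
qed

section \<open>Removal of the modulus factors and the inversion formula\<close>

lemma annulus_eq_open_ring: "annulus p \<eta> = open_ring (real p powr \<eta>)"
  by (simp add: annulus_def open_ring_def powr_minus_divide)

lemma delta_half_measure_factor:
  assumes "0 < p"
  shows "complex_of_real (delta_half n p m) * complex_of_real (delta_half n p m) * measure_factor n p m = 1"
proof -
  let ?s = "\<Sum>k\<in>{1..<n}. real (k * (n - k)) * real_of_int (m k)"
  have "(\<Prod>k\<in>{1..<n}. real p powi (int (k * (n - k)) * m k)) = (\<Prod>k\<in>{1..<n}. real p powr (real (k * (n - k)) * real_of_int (m k)))"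
    using assms by (intro prod.cong) (auto simp flip: powr_real_of_int')
  also have "\<dots> = real p powr ?s" using assms by (subst powr_sum) auto
  finally have "delta_half n p m * delta_half n p m * (\<Prod>k\<in>{1..<n}. real p powi (int (k * (n - k)) * m k)) =
      real p powr (- ?s / 2 + - ?s / 2 + ?s)"
    by (simp only: delta_half_def powr_add)
  also have "\<dots> = 1" using assms by (simp add: field_simps)
  finally show ?thesis unfolding measure_factor_def by (simp only: of_real_mult[symmetric]) simp
qed

lemma H_flat_eq:
  assumes "dominant n m"
  shows "H_flat n p H m = complex_of_real (delta_half n p m) * flat_coeff n H m"
proof -
  have w: "whittaker n p x m = complex_of_real (delta_half n p m) * schur n m x" for x
    using assms by (simp add: whittaker_def dominant_def)
  have "(LINT \<theta>|angle_measure n. H (torus_pt n \<theta>) * whittaker n p (inv_tuple n (torus_pt n \<theta>)) m *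
        (\<Prod>i\<in>{1..n}. \<Prod>j\<in>{1..n} - {i}. torus_pt n \<theta> i - torus_pt n \<theta> j)) =
      (LINT \<theta>|angle_measure n. complex_of_real (delta_half n p m) * (H (torus_pt n \<theta>) * schur n m (inv_tuple n (torus_pt n \<theta>)) *
        (\<Prod>i\<in>{1..n}. \<Prod>j\<in>{1..n} - {i}. torus_pt n \<theta> i - torus_pt n \<theta> j)))"
    by (intro Bochner_Integration.integral_cong refl)
       (simp only: w mult_ac)
  also have "\<dots> = complex_of_real (delta_half n p m) * (LINT \<theta>|angle_measure n. H (torus_pt n \<theta>) * schur n m (inv_tuple n (torus_pt n \<theta>)) *
        (\<Prod>i\<in>{1..n}. \<Prod>j\<in>{1..n} - {i}. torus_pt n \<theta> i - torus_pt n \<theta> j))"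
    by (rule integral_mult_right_zero)
  finally show ?thesis unfolding H_flat_def flat_coeff_def by (simp only: mult_ac)
qed

theorem mainTheorem1:
  fixes n p :: nat and \<eta> :: real and H :: "(nat \<Rightarrow> complex) \<Rightarrow> complex"
  assumes "n \<ge> 2"
    and "prime p"
    and "\<eta> > 0"
    and "holomorphic_n n (annulus p \<eta>) H"
    and "symmetric_n n (annulus p \<eta>) H"
    and "\<forall>\<alpha>\<in>{1..n} \<rightarrow>\<^sub>E annulus p \<eta>.
           (\<lambda>m. norm (whittaker_summand n p (H_flat n p H) \<alpha> m)) summable_on lattice_pts n"
  shows "\<forall>\<alpha>\<in>{1..n} \<rightarrow>\<^sub>E annulus p \<eta>. (\<Prod>k\<in>{1..n}. \<alpha> k) = 1 \<longrightarrow>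
           whittaker_transform n p (H_flat n p H) \<alpha> = H \<alpha>"
proof (intro ballI impI)
  fix \<alpha> assume \<alpha>: "\<alpha> \<in> {1..n} \<rightarrow>\<^sub>E annulus p \<eta>" "(\<Prod>k\<in>{1..n}. \<alpha> k) = 1"
  define R where "R = real p powr \<eta>"
  have p: "1 < p" using assms(2) prime_gt_1_nat by blast
  hence R: "1 < R" using assms(3) by (simp add: R_def)
  have n: "1 \<le> n" using assms(1) by simp
  have ring: "annulus p \<eta> = open_ring R" by (simp add: R_def annulus_eq_open_ring)
  have H: "holomorphic_n n (open_ring R) H" "symmetric_n n (open_ring R) H" using assms(4,5) by (simp_all add: ring)
  obtain a where
    a: "\<And>\<rho>. 1 \<le> \<rho> \<Longrightarrow> \<rho> < R \<Longrightarrow> (\<lambda>e. norm (a e) * ring_weight n \<rho> e) summable_on int_tuples n"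
    and sum: "\<And>x. x \<in> {1..n} \<rightarrow>\<^sub>E open_ring R \<Longrightarrow> ((\<lambda>e. a e * laurent_monom n e x) has_sum H x * vdet n x) (int_tuples n)"
    and anti: "\<And>e \<sigma>. \<sigma> permutes {1..n} \<Longrightarrow> a (e \<circ> \<sigma>) = of_int (sign \<sigma>) * a e"
    using antisymmetric_laurent_series[OF R H] by blast
  have a1: "(\<lambda>e. norm (a e)) summable_on int_tuples n"
    using a[of 1] R by (simp add: ring_weight_def)
  have coeff: "((\<lambda>k. a (shift_tuple n (schur_exp n m) k)) has_sum flat_coeff n H m) UNIV" for m
    by (rule flat_coeff_has_sum[OF n a1 sum[OF torus_pt_in[OF R n]] anti])
  have S: "((\<lambda>m. flat_coeff n H m * schur_poly n m \<alpha>) has_sum H \<alpha>) (dominant_pts n)"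
  proof (rule schur_poly_expansion[OF R])
    show "\<alpha> \<in> {1..n} \<rightarrow>\<^sub>E open_ring R" "(\<Prod>k\<in>{1..n}. \<alpha> k) = 1" using \<alpha> by (simp_all only: ring)
    show "continuous_on ({1..n} \<rightarrow>\<^sub>E open_ring R) H" using H(1) by (simp add: holomorphic_n_def)
    fix \<rho> assume \<rho>: "1 < \<rho>" "\<rho> < R"
    have sub: "x \<in> {1..n} \<rightarrow>\<^sub>E open_ring R" if "x \<in> {1..n} \<rightarrow>\<^sub>E closed_ring \<rho>" for x
      using that closed_ring_subset_open_ring[of \<rho> R] \<rho> by (auto simp: PiE_iff)
    have \<rho>0: "0 < \<rho>" "1 \<le> \<rho>" using \<rho> by auto
    show "\<exists>T. T summable_on dominant_pts n \<and>
      (\<forall>x\<in>{1..n} \<rightarrow>\<^sub>E closed_ring \<rho>. (\<Prod>i\<in>{1..n}. x i) = 1 \<longrightarrow>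
        (\<forall>m\<in>dominant_pts n. norm (flat_coeff n H m * Determinant.det (schur_num_mat n m x)) \<le> T m) \<and>
        ((\<lambda>m. flat_coeff n H m * Determinant.det (schur_num_mat n m x)) has_sum H x * vdet n x) (dominant_pts n))"
      by (rule alternant_regroup[OF n \<rho>0(1) a[OF \<rho>0(2) \<rho>(2)] anti sum[OF sub] coeff]) blast+
  qed
  have "whittaker_summand n p (H_flat n p H) \<alpha> m = flat_coeff n H m * schur_poly n m \<alpha>"
    if "m \<in> dominant_pts n" for m
  proof -
    have m: "dominant n m" using that by (simp add: dominant_pts_def)
    have "\<alpha> \<in> {1..n} \<rightarrow>\<^sub>E - {0}" using \<alpha>(1) zero_notin_open_ring[of R] R by (auto simp: PiE_iff ring)
    hence "whittaker n p \<alpha> m = complex_of_real (delta_half n p m) * schur_poly n m \<alpha>"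
      using m schur_eq_schur_poly[OF m] by (simp add: whittaker_def dominant_def)
    hence "whittaker_summand n p (H_flat n p H) \<alpha> m =
        (complex_of_real (delta_half n p m) * complex_of_real (delta_half n p m) * measure_factor n p m) *
        (flat_coeff n H m * schur_poly n m \<alpha>)"
      by (simp only: whittaker_summand_def H_flat_eq[OF m] mult_ac)
    thus ?thesis using p by (simp only: delta_half_measure_factor) simp
  qed
  from has_sum_cong[of "dominant_pts n" "whittaker_summand n p (H_flat n p H) \<alpha>", OF this] S
  have "(whittaker_summand n p (H_flat n p H) \<alpha> has_sum H \<alpha>) (dominant_pts n)" by (rule iffD2)
  \<comment> \<open>Outside the dominant points the Whittaker function is zero, so the sum extends
    to the whole lattice.\<close>
  hence "(whittaker_summand n p (H_flat n p H) \<alpha> has_sum H \<alpha>) (lattice_pts n)"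
    by (rule has_sum_cong_neutral[THEN iffD1, rotated 3])
       (auto simp: dominant_pts_def dominant_def whittaker_summand_def whittaker_def)
  thus "whittaker_transform n p (H_flat n p H) \<alpha> = H \<alpha>"
    unfolding whittaker_transform_def by (rule infsumI)
qed

end
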